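(* Let $b=p_1^{l_1}\cdots p_s^{l_s}$ with $s\ge 2$, where $p_1,\ldots,p_s$ are distinct primes and $l_1,\ldots,l_s\geq1$ are integers. For each $i=1,\ldots,s$ let $f_i\in\mathbb{Q}_{p_i}[X]$ be a nonzero polynomial, and let $f=(f_1,\ldots,f_s)$. Let $\mathcal{R}_f=\mathcal{R}_{f_1}\times\cdots\times\mathcal{R}_{f_s}\subset\mathbb{Z}_b$, where $\mathcal{R}_{f_i}$ is the set of roots of $f_i$ in $\mathbb{Z}_{p_i}$. Then the sequence $(\mathcal{L}_b(f(n)))_{n\ge0}$ of elements of $\mathbb{Z}_b$ is (a) $k$-regular for every integer $k\ge2$ if $\mathcal{R}_f=\varnothing$; (b) strictly $b$-regular if $\mathcal{R}_f=\{\theta\}$ for some $\theta\in\mathbb{Q}\cap\mathbb{Z}_b$ and $m_{f_1}(\theta)=\cdots=m_{f_s}(\theta)$; (c) not regular otherwise.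
   Context: $\mathbb{N}=\{0,1,2,\ldots\}$. $m_{f_i}(\theta)$ denotes the multiplicity of $\theta$ as a root of $f_i$. Put $\mathbb{Z}_b=\mathbb{Z}_{p_1}\times\cdots\times\mathbb{Z}_{p_s}$ and $\mathbb{Q}_b=\mathbb{Q}_{p_1}\times\cdots\times\mathbb{Q}_{p_s}$; $\mathbb{Q}$ is identified with its diagonal image in $\mathbb{Q}_b$ under $x\mapsto(x,\ldots,x)$. For $n\in\mathbb{N}$, $f(n)=(f_1(n),\ldots,f_s(n))\in\mathbb{Q}_b$. For $x=(x_1,\ldots,x_s)\in\mathbb{Q}_b$ put $\nu_b(x)=\min_{1\le i\le s}\lfloor\nu_{p_i}(x_i)/l_i\rfloor$ (with $\nu_{p_i}(0)=+\infty$), $\mathcal{L}_b(x)=b^{-\nu_b(x)}x\in\mathbb{Z}_b$ if $x\ne0$, and $\mathcal{L}_b(0)=0$. For an integer $k\ge2$, the $k$-kernel of $\mathbf{a}=(a_n)_{n\ge0}$ is $\{(a_{k^in+j})_{n\ge0}: i\ge0,\ 0\le j\le k^i-1\}$. A sequence with values in a $\mathbb{Z}$-module $R$ is $k$-regular if the $\mathbb{Z}$-submodule of $R^{\mathbb{N}}$ generated by its $k$-kernel is finitely generated. It is regular if it is $k$-regular for some $k\ge2$. It is strictly $k$-regular if it is $k$-regular and is not $m$-regular for any integer $m\ge2$ multiplicatively independent of $k$ (i.e. with $k^a\neq m^c$ for all integers $a,c\ge1$). *)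

theory Defs
  imports Complex_Main "HOL-Library.Extended" "HOL-Computational_Algebra.Primes"
    "HOL-Algebra.Product_Groups" "HOL-Algebra.Polynomial_Divisibility"
begin

section \<open>The field of \<open>p\<close>-adic numbers\<close>

text \<open>
  \<open>\<rat>\<^sub>p\<close> is the completion of \<open>\<rat>\<close> for the \<open>p\<close>-adic absolute value: the ring of Cauchy sequences
  modulo the ideal of null sequences.  All \<open>\<rat>\<^sub>p\<close> share one carrier type, so that families of
  \<open>p\<^sub>i\<close>-adic numbers, with \<open>p\<^sub>i\<close> varying, can be formed.
\<close>

definition rat_val :: "nat \<Rightarrow> rat \<Rightarrow> int" where
  "rat_val p q = int (multiplicity (int p) (fst (quotient_of q)))
               - int (multiplicity (int p) (snd (quotient_of q)))"

definition rat_abs :: "nat \<Rightarrow> rat \<Rightarrow> real" where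
  "rat_abs p q = (if q = 0 then 0 else real p powi (- rat_val p q))"

definition padic_Cauchy :: "nat \<Rightarrow> (nat \<Rightarrow> rat) set" where
  "padic_Cauchy p = {x. \<forall>e>0. \<exists>N. \<forall>m\<ge>N. \<forall>n\<ge>N. rat_abs p (x m - x n) < e}"

definition padic_null :: "nat \<Rightarrow> (nat \<Rightarrow> rat) set" where
  "padic_null p = {x. (\<lambda>n. rat_abs p (x n)) \<longlonglongrightarrow> 0}"

definition Cauchy_ring :: "nat \<Rightarrow> (nat \<Rightarrow> rat) ring" where
  "Cauchy_ring p = \<lparr>carrier = padic_Cauchy p,
                    mult = (\<lambda>x y n. x n * y n), one = (\<lambda>n. 1),
                    zero = (\<lambda>n. 0), add = (\<lambda>x y n. x n + y n)\<rparr>"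

type_synonym padic = "(nat \<Rightarrow> rat) set"

definition Qp :: "nat \<Rightarrow> padic ring" where
  "Qp p = Cauchy_ring p Quot padic_null p"

definition padic_of_rat :: "nat \<Rightarrow> rat \<Rightarrow> padic" where
  "padic_of_rat p q = padic_null p +>\<^bsub>Cauchy_ring p\<^esub> (\<lambda>n. q)"

text \<open>
  Along a Cauchy sequence that is not a null sequence the valuation is eventually constant; this
  constant depends only on the class of the sequence.
\<close>

definition padic_val :: "nat \<Rightarrow> padic \<Rightarrow> int extended" where
  "padic_val p x = (if x = \<zero>\<^bsub>Qp p\<^esub> then \<infinity>
     else Fin (THE v. \<exists>r\<in>x. \<forall>\<^sub>F n in sequentially. r n \<noteq> 0 \<and> rat_val p (r n) = v))"

definition Zp :: "nat \<Rightarrow> padic ring" where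
  "Zp p = (Qp p)\<lparr>carrier := {x \<in> carrier (Qp p). Fin 0 \<le> padic_val p x}\<rparr>"


section \<open>The rings \<open>\<rat>\<^sub>b\<close> and \<open>\<int>\<^sub>b\<close>\<close>

definition product_ring :: "'i set \<Rightarrow> ('i \<Rightarrow> ('a, 'c) ring_scheme) \<Rightarrow> ('i \<Rightarrow> 'a) ring" where
  "product_ring I R = \<lparr>carrier = (\<Pi>\<^sub>E i\<in>I. carrier (R i)),
                       mult = (\<lambda>x y. \<lambda>i\<in>I. x i \<otimes>\<^bsub>R i\<^esub> y i), one = (\<lambda>i\<in>I. \<one>\<^bsub>R i\<^esub>),
                       zero = (\<lambda>i\<in>I. \<zero>\<^bsub>R i\<^esub>), add = (\<lambda>x y. \<lambda>i\<in>I. x i \<oplus>\<^bsub>R i\<^esub> y i)\<rparr>"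

text \<open>
  The factorisation \<open>b = p\<^sub>1^l\<^sub>1 \<cdots> p\<^sub>s^l\<^sub>s\<close> is given by \<open>s\<close> and by functions \<open>p\<close>, \<open>l\<close>, of which only
  the values on \<open>{1..s}\<close> matter.
\<close>

definition Qb :: "nat \<Rightarrow> (nat \<Rightarrow> nat) \<Rightarrow> (nat \<Rightarrow> padic) ring" where
  "Qb s p = product_ring {1..s} (\<lambda>i. Qp (p i))"

definition Zb :: "nat \<Rightarrow> (nat \<Rightarrow> nat) \<Rightarrow> (nat \<Rightarrow> padic) ring" where
  "Zb s p = product_ring {1..s} (\<lambda>i. Zp (p i))"

definition diag_rat :: "nat \<Rightarrow> (nat \<Rightarrow> nat) \<Rightarrow> rat \<Rightarrow> (nat \<Rightarrow> padic)" where
  "diag_rat s p q = (\<lambda>i\<in>{1..s}. padic_of_rat (p i) q)"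

definition nu_b :: "nat \<Rightarrow> (nat \<Rightarrow> nat) \<Rightarrow> (nat \<Rightarrow> nat) \<Rightarrow> (nat \<Rightarrow> padic) \<Rightarrow> int extended" where
  "nu_b s p l x =
     Min ((\<lambda>i. map_extended (\<lambda>v. \<lfloor>real_of_int v / real (l i)\<rfloor>) (padic_val (p i) (x i))) ` {1..s})"

definition L_b :: "nat \<Rightarrow> (nat \<Rightarrow> nat) \<Rightarrow> (nat \<Rightarrow> nat) \<Rightarrow> (nat \<Rightarrow> padic) \<Rightarrow> (nat \<Rightarrow> padic)" where
  "L_b s p l x =
     (if x = \<zero>\<^bsub>Qb s p\<^esub> then \<zero>\<^bsub>Qb s p\<^esub>
      else diag_rat s p (of_nat (\<Prod>i=1..s. p i ^ l i) powi (- (THE v. nu_b s p l x = Fin v)))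
             \<otimes>\<^bsub>Qb s p\<^esub> x)"


section \<open>Tuples of polynomials\<close>

definition eval_tuple ::
  "nat \<Rightarrow> (nat \<Rightarrow> nat) \<Rightarrow> (nat \<Rightarrow> padic list) \<Rightarrow> nat \<Rightarrow> (nat \<Rightarrow> padic)" where
  "eval_tuple s p f n = (\<lambda>i\<in>{1..s}. ring.eval (Qp (p i)) (f i) (padic_of_rat (p i) (of_nat n)))"

definition Zp_roots :: "nat \<Rightarrow> padic list \<Rightarrow> padic set" where
  "Zp_roots p g = {x \<in> carrier (Zp p). ring.is_root (Qp p) g x}"

definition Zb_roots :: "nat \<Rightarrow> (nat \<Rightarrow> nat) \<Rightarrow> (nat \<Rightarrow> padic list) \<Rightarrow> (nat \<Rightarrow> padic) set" where
  "Zb_roots s p f = (\<Pi>\<^sub>E i\<in>{1..s}. Zp_roots (p i) (f i))"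

definition unique_rational_root :: "nat \<Rightarrow> (nat \<Rightarrow> nat) \<Rightarrow> (nat \<Rightarrow> padic list) \<Rightarrow> bool" where
  "unique_rational_root s p f \<longleftrightarrow>
     (\<exists>q :: rat. diag_rat s p q \<in> carrier (Zb s p) \<and> Zb_roots s p f = {diag_rat s p q} \<and>
        (\<forall>i\<in>{1..s}. \<forall>j\<in>{1..s}.
           ring.alg_mult (Qp (p i)) (f i) (padic_of_rat (p i) q) =
           ring.alg_mult (Qp (p j)) (f j) (padic_of_rat (p j) q)))"


section \<open>Regular sequences\<close>

definition k_kernel :: "nat \<Rightarrow> (nat \<Rightarrow> 'a) \<Rightarrow> (nat \<Rightarrow> 'a) set" where
  "k_kernel k a = {(\<lambda>n. a (k ^ i * n + j)) | i j. j \<le> k ^ i - 1}"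

text \<open>
  Below, \<open>R\<close> is a \<open>\<int>\<close>-module, that is, an abelian group in the sense of the locale
  \<^locale>\<open>abelian_group\<close>; a multiplication that \<open>R\<close> may carry is not used.  The
  \<open>\<int>\<close>-submodule generated by a set of sequences is the subgroup generated by it.
\<close>

definition seq_group :: "('a, 'c) ring_scheme \<Rightarrow> (nat \<Rightarrow> 'a) monoid" where
  "seq_group R = product_group UNIV (\<lambda>_. add_monoid R)"

definition k_regular :: "('a, 'c) ring_scheme \<Rightarrow> nat \<Rightarrow> (nat \<Rightarrow> 'a) \<Rightarrow> bool" where
  "k_regular R k a \<longleftrightarrow>
     (\<exists>S. finite S \<and> S \<subseteq> carrier (seq_group R) \<and>
          generate (seq_group R) S = generate (seq_group R) (k_kernel k a))"

definition regular :: "('a, 'c) ring_scheme \<Rightarrow> (nat \<Rightarrow> 'a) \<Rightarrow> bool" where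
  "regular R a \<longleftrightarrow> (\<exists>k\<ge>2. k_regular R k a)"

definition mult_independent :: "nat \<Rightarrow> nat \<Rightarrow> bool" where
  "mult_independent k m \<longleftrightarrow> (\<forall>a\<ge>1. \<forall>c\<ge>1. k ^ a \<noteq> m ^ c)"

definition strictly_k_regular :: "('a, 'c) ring_scheme \<Rightarrow> nat \<Rightarrow> (nat \<Rightarrow> 'a) \<Rightarrow> bool" where
  "strictly_k_regular R k a \<longleftrightarrow>
     k_regular R k a \<and> (\<forall>m\<ge>2. mult_independent k m \<longrightarrow> \<not> k_regular R m a)"

end

theory Submission
  imports Defs "HOL-Number_Theory.Cong" "HOL-Computational_Algebra.Squarefree"
begin

text \<open>
  Put \<open>\<nu>(n) = \<nu>\<^sub>b(f(n))\<close>.  Where \<open>\<nu>\<close> is bounded above, \<open>b\<^sup>-\<^sup>\<nu>\<^sup>(\<^sup>n\<^sup>)\<close> depends only on \<open>n\<close> modulo a power of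
  \<open>p\<^sub>1 \<cdots> p\<^sub>s\<close>, and the coefficients of \<open>f\<close> are multiplied by rational sequences \<open>\<psi>(n) n\<^sup>h\<close> with \<open>\<psi>\<close>
  periodic.  If the \<open>f\<^sub>i\<close> have a single common root \<open>\<theta> \<in> \<rat>\<close> of the same multiplicity \<open>m\<close>, there remain the
  sequences \<open>\<beta>(n - y) n\<^sup>h\<close> with \<open>\<beta>(bx) = \<beta>(x)\<close>, where \<open>y\<close> runs through the finite orbit of
  \<open>\<theta>\<close> under the maps \<open>y \<mapsto> (y - j)/b\<close>.

  Conversely, let the sequence be \<open>k\<close>-regular, let \<open>\<theta> \<in> \<R>\<^sub>f\<close>, and let \<open>D\<close> be the set of all \<open>n\<close> for which the
  minimum \<open>\<nu>(n)\<close> is not attained at a given index.  Reduction modulo \<open>p\<^sub>i\<^sup>l\<^sup>i\<close> shows that the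
  \<open>k\<close>-kernel of \<open>D\<close> is finite.  Because \<open>s \<ge> 2\<close>, the set \<open>D\<close> is discontinuous in \<open>\<int>\<^sub>b\<close> precisely at the
  points of \<open>\<R>\<^sub>f\<close>; hence the points \<open>(\<theta> - j)/k\<^sup>t \<in> \<int>\<^sub>b\<close>, which are discontinuities of members of the kernel,
  are finite in number.  It follows that \<open>k\<close> is a product of the \<open>p\<^sub>i\<close> and that \<open>\<theta>\<close> is rational, so that
  \<open>\<R>\<^sub>f = {\<theta>}\<close>; and the behaviour of \<open>D\<close> near \<open>\<theta>\<close> at the scales \<open>k\<^sup>t\<close> shows that \<open>m\<^sub>i v\<^sub>i(k) / l\<^sub>i\<close> does not
  depend on \<open>i\<close>.  For equal \<open>m\<^sub>i\<close> this makes \<open>k\<close> and \<open>b\<close> multiplicatively dependent.  For distinct \<open>m\<^sub>i\<close>, take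
  \<open>i\<close> with \<open>m\<^sub>i\<close> minimal: along a progression of exponents \<open>t\<close>, the \<open>i\<close>-th component at \<open>k\<^sup>t n + j\<close> is
  \<open>\<kappa> R\<^sup>-\<^sup>\<tau>\<close> times an exponential sum in \<open>\<tau>\<close> with integer bases and nonzero constant term, where \<open>R \<ge> 2\<close>.  A
  finitely generated group would then contain \<open>\<kappa>' R\<^sup>-\<^sup>\<tau>\<close> for all \<open>\<tau>\<close>, which is impossible.
\<close>

section \<open>Valuations of rational numbers\<close>

lemma rat_val_divide:
  assumes p: "Factorial_Ring.prime p" and "a \<noteq> 0" "b \<noteq> 0"
  shows "rat_val p (of_int a / of_int b) = int (multiplicity (int p) a) - int (multiplicity (int p) b)"
proof -
  define q :: rat where "q = of_int a / of_int b"
  obtain n d where nd: "quotient_of q = (n, d)" by fastforce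
  have d: "d > 0" using quotient_of_denom_pos[OF nd] .
  have q: "q = of_int n / of_int d" using quotient_of_div[OF nd] .
  have n: "n \<noteq> 0" using q assms d by (auto simp: q_def)
  have "(of_int (n * b) :: rat) = of_int (a * d)"
    using q assms d by (simp add: q_def field_simps)
  then have eq: "n * b = a * d" by (simp only: of_int_eq_iff)
  have pe: "prime_elem (int p)" using p by simp
  have "multiplicity (int p) n + multiplicity (int p) b = multiplicity (int p) a + multiplicity (int p) d"
    using eq prime_elem_multiplicity_mult_distrib[OF pe n assms(3)]
      prime_elem_multiplicity_mult_distrib[OF pe assms(2), of d] d by simp
  then show ?thesis using nd by (simp add: rat_val_def q_def[symmetric])
qed

lemma rat_fracE:
  fixes q :: rat assumes "q \<noteq> 0"
  obtains a b where "q = of_int a / of_int b" "a \<noteq> 0" "b \<noteq> 0"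
proof -
  obtain a b where "quotient_of q = (a, b)" by fastforce
  then have "q = of_int a / of_int b" "b > 0"
    using quotient_of_div quotient_of_denom_pos by blast+
  then show ?thesis using that assms by force
qed

lemma rat_val_mult:
  assumes p: "Factorial_Ring.prime p" and "x \<noteq> 0" "y \<noteq> 0"
  shows "rat_val p (x * y) = rat_val p x + rat_val p y"
proof -
  obtain a b where x: "x = of_int a / of_int b" "a \<noteq> 0" "b \<noteq> 0" using rat_fracE assms by metis
  obtain c d where y: "y = of_int c / of_int d" "c \<noteq> 0" "d \<noteq> 0" using rat_fracE assms by metis
  have xy: "x * y = of_int (a * c) / of_int (b * d)" using x y by simp
  have pe: "prime_elem (int p)" using p by simp
  have "rat_val p (x * y) = int (multiplicity (int p) (a * c)) - int (multiplicity (int p) (b * d))"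
    unfolding xy using x y by (intro rat_val_divide[OF p]) auto
  also have "\<dots> = rat_val p x + rat_val p y" unfolding x(1) y(1)
    using x y by (simp add: rat_val_divide[OF p] prime_elem_multiplicity_mult_distrib[OF pe])
  finally show ?thesis .
qed

lemma rat_val_of_int: "Factorial_Ring.prime p \<Longrightarrow> a \<noteq> 0 \<Longrightarrow> rat_val p (of_int a) = int (multiplicity (int p) a)"
  using rat_val_divide[of p a 1] by simp

lemma rat_val_of_nat:
  assumes "Factorial_Ring.prime p" "a \<noteq> 0" shows "rat_val p (of_nat a) = int (multiplicity p a)"
proof -
  have "multiplicity (int p) (int a) = multiplicity p a"
    by (simp add: multiplicity_def flip: of_nat_power)
  then show ?thesis using rat_val_of_int[OF assms(1), of "int a"] assms by simp
qed

lemma rat_val_1: "rat_val p 1 = 0"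
  by (simp add: rat_val_def)

lemma rat_val_minus: "rat_val p (- x) = rat_val p x"
  by (cases "quotient_of x") (simp add: rat_val_def rat_uminus_code)

lemma rat_val_inverse:
  assumes p: "Factorial_Ring.prime p" and "x \<noteq> 0" shows "rat_val p (inverse x) = - rat_val p x"
  using rat_val_mult[OF p assms(2), of "inverse x"] assms rat_val_1[of p] by simp

lemma rat_val_power: "Factorial_Ring.prime q \<Longrightarrow> x \<noteq> 0 \<Longrightarrow> rat_val q (x ^ n) = int n * rat_val q x"
  by (induction n) (simp_all add: rat_val_1 rat_val_mult algebra_simps)

lemma rat_val_powi: "Factorial_Ring.prime q \<Longrightarrow> x \<noteq> 0 \<Longrightarrow> rat_val q (x powi n) = n * rat_val q x"
  by (cases n rule: int_cases2)
    (simp_all add: rat_val_power power_int_minus rat_val_inverse)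

definition rge :: "nat \<Rightarrow> int \<Rightarrow> rat \<Rightarrow> bool" where
  "rge p N x \<longleftrightarrow> x = 0 \<or> N \<le> rat_val p x"

lemma rge_0 [simp]: "rge p N 0" by (simp add: rge_def)

lemma rge_mono: "rge p N x \<Longrightarrow> M \<le> N \<Longrightarrow> rge p M x" by (auto simp: rge_def)

lemma rge_mult: "Factorial_Ring.prime p \<Longrightarrow> rge p M x \<Longrightarrow> rge p N y \<Longrightarrow> rge p (M + N) (x * y)"
  using rat_val_mult[of p x y] by (cases "x = 0 \<or> y = 0") (auto simp: rge_def)

lemma rge_minus [simp]: "rge p N (- x) \<longleftrightarrow> rge p N x" by (simp add: rge_def rat_val_minus)

lemma rge_of_int_iff:
  assumes p: "Factorial_Ring.prime p"
  shows "rge p (int N) (of_int a) \<longleftrightarrow> int p ^ N dvd a"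
proof (cases "a = 0")
  case False
  have "\<not> is_unit (int p)" using p not_prime_unit[of "int p"] by auto
  then show ?thesis using False power_dvd_iff_le_multiplicity[of a "int p" N]
    by (simp add: rge_def rat_val_of_int[OF p])
qed auto

lemma rge_add:
  assumes p: "Factorial_Ring.prime p" and "rge p N x" "rge p N y" shows "rge p N (x + y)"
proof (cases "x = 0 \<or> y = 0 \<or> x + y = 0")
  case False
  then obtain a b c d where x: "x = of_int a / of_int b" "a \<noteq> 0" "b \<noteq> 0"
    and y: "y = of_int c / of_int d" "c \<noteq> 0" "d \<noteq> 0" using rat_fracE by metis
  have eq: "x + y = of_int (a * d + c * b) / of_int (b * d)" using x y by (simp add: field_simps)
  have nz: "a * d + c * b \<noteq> 0"
  proof
    assume "a * d + c * b = 0"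
    then have "x + y = of_int 0 / of_int (b * d)" using eq by (simp only:)
    then show False using False by simp
  qed
  have pe: "prime_elem (int p)" using p by simp
  have nu: "\<not> is_unit (int p)" using p not_prime_unit[of "int p"] by auto
  define k where "k = min (multiplicity (int p) (a * d)) (multiplicity (int p) (c * b))"
  have "int p ^ k dvd a * d" "int p ^ k dvd c * b"
    by (auto simp: k_def intro!: multiplicity_dvd')
  then have "int p ^ k dvd a * d + c * b" by simp
  then have "k \<le> multiplicity (int p) (a * d + c * b)"
    using power_dvd_iff_le_multiplicity[OF nz nu] by simp
  then have "rat_val p (x + y) \<ge> int k - int (multiplicity (int p) (b * d))"
    unfolding eq using rat_val_divide[OF p nz, of "b * d"] x y by simp
  moreover have "int (multiplicity (int p) (a * d)) - int (multiplicity (int p) (b * d)) \<ge> N"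
    using assms(2) False x y by (simp add: rge_def rat_val_divide[OF p] prime_elem_multiplicity_mult_distrib[OF pe])
  moreover have "int (multiplicity (int p) (c * b)) - int (multiplicity (int p) (b * d)) \<ge> N"
    using assms(3) False x y by (simp add: rge_def rat_val_divide[OF p] prime_elem_multiplicity_mult_distrib[OF pe])
  ultimately show ?thesis by (auto simp: rge_def k_def)
qed (use assms in \<open>auto simp: rge_def\<close>)

lemma rge_diff:
  assumes p: "Factorial_Ring.prime p" and "rge p N x" "rge p N y" shows "rge p N (x - y)"
  using rge_add[OF p assms(2), of "- y"] assms by simp

lemma rge_of_int: "Factorial_Ring.prime p \<Longrightarrow> rge p 0 (of_int a)"
  using rge_of_int_iff[of p 0 a] by simp

lemma rge_of_nat: "Factorial_Ring.prime p \<Longrightarrow> rge p 0 (of_nat a)"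
  using rge_of_int[of p "int a"] by simp

lemma rat_abs_less_iff:
  assumes p: "Factorial_Ring.prime p"
  shows "rat_abs p x < real p powi (- N) \<longleftrightarrow> rge p (N + 1) x"
proof (cases "x = 0")
  case True
  then show ?thesis using p by (simp add: rat_abs_def prime_gt_0_nat)
next
  case False
  have "real p > 1" using p prime_gt_1_nat by simp
  then have "(real p powi (- rat_val p x) < real p powi (- N)) = (- rat_val p x < - N)"
    by (metis linorder_neqE_linordered_idom order_less_asym power_int_strict_increasing)
  then show ?thesis using False by (auto simp: rat_abs_def rge_def)
qed

lemma ex_powi_less:
  assumes p: "Factorial_Ring.prime p" and "e > 0"
  shows "\<exists>N. real p powi (- N) < e"
proof -
  have "1 / real p < 1" using prime_gt_1_nat[OF p] by simp
  then obtain n where "(1 / real p) ^ n < e" using real_arch_pow_inv[OF assms(2)] by blast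
  then have "real p powi (- int n) < e" by (simp add: power_int_minus power_inverse divide_inverse)
  then show ?thesis ..
qed

lemma padic_Cauchy_iff:
  assumes p: "Factorial_Ring.prime p"
  shows "x \<in> padic_Cauchy p \<longleftrightarrow> (\<forall>N. \<exists>M. \<forall>m\<ge>M. \<forall>n\<ge>M. rge p N (x m - x n))" (is "_ \<longleftrightarrow> ?R")
proof
  assume x: "x \<in> padic_Cauchy p"
  show ?R
  proof
    fix N
    have "real p powi (- (N - 1)) > 0" using p by (simp add: prime_gt_0_nat)
    then obtain M where "\<forall>m\<ge>M. \<forall>n\<ge>M. rat_abs p (x m - x n) < real p powi (- (N - 1))"
      using x unfolding padic_Cauchy_def by blast
    then show "\<exists>M. \<forall>m\<ge>M. \<forall>n\<ge>M. rge p N (x m - x n)" unfolding rat_abs_less_iff[OF p] by auto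
  qed
next
  assume R: ?R
  have "\<exists>M. \<forall>m\<ge>M. \<forall>n\<ge>M. rat_abs p (x m - x n) < e" if "e > 0" for e
  proof -
    obtain N where N: "real p powi (- N) < e" using ex_powi_less[OF p \<open>e > 0\<close>] by blast
    obtain M where "\<forall>m\<ge>M. \<forall>n\<ge>M. rge p (N + 1) (x m - x n)" using R by blast
    then have "\<forall>m\<ge>M. \<forall>n\<ge>M. rat_abs p (x m - x n) < e"
      using N unfolding rat_abs_less_iff[OF p, symmetric] by (meson less_trans)
    then show ?thesis ..
  qed
  then show "x \<in> padic_Cauchy p" unfolding padic_Cauchy_def by blast
qed

lemma padic_null_iff:
  assumes p: "Factorial_Ring.prime p"
  shows "x \<in> padic_null p \<longleftrightarrow> (\<forall>N. \<forall>\<^sub>F n in sequentially. rge p N (x n))" (is "_ \<longleftrightarrow> ?R")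
proof
  assume x: "x \<in> padic_null p"
  then have l: "(\<lambda>n. rat_abs p (x n)) \<longlonglongrightarrow> 0" by (simp add: padic_null_def)
  show ?R
  proof
    fix N
    have "real p powi (- (N - 1)) > 0" using p by (simp add: prime_gt_0_nat)
    from order_tendstoD(2)[OF l this] show "\<forall>\<^sub>F n in sequentially. rge p N (x n)"
      unfolding rat_abs_less_iff[OF p] by simp
  qed
next
  assume R: ?R
  have pos: "rat_abs p y \<ge> 0" for y by (simp add: rat_abs_def)
  have "(\<lambda>n. rat_abs p (x n)) \<longlonglongrightarrow> 0"
  proof (rule order_tendstoI)
    fix e :: real assume "e > 0"
    then obtain N where N: "real p powi (- N) < e" using ex_powi_less[OF p \<open>e > 0\<close>] by blast
    have "\<forall>\<^sub>F n in sequentially. rge p (N + 1) (x n)" using R by blast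
    then show "\<forall>\<^sub>F n in sequentially. rat_abs p (x n) < e"
      using N unfolding rat_abs_less_iff[OF p, symmetric] by (auto elim: eventually_mono)
  qed (use pos in \<open>auto intro: less_le_trans always_eventually\<close>)
  then show "x \<in> padic_null p" by (simp add: padic_null_def)
qed

section \<open>The field of \<open>p\<close>-adic numbers\<close>

lemma Cauchy_ring_simps [simp]:
  "carrier (Cauchy_ring p) = padic_Cauchy p"
  "x \<otimes>\<^bsub>Cauchy_ring p\<^esub> y = (\<lambda>n. x n * y n)"
  "x \<oplus>\<^bsub>Cauchy_ring p\<^esub> y = (\<lambda>n. x n + y n)"
  "\<one>\<^bsub>Cauchy_ring p\<^esub> = (\<lambda>n. 1)" "\<zero>\<^bsub>Cauchy_ring p\<^esub> = (\<lambda>n. 0)"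
  by (simp_all add: Cauchy_ring_def)

lemma rge_ex: "\<exists>N. rge p N x"
  by (auto simp: rge_def)

locale padic =
  fixes p :: nat
  assumes prime: "Factorial_Ring.prime p"
begin

lemmas Cauchy_iff = padic_Cauchy_iff[OF prime]
lemmas null_iff = padic_null_iff[OF prime]

lemma Cauchy_const [simp]: "(\<lambda>n. q) \<in> padic_Cauchy p"
  by (simp add: Cauchy_iff)

lemma Cauchy_minus: "x \<in> padic_Cauchy p \<Longrightarrow> (\<lambda>n. - x n) \<in> padic_Cauchy p"
  unfolding Cauchy_iff by (metis minus_diff_minus rge_minus)

lemma Cauchy_add:
  assumes "x \<in> padic_Cauchy p" "y \<in> padic_Cauchy p" shows "(\<lambda>n. x n + y n) \<in> padic_Cauchy p"
  unfolding Cauchy_iff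
proof
  fix N
  obtain M1 where 1: "\<And>m n. m \<ge> M1 \<Longrightarrow> n \<ge> M1 \<Longrightarrow> rge p N (x m - x n)" using assms(1)[unfolded Cauchy_iff] by blast
  obtain M2 where 2: "\<And>m n. m \<ge> M2 \<Longrightarrow> n \<ge> M2 \<Longrightarrow> rge p N (y m - y n)" using assms(2)[unfolded Cauchy_iff] by blast
  have "rge p N ((x m + y m) - (x n + y n))" if "m \<ge> max M1 M2" "n \<ge> max M1 M2" for m n
    using rge_add[OF prime 1[of m n] 2[of m n]] that by (simp add: algebra_simps)
  then show "\<exists>M. \<forall>m\<ge>M. \<forall>n\<ge>M. rge p N ((x m + y m) - (x n + y n))" by blast
qed

lemma Cauchy_bounded:
  assumes "x \<in> padic_Cauchy p" shows "\<exists>C. \<forall>n. rge p C (x n)"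
proof -
  obtain M where M: "\<And>m n. m \<ge> M \<Longrightarrow> n \<ge> M \<Longrightarrow> rge p 0 (x m - x n)" using assms[unfolded Cauchy_iff] by blast
  have "\<exists>C. \<forall>n<K. rge p C (x n)" for K
  proof (induction K)
    case (Suc K)
    then obtain C where C: "\<forall>n<K. rge p C (x n)" by blast
    obtain D where "rge p D (x K)" using rge_ex by blast
    then have "\<forall>n<Suc K. rge p (min C D) (x n)" using C by (auto simp: less_Suc_eq intro: rge_mono)
    then show ?case by blast
  qed auto
  then obtain C where C: "\<forall>n<Suc M. rge p C (x n)" by blast
  have "rge p (min C 0) (x n)" for n
  proof (cases "n < Suc M")
    case False
    then have "rge p (min C 0) (x n - x M)" using M[of n M] by (auto intro: rge_mono)
    moreover have "rge p (min C 0) (x M)" using C by (auto intro: rge_mono)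
    ultimately show ?thesis using rge_add[OF prime] by fastforce
  qed (use C in \<open>auto intro: rge_mono\<close>)
  then show ?thesis by blast
qed

lemma Cauchy_mult:
  assumes "x \<in> padic_Cauchy p" "y \<in> padic_Cauchy p" shows "(\<lambda>n. x n * y n) \<in> padic_Cauchy p"
  unfolding Cauchy_iff
proof
  fix N
  obtain C where C: "\<And>n. rge p C (x n)" using Cauchy_bounded assms by blast
  obtain D where D: "\<And>n. rge p D (y n)" using Cauchy_bounded assms by blast
  obtain M1 where 1: "\<And>m n. m \<ge> M1 \<Longrightarrow> n \<ge> M1 \<Longrightarrow> rge p (N - D) (x m - x n)" using assms(1)[unfolded Cauchy_iff] by blast
  obtain M2 where 2: "\<And>m n. m \<ge> M2 \<Longrightarrow> n \<ge> M2 \<Longrightarrow> rge p (N - C) (y m - y n)" using assms(2)[unfolded Cauchy_iff] by blast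
  have "rge p N (x m * y m - x n * y n)" if "m \<ge> max M1 M2" "n \<ge> max M1 M2" for m n
  proof -
    have "x m * y m - x n * y n = (x m - x n) * y m + x n * (y m - y n)" by (simp add: algebra_simps)
    moreover have "rge p N ((x m - x n) * y m)" using rge_mult[OF prime 1[of m n] D[of m]] that by simp
    moreover have "rge p N (x n * (y m - y n))" using rge_mult[OF prime C[of n] 2[of m n]] that by simp
    ultimately show ?thesis using rge_add[OF prime] by metis
  qed
  then show "\<exists>M. \<forall>m\<ge>M. \<forall>n\<ge>M. rge p N (x m * y m - x n * y n)" by blast
qed

lemma null_Cauchy: "x \<in> padic_null p \<Longrightarrow> x \<in> padic_Cauchy p"
  unfolding Cauchy_iff
proof
  fix N assume "x \<in> padic_null p"
  then obtain M where "\<And>n. n \<ge> M \<Longrightarrow> rge p N (x n)"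
    unfolding null_iff eventually_sequentially by blast
  then show "\<exists>M. \<forall>m\<ge>M. \<forall>n\<ge>M. rge p N (x m - x n)" using rge_diff[OF prime] by blast
qed

lemma null_add: "x \<in> padic_null p \<Longrightarrow> y \<in> padic_null p \<Longrightarrow> (\<lambda>n. x n + y n) \<in> padic_null p"
  unfolding null_iff
  by (intro allI) (rule eventually_elim2[where P = "\<lambda>n. rge p _ (x n)" and Q = "\<lambda>n. rge p _ (y n)"],
      auto intro: rge_add[OF prime])

lemma null_mult:
  assumes "x \<in> padic_null p" "y \<in> padic_Cauchy p" shows "(\<lambda>n. x n * y n) \<in> padic_null p"
  unfolding null_iff
proof
  fix N
  obtain D where D: "\<And>n. rge p D (y n)" using Cauchy_bounded assms by blast
  have "\<forall>\<^sub>F n in sequentially. rge p (N - D) (x n)" using assms unfolding null_iff by blast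
  then show "\<forall>\<^sub>F n in sequentially. rge p N (x n * y n)"
    by eventually_elim (use rge_mult[OF prime _ D, of "N - D"] in force)
qed

lemma null_minus: "x \<in> padic_null p \<Longrightarrow> (\<lambda>n. - x n) \<in> padic_null p"
  unfolding null_iff by simp

lemma nonnull_eventually:
  assumes x: "x \<in> padic_Cauchy p" and nx: "x \<notin> padic_null p"
  shows "\<exists>v. \<forall>\<^sub>F n in sequentially. x n \<noteq> 0 \<and> rat_val p (x n) = v"
proof -
  obtain N where N: "\<And>M. \<exists>n\<ge>M. \<not> rge p N (x n)" using nx unfolding null_iff eventually_sequentially by blast
  obtain M where M: "\<And>m n. m \<ge> M \<Longrightarrow> n \<ge> M \<Longrightarrow> rge p N (x m - x n)" using x[unfolded Cauchy_iff] by blast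
  obtain m where m: "m \<ge> M" "\<not> rge p N (x m)" using N by blast
  then have xm: "x m \<noteq> 0" "rat_val p (x m) < N" by (auto simp: rge_def)
  have "x n \<noteq> 0 \<and> rat_val p (x n) = rat_val p (x m)" if n: "n \<ge> M" for n
  proof -
    have d: "rge p N (x m - x n)" "rge p N (x n - x m)" using M m n by auto
    have nz: "x n \<noteq> 0" using d(1) m by auto
    have "rge p (min N (rat_val p (x n))) (x n + (x m - x n))"
      by (rule rge_add[OF prime]) (use d nz in \<open>auto simp: rge_def\<close>)
    moreover have "rge p (min N (rat_val p (x m))) (x m + (x n - x m))"
      by (rule rge_add[OF prime]) (use d xm in \<open>auto simp: rge_def\<close>)
    ultimately show ?thesis using nz xm by (auto simp: rge_def)
  qed
  then show ?thesis unfolding eventually_sequentially by blast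
qed

lemma Cauchy_inverse:
  assumes x: "x \<in> padic_Cauchy p" and nx: "x \<notin> padic_null p"
  shows "(\<lambda>n. inverse (x n)) \<in> padic_Cauchy p"
  unfolding Cauchy_iff
proof
  fix N
  obtain v M1 where v: "\<And>n. n \<ge> M1 \<Longrightarrow> x n \<noteq> 0 \<and> rat_val p (x n) = v"
    using nonnull_eventually[OF assms] unfolding eventually_sequentially by blast
  obtain M2 where 2: "\<And>m n. m \<ge> M2 \<Longrightarrow> n \<ge> M2 \<Longrightarrow> rge p (N + 2 * v) (x m - x n)" using x[unfolded Cauchy_iff] by blast
  have "rge p N (inverse (x m) - inverse (x n))" if "m \<ge> max M1 M2" "n \<ge> max M1 M2" for m n
  proof -
    have "inverse (x m) - inverse (x n) = (x n - x m) * (inverse (x m) * inverse (x n))"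
      using v[of m] v[of n] that by (simp add: field_simps)
    moreover have "rge p (- v + - v) (inverse (x m) * inverse (x n))"
      using v[of m] v[of n] that by (intro rge_mult[OF prime]) (auto simp: rge_def rat_val_inverse[OF prime])
    ultimately show ?thesis using rge_mult[OF prime 2[of n m]] that by fastforce
  qed
  then show "\<exists>M. \<forall>m\<ge>M. \<forall>n\<ge>M. rge p N (inverse (x m) - inverse (x n))" by blast
qed

lemma cring_Cauchy_ring: "cring (Cauchy_ring p)"
proof (rule cringI)
  show "abelian_group (Cauchy_ring p)"
    by (rule abelian_groupI)
      (auto simp: Cauchy_add algebra_simps intro!: bexI[of _ "\<lambda>n. - _ n"] Cauchy_minus)
  show "Group.comm_monoid (Cauchy_ring p)"
    by (rule comm_monoidI) (auto simp: Cauchy_mult algebra_simps)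
qed (auto simp: algebra_simps)

sublocale CR: cring "Cauchy_ring p" by (rule cring_Cauchy_ring)

lemma CR_minus: "x \<in> padic_Cauchy p \<Longrightarrow> \<ominus>\<^bsub>Cauchy_ring p\<^esub> x = (\<lambda>n. - x n)"
  by (rule CR.minus_equality) (auto simp: Cauchy_minus)

lemma ideal_null: "ideal (padic_null p) (Cauchy_ring p)"
proof (rule idealI)
  show "subgroup (padic_null p) (add_monoid (Cauchy_ring p))"
  proof (rule group.subgroupI)
    show "Group.group (add_monoid (Cauchy_ring p))" by (rule CR.add.group_axioms)
    show "inv\<^bsub>add_monoid (Cauchy_ring p)\<^esub> a \<in> padic_null p" if "a \<in> padic_null p" for a
      using CR_minus[OF null_Cauchy[OF that]] null_minus[OF that] by (simp add: a_inv_def)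
    have "(\<lambda>n. 0) \<in> padic_null p" by (simp add: null_iff)
    then show "padic_null p \<noteq> {}" by blast
  qed (auto simp: null_Cauchy null_add)
  show "ring (Cauchy_ring p)" by (rule CR.ring_axioms)
  fix a x assume "a \<in> padic_null p" "x \<in> carrier (Cauchy_ring p)"
  then show "x \<otimes>\<^bsub>Cauchy_ring p\<^esub> a \<in> padic_null p" "a \<otimes>\<^bsub>Cauchy_ring p\<^esub> x \<in> padic_null p"
    using null_mult[of a x] by (auto simp: mult.commute)
qed

sublocale NI: ideal "padic_null p" "Cauchy_ring p" by (rule ideal_null)

definition cls :: "(nat \<Rightarrow> rat) \<Rightarrow> padic" where
  "cls r = padic_null p +>\<^bsub>Cauchy_ring p\<^esub> r"

lemma carrier_Qp: "carrier (Qp p) = cls ` padic_Cauchy p"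
  by (auto simp: Qp_def FactRing_def A_RCOSETS_def' cls_def)

lemma QpE: assumes "x \<in> carrier (Qp p)" obtains r where "r \<in> padic_Cauchy p" "x = cls r"
  using assms by (auto simp: carrier_Qp)

lemma cls_closed: "r \<in> padic_Cauchy p \<Longrightarrow> cls r \<in> carrier (Qp p)"
  by (simp add: carrier_Qp)

lemma cls_add: "r \<in> padic_Cauchy p \<Longrightarrow> t \<in> padic_Cauchy p \<Longrightarrow> cls r \<oplus>\<^bsub>Qp p\<^esub> cls t = cls (\<lambda>n. r n + t n)"
  by (simp add: Qp_def FactRing_def cls_def NI.a_rcos_sum)

lemma cls_mult: "r \<in> padic_Cauchy p \<Longrightarrow> t \<in> padic_Cauchy p \<Longrightarrow> cls r \<otimes>\<^bsub>Qp p\<^esub> cls t = cls (\<lambda>n. r n * t n)"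
  by (simp add: Qp_def FactRing_def cls_def NI.rcoset_mult_add)

lemma cls_one: "\<one>\<^bsub>Qp p\<^esub> = cls (\<lambda>n. 1)"
  by (simp add: Qp_def FactRing_def cls_def)

lemma mem_cls: "t \<in> cls r \<longleftrightarrow> (\<exists>h\<in>padic_null p. t = (\<lambda>n. h n + r n))"
  by (simp add: cls_def a_r_coset_def r_coset_def) 

lemma cls_zero_iff: "r \<in> padic_Cauchy p \<Longrightarrow> cls r = \<zero>\<^bsub>Qp p\<^esub> \<longleftrightarrow> r \<in> padic_null p"
  using NI.a_rcos_const[of r] NI.a_rcos_self[of r] by (auto simp: Qp_def FactRing_def cls_def)

lemma field_Qp: "field (Qp p)"
proof -
  interpret Q: cring "Qp p" unfolding Qp_def by (rule NI.quotient_is_cring[OF cring_Cauchy_ring])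
  have n1: "(\<lambda>n. 1) \<notin> padic_null p"
  proof
    assume "(\<lambda>n. 1) \<in> padic_null p"
    then have "rge p 1 1" unfolding null_iff by (auto simp: eventually_sequentially)
    then show False by (simp add: rge_def rat_val_1)
  qed
  show ?thesis
  proof (rule Q.cring_fieldI2)
    show "\<zero>\<^bsub>Qp p\<^esub> \<noteq> \<one>\<^bsub>Qp p\<^esub>" using cls_zero_iff[of "\<lambda>n. 1"] n1 by (auto simp: cls_one)
    fix a assume a: "a \<in> carrier (Qp p)" "a \<noteq> \<zero>\<^bsub>Qp p\<^esub>"
    then obtain r where r: "r \<in> padic_Cauchy p" "a = cls r" by (elim QpE)
    then have nr: "r \<notin> padic_null p" using cls_zero_iff a by blast
    have i: "(\<lambda>n. inverse (r n)) \<in> padic_Cauchy p" by (rule Cauchy_inverse[OF r(1) nr])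
    have "\<forall>\<^sub>F n in sequentially. r n \<noteq> 0" using nonnull_eventually[OF r(1) nr] by (auto elim: eventually_mono)
    then have "(\<lambda>n. r n * inverse (r n) - 1) \<in> padic_null p"
      unfolding null_iff by (auto elim: eventually_mono)
    then have "(\<lambda>n. r n * inverse (r n)) \<in> cls (\<lambda>n. 1)"
      unfolding mem_cls by (auto intro!: bexI[of _ "\<lambda>n. r n * inverse (r n) - 1"])
    then have "cls (\<lambda>n. 1) = cls (\<lambda>n. r n * inverse (r n))"
      unfolding cls_def by (intro NI.a_repr_independence') auto
    then show "\<exists>b\<in>carrier (Qp p). a \<otimes>\<^bsub>Qp p\<^esub> b = \<one>\<^bsub>Qp p\<^esub>"
      using cls_mult[OF r(1) i] cls_closed[OF i] r cls_one by metis
  qed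
qed

end

sublocale padic \<subseteq> Q: field "Qp p" by (rule field_Qp)

context padic
begin

abbreviation \<iota> :: "rat \<Rightarrow> padic" where "\<iota> \<equiv> padic_of_rat p"

definition Ov :: "int \<Rightarrow> padic set" where
  "Ov N = {x \<in> carrier (Qp p). Fin N \<le> padic_val p x}"

definition pv :: "padic \<Rightarrow> int" where
  "pv x = (THE v. padic_val p x = Fin v)"

lemma iota_cls: "\<iota> q = cls (\<lambda>n. q)"
  by (simp add: padic_of_rat_def cls_def)

lemma rat_val_perturb:
  assumes "y \<noteq> 0" "rge p (rat_val p y + 1) h"
  shows "h + y \<noteq> 0" "rat_val p (h + y) = rat_val p y"
proof -
  show nz: "h + y \<noteq> 0"
  proof
    assume "h + y = 0"
    then have "h = - y" by (simp add: add_eq_0_iff2)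
    then show False using assms by (simp add: rge_def rat_val_minus)
  qed
  have "rge p (rat_val p y) (h + y)"
    using assms by (intro rge_add[OF prime]) (auto simp: rge_def)
  moreover have "rge p (min (rat_val p y + 1) (rat_val p (h + y))) (h + y - h)"
    using assms nz by (intro rge_diff[OF prime]) (auto simp: rge_def)
  ultimately show "rat_val p (h + y) = rat_val p y" using nz assms(1) by (auto simp: rge_def)
qed

lemma padic_val_cls:
  assumes r: "r \<in> padic_Cauchy p" and v: "\<forall>\<^sub>F n in sequentially. r n \<noteq> 0 \<and> rat_val p (r n) = v"
  shows "cls r \<noteq> \<zero>\<^bsub>Qp p\<^esub>" "padic_val p (cls r) = Fin v"
proof -
  have nr: "r \<notin> padic_null p"
  proof
    assume "r \<in> padic_null p"
    then have "\<forall>\<^sub>F n in sequentially. rge p (v + 1) (r n)" unfolding null_iff by blast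
    with v have "\<forall>\<^sub>F n in sequentially. False" by eventually_elim (auto simp: rge_def)
    then show False by simp
  qed
  then show nz: "cls r \<noteq> \<zero>\<^bsub>Qp p\<^esub>" using cls_zero_iff[OF r] by blast
  have "(THE v. \<exists>t\<in>cls r. \<forall>\<^sub>F n in sequentially. t n \<noteq> 0 \<and> rat_val p (t n) = v) = v"
  proof (rule the_equality)
    show "\<exists>t\<in>cls r. \<forall>\<^sub>F n in sequentially. t n \<noteq> 0 \<and> rat_val p (t n) = v"
      using v by (intro bexI[of _ r]) (auto simp: mem_cls null_iff intro!: bexI[of _ "\<lambda>n. 0"])
    fix v' assume "\<exists>t\<in>cls r. \<forall>\<^sub>F n in sequentially. t n \<noteq> 0 \<and> rat_val p (t n) = v'"
    then obtain h where h: "h \<in> padic_null p"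
      and v': "\<forall>\<^sub>F n in sequentially. h n + r n \<noteq> 0 \<and> rat_val p (h n + r n) = v'"
      using mem_cls by fastforce
    have "\<forall>\<^sub>F n in sequentially. rge p (v + 1) (h n)" using h unfolding null_iff by blast
    with v v' have "\<forall>\<^sub>F n in sequentially. v' = v" by eventually_elim (use rat_val_perturb in blast)
    then show "v' = v" by simp
  qed
  then show "padic_val p (cls r) = Fin v" using nz by (simp add: padic_val_def)
qed

lemma cls_Ov:
  assumes r: "r \<in> padic_Cauchy p"
  shows "cls r \<in> Ov N \<longleftrightarrow> (\<forall>\<^sub>F n in sequentially. rge p N (r n))"
proof (cases "r \<in> padic_null p")
  case True
  then show ?thesis using cls_closed[OF r] cls_zero_iff[OF r] by (simp add: Ov_def padic_val_def null_iff)
next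
  case False
  then obtain v where v: "\<forall>\<^sub>F n in sequentially. r n \<noteq> 0 \<and> rat_val p (r n) = v"
    using nonnull_eventually r by blast
  have "(\<forall>\<^sub>F n in sequentially. rge p N (r n)) \<longleftrightarrow> (\<forall>\<^sub>F n in sequentially. N \<le> v)"
    by (rule eventually_subst) (use v in eventually_elim, auto simp: rge_def)
  then show ?thesis using padic_val_cls[OF r v] cls_closed[OF r] by (simp add: Ov_def)
qed

lemma pv_cls:
  assumes r: "r \<in> padic_Cauchy p" and v: "\<forall>\<^sub>F n in sequentially. r n \<noteq> 0 \<and> rat_val p (r n) = v"
  shows "pv (cls r) = v"
  using padic_val_cls[OF assms] by (simp add: pv_def)

lemma nonzeroE:
  assumes "x \<in> carrier (Qp p)" "x \<noteq> \<zero>\<^bsub>Qp p\<^esub>"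
  obtains r where "r \<in> padic_Cauchy p" "x = cls r"
    "\<forall>\<^sub>F n in sequentially. r n \<noteq> 0 \<and> rat_val p (r n) = pv x"
proof -
  obtain r where r: "r \<in> padic_Cauchy p" "x = cls r" using assms by (elim QpE)
  then obtain v where v: "\<forall>\<^sub>F n in sequentially. r n \<noteq> 0 \<and> rat_val p (r n) = v"
    using nonnull_eventually cls_zero_iff assms by blast
  show ?thesis using that[OF r] v pv_cls[OF r(1) v] r by simp
qed

lemma padic_val_nonzero:
  assumes "x \<in> carrier (Qp p)" "x \<noteq> \<zero>\<^bsub>Qp p\<^esub>" shows "padic_val p x = Fin (pv x)"
  using nonzeroE[OF assms] padic_val_cls by metis

lemma padic_val_zero: "padic_val p \<zero>\<^bsub>Qp p\<^esub> = \<infinity>"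
  by (simp add: padic_val_def)

lemma Ov_closed: "x \<in> Ov N \<Longrightarrow> x \<in> carrier (Qp p)" by (simp add: Ov_def)

lemma Ov_pv: "x \<in> carrier (Qp p) \<Longrightarrow> x \<noteq> \<zero>\<^bsub>Qp p\<^esub> \<Longrightarrow> x \<in> Ov N \<longleftrightarrow> N \<le> pv x"
  by (simp add: Ov_def padic_val_nonzero)

lemma Ov_zero [simp]: "\<zero>\<^bsub>Qp p\<^esub> \<in> Ov N" by (simp add: Ov_def padic_val_zero)

lemma Ov_mono: "x \<in> Ov N \<Longrightarrow> M \<le> N \<Longrightarrow> x \<in> Ov M"
  by (cases "padic_val p x") (auto simp: Ov_def)

lemma Ov_ex: "x \<in> carrier (Qp p) \<Longrightarrow> \<exists>N. x \<in> Ov N"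
  by (cases "x = \<zero>\<^bsub>Qp p\<^esub>") (auto simp: Ov_pv)

lemma Ov_zeroI: "x \<in> carrier (Qp p) \<Longrightarrow> (\<And>N. x \<in> Ov N) \<Longrightarrow> x = \<zero>\<^bsub>Qp p\<^esub>"
  using Ov_pv[of x "pv x + 1"] by fastforce

lemma Ov_add: assumes "x \<in> Ov N" "y \<in> Ov N" shows "x \<oplus>\<^bsub>Qp p\<^esub> y \<in> Ov N"
proof -
  obtain r where r: "r \<in> padic_Cauchy p" "x = cls r" using assms Ov_closed by (metis QpE)
  obtain t where t: "t \<in> padic_Cauchy p" "y = cls t" using assms Ov_closed by (metis QpE)
  have "\<forall>\<^sub>F n in sequentially. rge p N (r n)" "\<forall>\<^sub>F n in sequentially. rge p N (t n)"
    using assms r t cls_Ov by auto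
  then have "\<forall>\<^sub>F n in sequentially. rge p N (r n + t n)" by eventually_elim (rule rge_add[OF prime])
  then show ?thesis using r t cls_Ov[OF Cauchy_add] by (simp add: cls_add)
qed

lemma Ov_mult: assumes "x \<in> Ov M" "y \<in> Ov N" shows "x \<otimes>\<^bsub>Qp p\<^esub> y \<in> Ov (M + N)"
proof -
  obtain r where r: "r \<in> padic_Cauchy p" "x = cls r" using assms Ov_closed by (metis QpE)
  obtain t where t: "t \<in> padic_Cauchy p" "y = cls t" using assms Ov_closed by (metis QpE)
  have "\<forall>\<^sub>F n in sequentially. rge p M (r n)" "\<forall>\<^sub>F n in sequentially. rge p N (t n)"
    using assms r t cls_Ov by auto
  then have "\<forall>\<^sub>F n in sequentially. rge p (M + N) (r n * t n)" by eventually_elim (rule rge_mult[OF prime])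
  then show ?thesis using r t cls_Ov[OF Cauchy_mult] by (simp add: cls_mult)
qed

lemma pv_mult:
  assumes "x \<in> carrier (Qp p)" "y \<in> carrier (Qp p)" "x \<noteq> \<zero>\<^bsub>Qp p\<^esub>" "y \<noteq> \<zero>\<^bsub>Qp p\<^esub>"
  shows "pv (x \<otimes>\<^bsub>Qp p\<^esub> y) = pv x + pv y"
proof -
  obtain r where r: "r \<in> padic_Cauchy p" "x = cls r"
    and rv: "\<forall>\<^sub>F n in sequentially. r n \<noteq> 0 \<and> rat_val p (r n) = pv x" using assms nonzeroE by blast
  obtain t where t: "t \<in> padic_Cauchy p" "y = cls t"
    and tv: "\<forall>\<^sub>F n in sequentially. t n \<noteq> 0 \<and> rat_val p (t n) = pv y" using assms nonzeroE by blast
  have "\<forall>\<^sub>F n in sequentially. r n * t n \<noteq> 0 \<and> rat_val p (r n * t n) = pv x + pv y"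
    using rv tv by eventually_elim (simp add: rat_val_mult[OF prime])
  then show ?thesis using pv_cls[OF Cauchy_mult] r t by (simp add: cls_mult)
qed

lemma iota_closed [simp]: "\<iota> q \<in> carrier (Qp p)" by (simp add: iota_cls cls_closed)

lemma iota_add: "\<iota> (x + y) = \<iota> x \<oplus>\<^bsub>Qp p\<^esub> \<iota> y" by (simp add: iota_cls cls_add)

lemma iota_mult: "\<iota> (x * y) = \<iota> x \<otimes>\<^bsub>Qp p\<^esub> \<iota> y" by (simp add: iota_cls cls_mult)

lemma iota_1: "\<iota> 1 = \<one>\<^bsub>Qp p\<^esub>" by (simp add: iota_cls cls_one)

lemma iota_0: "\<iota> 0 = \<zero>\<^bsub>Qp p\<^esub>" by (simp add: iota_cls cls_zero_iff null_iff)

lemma iota_minus: "\<iota> (- x) = \<ominus>\<^bsub>Qp p\<^esub> \<iota> x"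
  by (rule Q.minus_equality[symmetric]) (simp_all flip: iota_add iota_0)

lemma iota_diff: "\<iota> (x - y) = \<iota> x \<ominus>\<^bsub>Qp p\<^esub> \<iota> y"
  using iota_add[of x "- y"] by (simp add: iota_minus Q.minus_eq)

lemma iota_pow: "\<iota> (x ^ n) = \<iota> x [^]\<^bsub>Qp p\<^esub> n"
  by (induction n) (simp_all add: iota_1 iota_mult Q.m_comm)

lemma iota_Ov: "\<iota> q \<in> Ov N \<longleftrightarrow> rge p N q"
  by (simp add: iota_cls cls_Ov)

lemma iota_eq_0: "\<iota> q = \<zero>\<^bsub>Qp p\<^esub> \<longleftrightarrow> q = 0"
proof
  assume "\<iota> q = \<zero>\<^bsub>Qp p\<^esub>"
  then have "rge p (rat_val p q + 1) q" by (metis iota_Ov Ov_zero)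
  then show "q = 0" by (simp add: rge_def)
qed (simp add: iota_0)

lemma iota_inj: "\<iota> q = \<iota> r \<longleftrightarrow> q = r"
  using iota_eq_0[of "q - r"] iota_diff[of q r] by (metis Q.r_right_minus_eq eq_iff_diff_eq_0 iota_closed)

lemma pv_iota: "q \<noteq> 0 \<Longrightarrow> pv (\<iota> q) = rat_val p q"
  by (simp add: iota_cls pv_cls)

lemma Ov_minus: "x \<in> Ov N \<Longrightarrow> \<ominus>\<^bsub>Qp p\<^esub> x \<in> Ov N"
proof -
  assume x: "x \<in> Ov N"
  have "\<iota> (- 1) \<in> Ov 0" by (simp add: iota_Ov rge_def rat_val_1 rat_val_minus)
  then have "\<iota> (- 1) \<otimes>\<^bsub>Qp p\<^esub> x \<in> Ov (0 + N)" using x by (rule Ov_mult)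
  moreover have "\<iota> (- 1) \<otimes>\<^bsub>Qp p\<^esub> x = \<ominus>\<^bsub>Qp p\<^esub> x"
    using Ov_closed[OF x] by (simp add: iota_minus iota_1 Q.l_minus)
  ultimately show ?thesis by simp
qed

lemma Ov_diff: "x \<in> Ov N \<Longrightarrow> y \<in> Ov N \<Longrightarrow> x \<ominus>\<^bsub>Qp p\<^esub> y \<in> Ov N"
  by (simp add: Q.minus_eq Ov_add Ov_minus)

lemma Ov_diff_commute:
  assumes "x \<in> carrier (Qp p)" "y \<in> carrier (Qp p)"
  shows "x \<ominus>\<^bsub>Qp p\<^esub> y \<in> Ov N \<longleftrightarrow> y \<ominus>\<^bsub>Qp p\<^esub> x \<in> Ov N"
proof -
  have "\<ominus>\<^bsub>Qp p\<^esub> (x \<ominus>\<^bsub>Qp p\<^esub> y) = y \<ominus>\<^bsub>Qp p\<^esub> x" "\<ominus>\<^bsub>Qp p\<^esub> (y \<ominus>\<^bsub>Qp p\<^esub> x) = x \<ominus>\<^bsub>Qp p\<^esub> y"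
    using assms by algebra+
  then show ?thesis using Ov_minus by metis
qed

lemma Ov_diff_trans:
  assumes "x \<in> carrier (Qp p)" "y \<in> carrier (Qp p)" "z \<in> carrier (Qp p)"
    and "x \<ominus>\<^bsub>Qp p\<^esub> y \<in> Ov N" "y \<ominus>\<^bsub>Qp p\<^esub> z \<in> Ov N"
  shows "x \<ominus>\<^bsub>Qp p\<^esub> z \<in> Ov N"
proof -
  have "x \<ominus>\<^bsub>Qp p\<^esub> z = (x \<ominus>\<^bsub>Qp p\<^esub> y) \<oplus>\<^bsub>Qp p\<^esub> (y \<ominus>\<^bsub>Qp p\<^esub> z)"
    using assms by algebra
  then show ?thesis using Ov_add assms by simp
qed

lemma Ov_cong:
  assumes "x \<in> carrier (Qp p)" "y \<in> carrier (Qp p)" "x \<ominus>\<^bsub>Qp p\<^esub> y \<in> Ov N"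
  shows "x \<in> Ov N \<longleftrightarrow> y \<in> Ov N"
proof -
  have "x = (x \<ominus>\<^bsub>Qp p\<^esub> y) \<oplus>\<^bsub>Qp p\<^esub> y" "y = x \<ominus>\<^bsub>Qp p\<^esub> (x \<ominus>\<^bsub>Qp p\<^esub> y)" using assms by algebra+
  then show ?thesis using Ov_add Ov_diff assms by metis
qed

lemma pv_perturb:
  assumes "x \<in> carrier (Qp p)" "y \<in> carrier (Qp p)" "y \<noteq> \<zero>\<^bsub>Qp p\<^esub>" "x \<ominus>\<^bsub>Qp p\<^esub> y \<in> Ov (pv y + 1)"
  shows "x \<noteq> \<zero>\<^bsub>Qp p\<^esub>" "pv x = pv y"
proof -
  have 1: "x \<notin> Ov (pv y + 1)" using Ov_cong[OF assms(1,2,4)] Ov_pv assms by simp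
  then show nz: "x \<noteq> \<zero>\<^bsub>Qp p\<^esub>" by auto
  have "x \<in> Ov (pv y)" using Ov_cong[OF assms(1,2)] Ov_mono[OF assms(4)] Ov_pv assms by simp
  then show "pv x = pv y" using 1 Ov_pv[OF assms(1) nz] by simp
qed

lemma Ov_iota_of_nat [simp]: "\<iota> (of_nat a) \<in> Ov 0" by (simp add: iota_Ov rge_of_nat[OF prime])
lemma Ov_one [simp]: "\<one>\<^bsub>Qp p\<^esub> \<in> Ov 0" using Ov_iota_of_nat[of 1] by (simp add: iota_1)

lemma Ov_pow: "x \<in> Ov N \<Longrightarrow> x [^]\<^bsub>Qp p\<^esub> n \<in> Ov (int n * N)"
proof (induction n)
  case (Suc n)
  then show ?case using Ov_mult[of "x [^]\<^bsub>Qp p\<^esub> n" "int n * N" x N] by (simp add: algebra_simps)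
qed simp

lemma pow_nonzero: "x \<in> carrier (Qp p) \<Longrightarrow> x \<noteq> \<zero>\<^bsub>Qp p\<^esub> \<Longrightarrow> x [^]\<^bsub>Qp p\<^esub> (n::nat) \<noteq> \<zero>\<^bsub>Qp p\<^esub>"
  by (induction n) (auto simp: Q.integral_iff)

lemma pv_one: "pv \<one>\<^bsub>Qp p\<^esub> = 0" using pv_iota[of 1] by (simp add: iota_1 rat_val_1)

lemma pv_pow: "x \<in> carrier (Qp p) \<Longrightarrow> x \<noteq> \<zero>\<^bsub>Qp p\<^esub> \<Longrightarrow> pv (x [^]\<^bsub>Qp p\<^esub> n) = int n * pv x"
  by (induction n) (simp_all add: pv_one pv_mult pow_nonzero algebra_simps)

lemma iota_diff_Ov: "\<iota> (of_nat m) \<ominus>\<^bsub>Qp p\<^esub> \<iota> (of_nat n) \<in> Ov (int N) \<longleftrightarrow> [m = n] (mod p ^ N)"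
proof -
  have "\<iota> (of_nat m) \<ominus>\<^bsub>Qp p\<^esub> \<iota> (of_nat n) = \<iota> (of_int (int m - int n))" by (simp add: iota_diff)
  then have "\<iota> (of_nat m) \<ominus>\<^bsub>Qp p\<^esub> \<iota> (of_nat n) \<in> Ov (int N) \<longleftrightarrow> int p ^ N dvd int m - int n"
    using iota_Ov rge_of_int_iff[OF prime] by metis
  then show ?thesis by (metis cong_iff_dvd_diff cong_int_iff of_nat_power)
qed

lemma Zp_dense:
  assumes x: "x \<in> Ov 0"
  obtains n :: nat where "x \<ominus>\<^bsub>Qp p\<^esub> \<iota> (of_nat n) \<in> Ov (int N)"
proof -
  obtain r where r: "r \<in> padic_Cauchy p" "x = cls r" using x Ov_closed by (metis QpE)
  obtain M1 where 1: "\<And>m n. m \<ge> M1 \<Longrightarrow> n \<ge> M1 \<Longrightarrow> rge p (int N) (r m - r n)" using r(1)[unfolded Cauchy_iff] by blast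
  obtain M2 where 2: "\<And>n. n \<ge> M2 \<Longrightarrow> rge p 0 (r n)"
    using x cls_Ov[OF r(1)] unfolding r(2) eventually_sequentially by blast
  define q where "q = r (max M1 M2)"
  have "\<iota> q \<in> Ov 0" using 2 by (simp add: q_def iota_Ov)
  have xq: "x \<ominus>\<^bsub>Qp p\<^esub> \<iota> q \<in> Ov (int N)"
  proof -
    have "x \<ominus>\<^bsub>Qp p\<^esub> \<iota> q = cls (\<lambda>n. r n + - q)"
      by (simp add: Q.minus_eq r(2) flip: iota_minus) (simp add: iota_cls cls_add r(1))
    moreover have "\<forall>\<^sub>F n in sequentially. rge p (int N) (r n + - q)"
      unfolding eventually_sequentially using 1[of _ "max M1 M2"] by (auto simp: q_def intro!: exI[of _ M1])
    ultimately show ?thesis using cls_Ov[OF Cauchy_add[OF r(1) Cauchy_const]] by metis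
  qed
  obtain n :: nat where n: "rge p (int N) (q - of_nat n)"
  proof (cases "q = 0")
    case True then show ?thesis using that[of 0] by simp
  next
    case False
    obtain a d where ad: "quotient_of q = (a, d)" by fastforce
    have d: "d > 0" and q: "q = of_int a / of_int d" and co: "coprime a d"
      using quotient_of_denom_pos[OF ad] quotient_of_div[OF ad] quotient_of_coprime[OF ad] by auto
    have "rat_val p q \<ge> 0" using 2[of "max M1 M2"] False by (auto simp: q_def rge_def)
    have nu: "\<not> is_unit (int p)" using prime not_prime_unit[of "int p"] by auto
    have a0: "a \<noteq> 0" using q False by auto
    have pd: "\<not> int p dvd d"
    proof
      assume pd: "int p dvd d"
      then have "\<not> int p dvd a" using co nu by (meson coprime_common_divisor)
      then have "multiplicity (int p) a = 0" by (simp add: not_dvd_imp_multiplicity_0)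
      moreover have "multiplicity (int p) d > 0" using pd d nu by (simp add: multiplicity_gt_zero_iff)
      ultimately show False using \<open>rat_val p q \<ge> 0\<close> rat_val_divide[OF prime a0, of d] d q by simp
    qed
    then have "coprime (int p) d" using prime by (intro prime_imp_coprime) simp_all
    then have "coprime d (int p ^ N)" by (simp add: coprime_commute)
    then obtain e where e: "[d * e = 1] (mod int p ^ N)" using cong_solve_coprime_int by blast
    define n where "n = nat (a * e mod int p ^ N)"
    have "int p ^ N > 0" using prime prime_gt_0_nat by simp
    then have nn: "int n = a * e mod int p ^ N" by (simp add: n_def)
    have "[a - d * int n = a - d * (a * e)] (mod int p ^ N)" unfolding nn
      by (intro cong_diff cong_mult) (auto simp: cong_def)
    also have "[a - d * (a * e) = a - a * 1] (mod int p ^ N)"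
      using cong_mult[OF cong_refl[of a] e] by (intro cong_diff) (auto simp: ac_simps)
    finally have "int p ^ N dvd a - d * int n" by (simp add: cong_0_iff)
    then have "rge p (int N) (of_int (a - d * int n))" using rge_of_int_iff[OF prime] by blast
    moreover have "rge p 0 (1 / of_int d)"
      using rat_val_divide[OF prime, of 1 d] d pd by (simp add: rge_def not_dvd_imp_multiplicity_0)
    ultimately have "rge p (int N + 0) (of_int (a - d * int n) * (1 / of_int d))" by (rule rge_mult[OF prime])
    moreover have "of_int (a - d * int n) * (1 / of_int d) = q - of_nat n" using d q by (simp add: field_simps)
    ultimately show ?thesis using that by simp
  qed
  have "\<iota> q \<ominus>\<^bsub>Qp p\<^esub> \<iota> (of_nat n) \<in> Ov (int N)" using n by (simp add: iota_Ov flip: iota_diff)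
  then have "x \<ominus>\<^bsub>Qp p\<^esub> \<iota> (of_nat n) \<in> Ov (int N)" by (intro Ov_diff_trans[OF Ov_closed[OF x] _ _ xq]) simp_all
  then show ?thesis by (rule that)
qed

lemma coherent_limit:
  assumes c: "\<And>N. [c (Suc N) = c N] (mod p ^ N)"
  obtains x where "x \<in> Ov 0" "\<And>N. x \<ominus>\<^bsub>Qp p\<^esub> \<iota> (of_nat (c N)) \<in> Ov (int N)"
proof -
  have c': "[c n = c N] (mod p ^ N)" if "N \<le> n" for n N
    using that
  proof (induction n rule: dec_induct)
    case (step n)
    have "[c (Suc n) = c n] (mod p ^ N)" using c[of n] le_imp_power_dvd[OF step(1), of p] cong_dvd_modulus_nat by blast
    then show ?case using step cong_trans by blast
  qed simp
  have rg: "rge p (int N) (of_nat (c m) - of_nat (c n))" if "[c m = c n] (mod p ^ N)" for m n N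
    using that iota_diff_Ov[of "c m" "c n" N] iota_Ov by (simp flip: iota_diff)
  let ?r = "\<lambda>n. of_nat (c n) :: rat"
  have r: "?r \<in> padic_Cauchy p" unfolding Cauchy_iff
  proof
    fix N :: int
    have "rge p N (?r m - ?r n)" if "m \<ge> nat N" "n \<ge> nat N" for m n
      using rg[OF cong_trans[OF c'[OF that(1)] cong_sym[OF c'[OF that(2)]]]] by (rule rge_mono) simp
    then show "\<exists>M. \<forall>m\<ge>M. \<forall>n\<ge>M. rge p N (?r m - ?r n)" by blast
  qed
  show ?thesis
  proof (rule that[of "cls ?r"])
    show "cls ?r \<in> Ov 0" using cls_Ov[OF r] rge_of_nat[OF prime] by simp
    fix N
    have "cls ?r \<ominus>\<^bsub>Qp p\<^esub> \<iota> (of_nat (c N)) = cls (\<lambda>n. ?r n + - of_nat (c N))"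
      by (simp add: Q.minus_eq flip: iota_minus) (simp add: iota_cls cls_add r)
    moreover have "\<forall>\<^sub>F n in sequentially. rge p (int N) (?r n + - of_nat (c N))"
      unfolding eventually_sequentially using rg c' by (auto intro!: exI[of _ N])
    ultimately show "cls ?r \<ominus>\<^bsub>Qp p\<^esub> \<iota> (of_nat (c N)) \<in> Ov (int N)"
      using cls_Ov[OF Cauchy_add[OF r Cauchy_const]] by metis
  qed
qed

lemma carrier_Zp: "carrier (Zp p) = Ov 0" by (simp add: Zp_def Ov_def)

end

section \<open>Polynomials over \<open>\<rat>\<^sub>p\<close>\<close>

context padic
begin

lemma poly_set: "f \<in> carrier (poly_ring (Qp p)) \<Longrightarrow> set f \<subseteq> carrier (Qp p)"
  by (simp add: Q.polynomial_incl univ_poly_def)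

lemma mult_diff_split:
  assumes "u \<in> carrier (Qp p)" "v \<in> carrier (Qp p)" "x \<in> carrier (Qp p)" "y \<in> carrier (Qp p)"
  shows "u \<otimes>\<^bsub>Qp p\<^esub> x \<ominus>\<^bsub>Qp p\<^esub> v \<otimes>\<^bsub>Qp p\<^esub> y = (u \<ominus>\<^bsub>Qp p\<^esub> v) \<otimes>\<^bsub>Qp p\<^esub> x \<oplus>\<^bsub>Qp p\<^esub> v \<otimes>\<^bsub>Qp p\<^esub> (x \<ominus>\<^bsub>Qp p\<^esub> y)"
  using assms by algebra

lemma affine_diff_split:
  assumes "a \<in> carrier (Qp p)" "u \<in> carrier (Qp p)" "v \<in> carrier (Qp p)" "x \<in> carrier (Qp p)" "y \<in> carrier (Qp p)"
  shows "(a \<otimes>\<^bsub>Qp p\<^esub> u \<oplus>\<^bsub>Qp p\<^esub> x) \<ominus>\<^bsub>Qp p\<^esub> (a \<otimes>\<^bsub>Qp p\<^esub> v \<oplus>\<^bsub>Qp p\<^esub> y) =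
    a \<otimes>\<^bsub>Qp p\<^esub> (u \<ominus>\<^bsub>Qp p\<^esub> v) \<oplus>\<^bsub>Qp p\<^esub> (x \<ominus>\<^bsub>Qp p\<^esub> y)"
  using assms by algebra

lemma pow_diff_Ov:
  assumes "x \<in> Ov 0" "y \<in> Ov 0" "x \<ominus>\<^bsub>Qp p\<^esub> y \<in> Ov N"
  shows "x [^]\<^bsub>Qp p\<^esub> (n::nat) \<ominus>\<^bsub>Qp p\<^esub> y [^]\<^bsub>Qp p\<^esub> n \<in> Ov N"
proof (induction n)
  case 0
  then show ?case by (simp add: Q.minus_eq Q.r_neg)
next
  case (Suc n)
  have c: "x \<in> carrier (Qp p)" "y \<in> carrier (Qp p)" "x [^]\<^bsub>Qp p\<^esub> n \<in> carrier (Qp p)" "y [^]\<^bsub>Qp p\<^esub> n \<in> carrier (Qp p)"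
    using assms Ov_closed by auto
  have e: "x [^]\<^bsub>Qp p\<^esub> Suc n \<ominus>\<^bsub>Qp p\<^esub> y [^]\<^bsub>Qp p\<^esub> Suc n =
      (x [^]\<^bsub>Qp p\<^esub> n \<ominus>\<^bsub>Qp p\<^esub> y [^]\<^bsub>Qp p\<^esub> n) \<otimes>\<^bsub>Qp p\<^esub> x \<oplus>\<^bsub>Qp p\<^esub> y [^]\<^bsub>Qp p\<^esub> n \<otimes>\<^bsub>Qp p\<^esub> (x \<ominus>\<^bsub>Qp p\<^esub> y)"
    unfolding Q.nat_pow_Suc using c by (intro mult_diff_split)
  show ?case unfolding e
    using Ov_mult[OF Suc assms(1)] Ov_mult[OF _ assms(3), of "y [^]\<^bsub>Qp p\<^esub> n" 0] Ov_pow[OF assms(2), of n]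
    by (intro Ov_add) auto
qed

lemma eval_continuous:
  assumes "set f \<subseteq> carrier (Qp p)"
  shows "\<exists>C. \<forall>x\<in>Ov 0. \<forall>y\<in>Ov 0. \<forall>N. x \<ominus>\<^bsub>Qp p\<^esub> y \<in> Ov (N + C) \<longrightarrow>
    ring.eval (Qp p) f x \<ominus>\<^bsub>Qp p\<^esub> ring.eval (Qp p) f y \<in> Ov N"
  using assms
proof (induction f)
  case Nil
  then show ?case by (auto simp: Q.minus_eq)
next
  case (Cons a f)
  then obtain C where C: "\<And>x y N. x \<in> Ov 0 \<Longrightarrow> y \<in> Ov 0 \<Longrightarrow> x \<ominus>\<^bsub>Qp p\<^esub> y \<in> Ov (N + C) \<Longrightarrow> Q.eval f x \<ominus>\<^bsub>Qp p\<^esub> Q.eval f y \<in> Ov N" by auto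
  obtain D where D: "a \<in> Ov D" using Cons.prems Ov_ex[of a] by auto
  have "Q.eval (a # f) x \<ominus>\<^bsub>Qp p\<^esub> Q.eval (a # f) y \<in> Ov N"
    if x: "x \<in> Ov 0" and y: "y \<in> Ov 0" and xy: "x \<ominus>\<^bsub>Qp p\<^esub> y \<in> Ov (N + max C (- D))" for x y N
  proof -
    have c: "a \<in> carrier (Qp p)" "x \<in> carrier (Qp p)" "y \<in> carrier (Qp p)" "x [^]\<^bsub>Qp p\<^esub> length f \<in> carrier (Qp p)"
      "y [^]\<^bsub>Qp p\<^esub> length f \<in> carrier (Qp p)" "Q.eval f x \<in> carrier (Qp p)" "Q.eval f y \<in> carrier (Qp p)"
      using x y Ov_closed Cons Q.eval_in_carrier by auto
    have e: "Q.eval (a # f) x \<ominus>\<^bsub>Qp p\<^esub> Q.eval (a # f) y = a \<otimes>\<^bsub>Qp p\<^esub> (x [^]\<^bsub>Qp p\<^esub> length f \<ominus>\<^bsub>Qp p\<^esub> y [^]\<^bsub>Qp p\<^esub> length f)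
        \<oplus>\<^bsub>Qp p\<^esub> (Q.eval f x \<ominus>\<^bsub>Qp p\<^esub> Q.eval f y)"
      using c affine_diff_split by simp
    have "a \<otimes>\<^bsub>Qp p\<^esub> (x [^]\<^bsub>Qp p\<^esub> length f \<ominus>\<^bsub>Qp p\<^esub> y [^]\<^bsub>Qp p\<^esub> length f) \<in> Ov (D + (N - D))"
      by (intro Ov_mult D pow_diff_Ov x y Ov_mono[OF xy]) auto
    moreover have "Q.eval f x \<ominus>\<^bsub>Qp p\<^esub> Q.eval f y \<in> Ov N" by (intro C x y Ov_mono[OF xy]) auto
    ultimately show ?thesis unfolding e by (intro Ov_add) auto
  qed
  then show ?case by blast
qed

lemma eval_factor:
  assumes f: "f \<in> carrier (poly_ring (Qp p))" "f \<noteq> []" and th: "\<theta> \<in> carrier (Qp p)"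
  obtains g where "g \<in> carrier (poly_ring (Qp p))" "ring.eval (Qp p) g \<theta> \<noteq> \<zero>\<^bsub>Qp p\<^esub>"
    "\<And>x. x \<in> carrier (Qp p) \<Longrightarrow> ring.eval (Qp p) f x =
       (x \<ominus>\<^bsub>Qp p\<^esub> \<theta>) [^]\<^bsub>Qp p\<^esub> (ring.alg_mult (Qp p) f \<theta>) \<otimes>\<^bsub>Qp p\<^esub> ring.eval (Qp p) g x"
proof -
  let ?P = "poly_ring (Qp p)" and ?l = "[\<one>\<^bsub>Qp p\<^esub>, \<ominus>\<^bsub>Qp p\<^esub> \<theta>]" and ?m = "Q.alg_mult f \<theta>"
  interpret P: domain ?P by (rule Q.univ_poly_is_domain[OF Q.carrier_is_subring])
  have l: "?l \<in> carrier ?P" using th by (simp add: univ_poly_def polynomial_def)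
  have lm: "?l [^]\<^bsub>?P\<^esub> n \<in> carrier ?P" for n :: nat using l by simp
  obtain g where g: "g \<in> carrier ?P" "f = ?l [^]\<^bsub>?P\<^esub> ?m \<otimes>\<^bsub>?P\<^esub> g"
    using Q.alg_multE(1)[OF th f] unfolding pdivides_def factor_def by blast
  have le: "Q.eval ?l x = x \<ominus>\<^bsub>Qp p\<^esub> \<theta>" if "x \<in> carrier (Qp p)" for x
    using that th by (simp add: Q.minus_eq)
  have lme: "Q.eval (?l [^]\<^bsub>?P\<^esub> n) x = (x \<ominus>\<^bsub>Qp p\<^esub> \<theta>) [^]\<^bsub>Qp p\<^esub> n" if x: "x \<in> carrier (Qp p)" for x and n :: nat
  proof (induction n)
    case 0
    then show ?case by (simp add: univ_poly_def)
  next
    case (Suc n)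
    then show ?case using Q.eval_poly_mult[OF poly_set[OF lm] poly_set[OF l] x, of n] le[OF x]
      by (simp add: univ_poly_mult)
  qed
  have ev: "Q.eval f x = (x \<ominus>\<^bsub>Qp p\<^esub> \<theta>) [^]\<^bsub>Qp p\<^esub> ?m \<otimes>\<^bsub>Qp p\<^esub> Q.eval g x" if x: "x \<in> carrier (Qp p)" for x
    using Q.eval_poly_mult[OF poly_set[OF lm] poly_set[OF g(1)] x] lme[OF x] arg_cong[OF g(2), of "\<lambda>h. Q.eval h x"]
    by (simp add: univ_poly_mult)
  have "Q.eval g \<theta> \<noteq> \<zero>\<^bsub>Qp p\<^esub>"
  proof
    assume g0: "Q.eval g \<theta> = \<zero>\<^bsub>Qp p\<^esub>"
    have "g \<noteq> []" using g(2) f(2) lm P.r_null by (metis univ_poly_zero)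
    then have "Q.is_root g \<theta>" using g0 th by (simp add: Q.is_root_def)
    then obtain h where h: "h \<in> carrier ?P" "g = ?l \<otimes>\<^bsub>?P\<^esub> h"
      using Q.is_root_imp_pdivides[OF g(1)] unfolding pdivides_def factor_def by blast
    have "f = ?l [^]\<^bsub>?P\<^esub> Suc ?m \<otimes>\<^bsub>?P\<^esub> h"
      using g(2) h l lm by (simp add: P.m_assoc)
    then have "?l [^]\<^bsub>?P\<^esub> Suc ?m pdivides\<^bsub>Qp p\<^esub> f" unfolding pdivides_def factor_def using h by blast
    then show False using Q.alg_multE(2)[OF th f] by fastforce
  qed
  then show ?thesis using that g(1) ev by blast
qed

text \<open>If the valuations of the values of \<open>f\<close> on \<open>\<nat>\<close> are unbounded, one of the residue classes
  modulo \<open>p\<^sup>N\<close> has the same property for every \<open>N\<close>, and a coherent choice of such classes converges to a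
  root.\<close>

lemma val_bounded_if_no_root:
  assumes f: "f \<in> carrier (poly_ring (Qp p))" "f \<noteq> []" and no: "Zp_roots p f = {}"
  obtains C where "\<And>n::nat. ring.eval (Qp p) f (\<iota> (of_nat n)) \<notin> Ov C"
proof (rule ccontr)
  assume "\<not> thesis"
  then have un: "\<exists>n::nat. Q.eval f (\<iota> (of_nat n)) \<in> Ov C" for C using that by blast
  define U where "U N r \<longleftrightarrow> (\<forall>C. \<exists>n. [n = r] (mod p ^ N) \<and> Q.eval f (\<iota> (of_nat n)) \<in> Ov C)" for N r
  have U0: "U 0 0" using un by (auto simp: U_def cong_def)
  have US: "\<exists>r'. [r' = r] (mod p ^ N) \<and> U (Suc N) r'" if "U N r" for N r
  proof (rule ccontr)
    assume "\<not> ?thesis"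
    then have "\<forall>r'. \<exists>C. [r' = r] (mod p ^ N) \<longrightarrow> (\<forall>n. [n = r'] (mod p ^ Suc N) \<longrightarrow> Q.eval f (\<iota> (of_nat n)) \<notin> Ov C)"
      unfolding U_def by blast
    then obtain C where C: "\<And>r' n. [r' = r] (mod p ^ N) \<Longrightarrow> [n = r'] (mod p ^ Suc N) \<Longrightarrow> Q.eval f (\<iota> (of_nat n)) \<notin> Ov (C r')"
      by metis
    define D where "D = Max (C ` {..<p ^ Suc N})"
    have pp: "p ^ Suc N > 0" using prime prime_gt_0_nat by simp
    obtain n where n: "[n = r] (mod p ^ N)" "Q.eval f (\<iota> (of_nat n)) \<in> Ov D" using \<open>U N r\<close> U_def by blast
    define r' where "r' = n mod p ^ Suc N"
    have r': "[n = r'] (mod p ^ Suc N)" by (simp add: r'_def cong_def)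
    then have "[n = r'] (mod p ^ N)" using cong_dvd_modulus_nat le_imp_power_dvd[of N "Suc N" p] by auto
    then have "[r' = r] (mod p ^ N)" using n(1) by (metis cong_sym cong_trans)
    then have "Q.eval f (\<iota> (of_nat n)) \<notin> Ov (C r')" using C r' by blast
    moreover have "r' \<in> {..<p ^ Suc N}" using pp by (simp add: r'_def)
    then have "C r' \<le> D" unfolding D_def by (intro Max_ge) auto
    ultimately show False using n(2) Ov_mono by blast
  qed
  define c where "c = rec_nat 0 (\<lambda>N r. SOME r'. [r' = r] (mod p ^ N) \<and> U (Suc N) r')"
  have c: "U N (c N) \<and> [c (Suc N) = c N] (mod p ^ N)" for N
  proof -
    have *: "[c (Suc N) = c N] (mod p ^ N) \<and> U (Suc N) (c (Suc N))" if "U N (c N)" for N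
      using someI_ex[OF US[OF that]] by (simp add: c_def)
    have "U N (c N)"
      by (induction N) (use U0 * in \<open>auto simp: c_def\<close>)
    then show ?thesis using * by blast
  qed
  then obtain x where x: "x \<in> Ov 0" "\<And>N. x \<ominus>\<^bsub>Qp p\<^esub> \<iota> (of_nat (c N)) \<in> Ov (int N)"
    using coherent_limit[of c] by blast
  obtain D where D: "\<And>x y N. x \<in> Ov 0 \<Longrightarrow> y \<in> Ov 0 \<Longrightarrow> x \<ominus>\<^bsub>Qp p\<^esub> y \<in> Ov (N + D) \<Longrightarrow> Q.eval f x \<ominus>\<^bsub>Qp p\<^esub> Q.eval f y \<in> Ov N"
    using eval_continuous[OF poly_set[OF f(1)]] by blast
  have xc: "x \<in> carrier (Qp p)" using x Ov_closed by blast
  have fc: "Q.eval f y \<in> carrier (Qp p)" if "y \<in> carrier (Qp p)" for y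
    using Q.eval_in_carrier poly_set f that by blast
  have "Q.eval f x = \<zero>\<^bsub>Qp p\<^esub>"
  proof (rule Ov_zeroI)
    fix N
    let ?M = "nat (N + D)"
    obtain n where n: "[n = c ?M] (mod p ^ ?M)" "Q.eval f (\<iota> (of_nat n)) \<in> Ov N" using c[of ?M] U_def by blast
    have "x \<ominus>\<^bsub>Qp p\<^esub> \<iota> (of_nat n) \<in> Ov (int ?M)"
      by (rule Ov_diff_trans[OF xc _ _ x(2)[of ?M]]) (use cong_sym[OF n(1)] in \<open>simp_all only: iota_diff_Ov iota_closed\<close>)
    then have "x \<ominus>\<^bsub>Qp p\<^esub> \<iota> (of_nat n) \<in> Ov (N + D)" by (rule Ov_mono) simp
    then show "Q.eval f x \<in> Ov N" using D[OF x(1) Ov_iota_of_nat] Ov_cong[OF fc[OF xc] fc[OF iota_closed]] n(2) by blast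
  qed (use fc xc in simp)
  then have "x \<in> Zp_roots p f" using x xc f by (simp add: Zp_roots_def carrier_Zp Q.is_root_def)
  then show False using no by simp
qed

end

section \<open>Finitely generated abelian groups\<close>

lemma int_subgroup_principal:
  fixes I :: "int set"
  assumes 0: "0 \<in> I" and diff: "\<And>x y. x \<in> I \<Longrightarrow> y \<in> I \<Longrightarrow> x - y \<in> I"
  shows "\<exists>d\<in>I. \<forall>z\<in>I. d dvd z"
proof (cases "\<exists>n>0. int n \<in> I")
  case True
  define d where "d = (LEAST n. n > 0 \<and> int n \<in> I)"
  have d: "d > 0" "int d \<in> I" using LeastI_ex[OF True] by (auto simp: d_def)
  have least: "d \<le> n" if "n > 0" "int n \<in> I" for n using that by (auto simp: d_def intro: Least_le)
  have neg: "- x \<in> I" if "x \<in> I" for x using diff[OF 0 that] by simp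
  have mulN: "int n * int d \<in> I" for n
  proof (induction n)
    case (Suc n)
    have "int (Suc n) * int d = int n * int d - (- int d)" by (simp add: algebra_simps)
    then show ?case using diff[OF Suc neg[OF d(2)]] by simp
  qed (use 0 in simp)
  have mul: "z * int d \<in> I" for z
  proof (cases z rule: int_cases2)
    case (nonpos n)
    then show ?thesis using neg[OF mulN[of n]] by simp
  qed (use mulN in simp)
  have "int d dvd z" if "z \<in> I" for z
  proof -
    have "z mod int d = z - (z div int d) * int d" by (simp add: minus_div_mult_eq_mod)
    then have "z mod int d \<in> I" using diff[OF that mul] by simp
    moreover have "0 \<le> z mod int d" "z mod int d < int d" using d by auto
    ultimately have "z mod int d = 0" using least[of "nat (z mod int d)"] by force
    then show ?thesis by (simp add: dvd_eq_mod_eq_0)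
  qed
  then show ?thesis using d by blast
next
  case False
  have "z = 0" if "z \<in> I" for z
  proof (cases z rule: int_cases2)
    case (nonneg n)
    then show ?thesis using False that by (cases n) auto
  next
    case (nonpos n)
    then have "int n \<in> I" using diff[OF 0 that] by simp
    then show ?thesis using False nonpos by (cases n) auto
  qed
  then show ?thesis using 0 by auto
qed

lemma (in comm_group) generate_insertE:
  assumes "x \<in> carrier G" "S \<subseteq> carrier G" "y \<in> generate G (insert x S)"
  obtains z :: int and g where "g \<in> generate G S" "y = x [^] z \<otimes> g"
proof -
  have gc: "g \<in> generate G S \<Longrightarrow> g \<in> carrier G" for g using generate_in_carrier[OF assms(2)] .
  have "\<exists>z::int. \<exists>g\<in>generate G S. y = x [^] z \<otimes> g"
    using assms(3)
  proof (induction y rule: generate.induct)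
    case one
    show ?case by (rule exI[of _ 0], rule bexI[of _ \<one>]) (auto intro: generate.one)
  next
    case (incl h)
    show ?case
    proof (cases "h = x")
      case True
      then show ?thesis using assms by (intro exI[of _ 1] bexI[of _ \<one>]) (auto intro: generate.one)
    next
      case False
      then show ?thesis using incl assms by (intro exI[of _ 0] bexI[of _ h]) (auto intro: generate.incl)
    qed
  next
    case (inv h)
    show ?case
    proof (cases "h = x")
      case True
      then show ?thesis using assms by (intro exI[of _ "- 1"] bexI[of _ \<one>]) (auto intro: generate.one simp: int_pow_neg)
    next
      case False
      then show ?thesis using inv assms by (intro exI[of _ 0] bexI[of _ "inv h"]) (auto intro: generate.inv)
    qed
  next
    case (eng h1 h2)
    then obtain z1 z2 :: int and g1 g2 where g: "g1 \<in> generate G S" "h1 = x [^] z1 \<otimes> g1"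
      "g2 \<in> generate G S" "h2 = x [^] z2 \<otimes> g2" by blast
    have "h1 \<otimes> h2 = x [^] (z1 + z2) \<otimes> (g1 \<otimes> g2)"
      using g gc assms by (simp add: int_pow_mult m_ac)
    then show ?case using generate.eng[OF g(1,3)] by blast
  qed
  then show ?thesis using that by blast
qed

lemma (in comm_group) cancel_both:
  assumes "x \<in> carrier G" "u \<in> carrier G" "g \<in> carrier G"
  shows "(x \<otimes> u) \<otimes> (g \<otimes> inv u) = x \<otimes> g"
proof -
  have "(x \<otimes> u) \<otimes> (g \<otimes> inv u) = (x \<otimes> g) \<otimes> (u \<otimes> inv u)"
    using assms by (simp only: m_ac m_closed inv_closed)
  then show ?thesis using assms by simp
qed

lemma (in comm_group) m_ac4:
  assumes "x \<in> carrier G" "y \<in> carrier G" "u \<in> carrier G" "v \<in> carrier G"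
  shows "(x \<otimes> y) \<otimes> (u \<otimes> v) = (x \<otimes> u) \<otimes> (y \<otimes> v)"
  using assms by (simp add: m_ac)

lemma (in comm_group) subgroup_of_fg:
  assumes "finite S" "S \<subseteq> carrier G" "subgroup H G" "H \<subseteq> generate G S"
  shows "\<exists>T. finite T \<and> T \<subseteq> H \<and> H = generate G T"
  using assms
proof (induction S arbitrary: H)
  case empty
  then have "H = {\<one>}" using subgroup.one_closed generate_empty by blast
  then show ?case using generate_empty by (intro exI[of _ "{}"]) auto
next
  case (insert x S)
  interpret H: subgroup H G by fact
  have x: "x \<in> carrier G" and S: "S \<subseteq> carrier G" using insert by auto
  have gs: "subgroup (generate G S) G" using generate_is_subgroup[OF S] .
  interpret GS: subgroup "generate G S" G by fact
  define I where "I = {z::int. \<exists>g\<in>generate G S. x [^] z \<otimes> g \<in> H}"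
  have I0: "0 \<in> I" by (auto simp: I_def intro!: bexI[of _ \<one>] generate.one)
  have Id: "z - w \<in> I" if zI: "z \<in> I" and wI: "w \<in> I" for z w
  proof -
    obtain g h where gh: "g \<in> generate G S" "x [^] z \<otimes> g \<in> H" "h \<in> generate G S" "x [^] w \<otimes> h \<in> H"
      using zI wI by (auto simp: I_def)
    then have c: "g \<in> carrier G" "h \<in> carrier G" by auto
    have "x [^] (z - w) \<otimes> (g \<otimes> inv h) = (x [^] z \<otimes> g) \<otimes> inv (x [^] w \<otimes> h)"
      using c x by (simp add: int_pow_diff inv_mult m_ac)
    also have "\<dots> \<in> H" using gh by blast
    finally show ?thesis using gh by (auto simp: I_def)
  qed
  obtain d where d: "d \<in> I" "\<And>z. z \<in> I \<Longrightarrow> d dvd z" using int_subgroup_principal[OF I0 Id] by blast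
  then obtain g0 where g0: "g0 \<in> generate G S" "x [^] d \<otimes> g0 \<in> H" by (auto simp: I_def)
  have "subgroup (H \<inter> generate G S) G" using subgroups_Inter_pair[OF insert.prems(2) gs] .
  then obtain T where T: "finite T" "T \<subseteq> H \<inter> generate G S" "H \<inter> generate G S = generate G T"
    using insert.IH[of "H \<inter> generate G S"] S by blast
  define h0 where "h0 = x [^] d \<otimes> g0"
  have h0: "h0 \<in> H" "h0 \<in> carrier G" using g0 by (auto simp: h0_def)
  have T': "insert h0 T \<subseteq> H" using T h0 by auto
  have gT: "generate G (insert h0 T) \<subseteq> H" using generate_subgroup_incl[OF T' insert.prems(2)] .
  have gTs: "subgroup (generate G (insert h0 T)) G" using T' generate_is_subgroup by (meson H.subset subset_trans)
  interpret GT: subgroup "generate G (insert h0 T)" G by fact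
  have "H \<subseteq> generate G (insert h0 T)"
  proof
    fix y assume y: "y \<in> H"
    then have "y \<in> generate G (insert x S)" using insert.prems by blast
    then obtain z :: int and g where g: "g \<in> generate G S" "y = x [^] z \<otimes> g"
      by (rule generate_insertE[OF x S])
    then have "z \<in> I" using y by (auto simp: I_def)
    then obtain q where q: "z = d * q" using d by blast
    have c: "g \<in> carrier G" "g0 \<in> carrier G" using g g0 by auto
    have hq: "h0 [^] q = x [^] z \<otimes> g0 [^] q"
      using c x by (simp add: h0_def int_pow_distrib int_pow_pow q)
    have e: "y = h0 [^] q \<otimes> (g \<otimes> inv (g0 [^] q))"
      unfolding hq g(2) using c x by (intro cancel_both[symmetric]) auto
    have "g \<otimes> inv (g0 [^] q) = y \<otimes> inv (h0 [^] q)"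
      unfolding e using cancel_both[of \<one> "h0 [^] q" "g \<otimes> inv (g0 [^] q)"] c h0 by (simp add: m_assoc)
    moreover have "h0 [^] q \<in> H" using h0 by (simp add: H.subgroup_axioms subgroup_int_pow_closed)
    ultimately have "g \<otimes> inv (g0 [^] q) \<in> H \<inter> generate G S"
      using y g(1) g0 subgroup_int_pow_closed[OF gs g0(1), of q] by (metis H.m_closed H.m_inv_closed GS.m_closed GS.m_inv_closed IntI)
    then have "g \<otimes> inv (g0 [^] q) \<in> generate G (insert h0 T)"
      using T mono_generate[of T "insert h0 T"] by blast
    moreover have "h0 [^] q \<in> generate G (insert h0 T)"
      using generate.incl[of h0 "insert h0 T" G] gTs by (simp add: subgroup_int_pow_closed)
    ultimately show "y \<in> generate G (insert h0 T)" unfolding e by blast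
  qed
  then show ?case using gT T T' by (intro exI[of _ "insert h0 T"]) auto
qed

lemma (in comm_group) fg_mod_finite:
  assumes "finite S" "S \<subseteq> carrier G" "e > (0::int)"
  shows "\<exists>F. finite F \<and> F \<subseteq> carrier G \<and> (\<forall>c\<in>generate G S. \<exists>f\<in>F. \<exists>h\<in>generate G S. c = f \<otimes> h [^] e)"
  using assms
proof (induction S)
  case empty
  have "\<one> = \<one> \<otimes> \<one> [^] e" by (simp only: int_pow_one l_one one_closed)
  then show ?case by (intro exI[of _ "{\<one>}"]) (simp add: generate_empty)
next
  case (insert x S)
  have x: "x \<in> carrier G" and S: "S \<subseteq> carrier G" using insert.prems by auto
  obtain F where F: "finite F" "F \<subseteq> carrier G"
    and Fc: "\<forall>c\<in>generate G S. \<exists>f\<in>F. \<exists>h\<in>generate G S. c = f \<otimes> h [^] e"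
    using insert.IH[OF S insert.prems(2)] by (elim exE conjE) (rule that)
  define F' where "F' = (\<lambda>(r, f). x [^] r \<otimes> f) ` ({0..<e} \<times> F)"
  have "\<exists>f\<in>F'. \<exists>h\<in>generate G (insert x S). c = f \<otimes> h [^] e" if cin: "c \<in> generate G (insert x S)" for c
  proof -
    obtain z :: int and g where g: "g \<in> generate G S" "c = x [^] z \<otimes> g"
      by (rule generate_insertE[OF x S cin])
    obtain f h where fh: "f \<in> F" "h \<in> generate G S" "g = f \<otimes> h [^] e"
      using bspec[OF Fc g(1)] by (elim bexE) (rule that)
    have cc: "f \<in> carrier G" "h \<in> carrier G" using fh F generate_in_carrier[OF S] by auto
    have "x [^] (z mod e + (z div e) * e) = x [^] (z mod e) \<otimes> (x [^] (z div e)) [^] e"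
      by (simp only: int_pow_mult[OF x] int_pow_pow[OF x])
    then have xz: "x [^] z = x [^] (z mod e) \<otimes> (x [^] (z div e)) [^] e" by simp
    have ceq: "c = (x [^] (z mod e) \<otimes> f) \<otimes> (x [^] (z div e) \<otimes> h) [^] e"
      unfolding g(2) fh(3) xz
      using m_ac4[of "x [^] (z mod e)" "(x [^] (z div e)) [^] e" f "h [^] e"] cc x
      by (simp only: int_pow_distrib int_pow_closed)
    have fin: "x [^] (z mod e) \<otimes> f \<in> F'" 
      unfolding F'_def using fh insert.prems by (intro image_eqI[of _ _ "(z mod e, f)"]) auto
    have hin: "x [^] (z div e) \<otimes> h \<in> generate G (insert x S)"
    proof -
      have "h \<in> generate G (insert x S)" using fh(2) mono_generate[of S "insert x S"] by blast
      moreover have "x [^] (z div e) \<in> generate G (insert x S)"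
        by (rule subgroup_int_pow_closed[OF generate_is_subgroup[OF insert.prems(1)]]) (simp add: generate.incl)
      ultimately show ?thesis by (intro generate.eng)
    qed
    show ?thesis by (rule bexI[OF _ fin], rule bexI[OF _ hin], rule ceq)
  qed
  moreover have "finite F'" using F(1) by (simp add: F'_def)
  moreover have "F' \<subseteq> carrier G" using F(2) x by (auto simp: F'_def)
  ultimately show ?case by (intro exI[of _ F']) blast
qed

lemma comm_group_product_group:
  assumes "\<And>i. i \<in> I \<Longrightarrow> comm_group (G i)" shows "comm_group (product_group I G)"
proof (rule group.group_comm_groupI)
  show "Group.group (product_group I G)" using assms by (simp add: comm_group_def)
  fix x y assume "x \<in> carrier (product_group I G)" "y \<in> carrier (product_group I G)"
  then show "x \<otimes>\<^bsub>product_group I G\<^esub> y = y \<otimes>\<^bsub>product_group I G\<^esub> x"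
    using assms by (auto simp: PiE_iff comm_group_def comm_monoid.m_comm intro!: restrict_ext)
qed

lemma seq_group_simps:
  "carrier (seq_group R) = {a. \<forall>n. a n \<in> carrier R}"
  "x \<otimes>\<^bsub>seq_group R\<^esub> y = (\<lambda>n. x n \<oplus>\<^bsub>R\<^esub> y n)"
  "\<one>\<^bsub>seq_group R\<^esub> = (\<lambda>n. \<zero>\<^bsub>R\<^esub>)"
  by (auto simp: seq_group_def)

locale multi_padic =
  fixes s :: nat and p :: "nat \<Rightarrow> nat"
  assumes primes: "\<And>i. i \<in> {1..s} \<Longrightarrow> Factorial_Ring.prime (p i)"
begin

lemma padic: "i \<in> {1..s} \<Longrightarrow> padic (p i)"
  using primes by (simp add: padic_def)

lemma Qb_simps:
  "carrier (Qb s p) = (\<Pi>\<^sub>E i\<in>{1..s}. carrier (Qp (p i)))"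
  "x \<oplus>\<^bsub>Qb s p\<^esub> y = (\<lambda>i\<in>{1..s}. x i \<oplus>\<^bsub>Qp (p i)\<^esub> y i)"
  "x \<otimes>\<^bsub>Qb s p\<^esub> y = (\<lambda>i\<in>{1..s}. x i \<otimes>\<^bsub>Qp (p i)\<^esub> y i)"
  "\<zero>\<^bsub>Qb s p\<^esub> = (\<lambda>i\<in>{1..s}. \<zero>\<^bsub>Qp (p i)\<^esub>)"
  by (simp_all add: Qb_def product_ring_def)

lemma Zb_simps:
  "x \<oplus>\<^bsub>Zb s p\<^esub> y = x \<oplus>\<^bsub>Qb s p\<^esub> y"
  "\<zero>\<^bsub>Zb s p\<^esub> = \<zero>\<^bsub>Qb s p\<^esub>"
  by (simp_all add: Qb_def Zb_def product_ring_def Zp_def)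

lemma carrier_Zb: "carrier (Zb s p) = (\<Pi>\<^sub>E i\<in>{1..s}. padic.Ov (p i) 0)"
proof -
  have "carrier (Zb s p) = (\<Pi>\<^sub>E i\<in>{1..s}. carrier (Zp (p i)))" by (simp add: Zb_def product_ring_def)
  also have "\<dots> = (\<Pi>\<^sub>E i\<in>{1..s}. padic.Ov (p i) 0)"
    by (intro PiE_cong) (rule padic.carrier_Zp[OF padic])
  finally show ?thesis .
qed

lemma mem_seq_Qb: "a \<in> carrier (seq_group (Qb s p)) \<longleftrightarrow>
    (\<forall>n. (\<forall>i\<in>{1..s}. a n i \<in> carrier (Qp (p i))) \<and> a n \<in> extensional {1..s})"
  by (simp only: seq_group_simps Qb_simps PiE_iff mem_Collect_eq)

lemma mem_seq_Zb: "a \<in> carrier (seq_group (Zb s p)) \<longleftrightarrow>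
    (\<forall>n. (\<forall>i\<in>{1..s}. a n i \<in> padic.Ov (p i) 0) \<and> a n \<in> extensional {1..s})"
  by (simp only: seq_group_simps carrier_Zb PiE_iff mem_Collect_eq)

lemma seq_mult: "a \<otimes>\<^bsub>seq_group (Qb s p)\<^esub> b = (\<lambda>n. \<lambda>i\<in>{1..s}. a n i \<oplus>\<^bsub>Qp (p i)\<^esub> b n i)"
  by (simp only: seq_group_simps Qb_simps)

lemma seq_Zb_sub: "carrier (seq_group (Zb s p)) \<subseteq> carrier (seq_group (Qb s p))"
proof
  fix a assume a: "a \<in> carrier (seq_group (Zb s p))"
  have "a n i \<in> carrier (Qp (p i))" if i: "i \<in> {1..s}" for n i
    using a i unfolding mem_seq_Zb by (intro padic.Ov_closed[OF padic[OF i]]) blast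
  then show "a \<in> carrier (seq_group (Qb s p))" using a unfolding mem_seq_Zb mem_seq_Qb by blast
qed
lemma comm_group_add_Qb: "comm_group (add_monoid (Qb s p))"
proof -
  have eq: "add_monoid (Qb s p) = product_group {1..s} (\<lambda>i. add_monoid (Qp (p i)))"
    by (simp add: Qb_def product_ring_def product_group_def)
  have "comm_group (add_monoid (Qp (p i)))" if "i \<in> {1..s}" for i
  proof -
    interpret padic "p i" using padic that by blast
    show ?thesis by (rule Q.a_comm_group)
  qed
  then show ?thesis unfolding eq by (intro comm_group_product_group)
qed

sublocale SG: comm_group "seq_group (Qb s p)"
  unfolding seq_group_def using comm_group_add_Qb by (intro comm_group_product_group)

lemma inv_seq_Qb:
  assumes a: "a \<in> carrier (seq_group (Qb s p))"
  shows "inv\<^bsub>seq_group (Qb s p)\<^esub> a = (\<lambda>n. \<lambda>i\<in>{1..s}. \<ominus>\<^bsub>Qp (p i)\<^esub> a n i)" (is "_ = ?b")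
proof (rule SG.inv_equality[OF _ a])
  have l: "(\<ominus>\<^bsub>Qp (p i)\<^esub> a n i) \<oplus>\<^bsub>Qp (p i)\<^esub> a n i = \<zero>\<^bsub>Qp (p i)\<^esub>"
    and c: "\<ominus>\<^bsub>Qp (p i)\<^esub> a n i \<in> carrier (Qp (p i))" if i: "i \<in> {1..s}" for n i
  proof -
    interpret padic "p i" using padic i by blast
    have "a n i \<in> carrier (Qp (p i))" using a i mem_seq_Qb by blast
    then show "(\<ominus>\<^bsub>Qp (p i)\<^esub> a n i) \<oplus>\<^bsub>Qp (p i)\<^esub> a n i = \<zero>\<^bsub>Qp (p i)\<^esub>"
      "\<ominus>\<^bsub>Qp (p i)\<^esub> a n i \<in> carrier (Qp (p i))" by (simp_all add: Q.l_neg)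
  qed
  show "?b \<in> carrier (seq_group (Qb s p))" unfolding mem_seq_Qb using c by simp
  show "?b \<otimes>\<^bsub>seq_group (Qb s p)\<^esub> a = \<one>\<^bsub>seq_group (Qb s p)\<^esub>"
    unfolding seq_mult unfolding seq_group_simps Qb_simps using l by (intro ext restrict_ext) simp
qed

lemma subgroup_seq_Zb: "subgroup (carrier (seq_group (Zb s p))) (seq_group (Qb s p))"
proof (rule SG.subgroupI)
  show "carrier (seq_group (Zb s p)) \<subseteq> carrier (seq_group (Qb s p))" by (rule seq_Zb_sub)
  have "(\<lambda>n. \<lambda>i\<in>{1..s}. \<zero>\<^bsub>Qp (p i)\<^esub>) \<in> carrier (seq_group (Zb s p))"
    unfolding mem_seq_Zb using padic padic.Ov_zero by simp
  then show "carrier (seq_group (Zb s p)) \<noteq> {}" by blast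
  fix a assume a: "a \<in> carrier (seq_group (Zb s p))"
  then have ac: "a \<in> carrier (seq_group (Qb s p))" using seq_Zb_sub by blast
  have "\<ominus>\<^bsub>Qp (p i)\<^esub> a n i \<in> padic.Ov (p i) 0" if "i \<in> {1..s}" for i n
    using padic.Ov_minus[OF padic[OF that]] a that unfolding mem_seq_Zb by blast
  then show "inv\<^bsub>seq_group (Qb s p)\<^esub> a \<in> carrier (seq_group (Zb s p))"
    unfolding inv_seq_Qb[OF ac] mem_seq_Zb by simp
next
  fix a b assume ab: "a \<in> carrier (seq_group (Zb s p))" "b \<in> carrier (seq_group (Zb s p))"
  have "a n i \<oplus>\<^bsub>Qp (p i)\<^esub> b n i \<in> padic.Ov (p i) 0" if "i \<in> {1..s}" for i n
    using padic.Ov_add[OF padic[OF that]] ab that unfolding mem_seq_Zb by blast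
  then show "a \<otimes>\<^bsub>seq_group (Qb s p)\<^esub> b \<in> carrier (seq_group (Zb s p))"
    unfolding seq_mult mem_seq_Zb by simp
qed

lemma generate_seq_Zb:
  assumes "K \<subseteq> carrier (seq_group (Zb s p))"
  shows "generate (seq_group (Zb s p)) K = generate (seq_group (Qb s p)) K"
proof -
  have "seq_group (Zb s p) = (seq_group (Qb s p))\<lparr>carrier := carrier (seq_group (Zb s p))\<rparr>"
    by (simp add: seq_group_def product_group_def Zb_simps)
  then have "generate (seq_group (Zb s p)) K =
      generate ((seq_group (Qb s p))\<lparr>carrier := carrier (seq_group (Zb s p))\<rparr>) K" by (rule arg_cong)
  then show ?thesis by (simp only: SG.generate_consistent[OF assms subgroup_seq_Zb])
qed

lemma k_regular_iff:
  assumes "\<And>n. a n \<in> carrier (Zb s p)"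
  shows "k_regular (Zb s p) k a \<longleftrightarrow>
    (\<exists>S. finite S \<and> S \<subseteq> carrier (seq_group (Qb s p)) \<and> k_kernel k a \<subseteq> generate (seq_group (Qb s p)) S)"
    (is "_ \<longleftrightarrow> ?R")
proof
  have K: "k_kernel k a \<subseteq> carrier (seq_group (Zb s p))"
    using assms by (auto simp: k_kernel_def seq_group_simps)
  have sub: "carrier (seq_group (Zb s p)) \<subseteq> carrier (seq_group (Qb s p))"
    by (rule subgroup.subset[OF subgroup_seq_Zb])
  {
    assume "k_regular (Zb s p) k a"
    then obtain S where S: "finite S" "S \<subseteq> carrier (seq_group (Zb s p))"
      "generate (seq_group (Zb s p)) S = generate (seq_group (Zb s p)) (k_kernel k a)"
      unfolding k_regular_def by blast
    then have "k_kernel k a \<subseteq> generate (seq_group (Qb s p)) S"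
      using generate_seq_Zb[OF S(2)] generate_seq_Zb[OF K] generate.incl by fast
    then show ?R using S sub by blast
  next
    assume ?R
    then obtain S where S: "finite S" "S \<subseteq> carrier (seq_group (Qb s p))"
      "k_kernel k a \<subseteq> generate (seq_group (Qb s p)) S" by blast
    have H: "subgroup (generate (seq_group (Qb s p)) (k_kernel k a)) (seq_group (Qb s p))"
      using K sub by (intro SG.generate_is_subgroup) blast
    have "generate (seq_group (Qb s p)) (k_kernel k a) \<subseteq> generate (seq_group (Qb s p)) S"
      using SG.generate_subgroup_incl[OF S(3) SG.generate_is_subgroup[OF S(2)]] .
    then obtain T where T: "finite T" "T \<subseteq> generate (seq_group (Qb s p)) (k_kernel k a)"
      "generate (seq_group (Qb s p)) (k_kernel k a) = generate (seq_group (Qb s p)) T"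
      using SG.subgroup_of_fg[OF S(1,2) H] by blast
    have TZ: "T \<subseteq> carrier (seq_group (Zb s p))"
      using T(2) SG.generate_subgroup_incl[OF K subgroup_seq_Zb] by blast
    have "generate (seq_group (Zb s p)) T = generate (seq_group (Zb s p)) (k_kernel k a)"
      using T(3) generate_seq_Zb[OF TZ] generate_seq_Zb[OF K] by simp
    then show "k_regular (Zb s p) k a" unfolding k_regular_def using T(1) TZ by blast
  }
qed

end

section \<open>Regular sequences of rational numbers\<close>

inductive_set zspan :: "(nat \<Rightarrow> rat) set \<Rightarrow> (nat \<Rightarrow> rat) set" for G where
  zero: "(\<lambda>n. 0) \<in> zspan G"
| incl: "g \<in> G \<Longrightarrow> g \<in> zspan G"
| diff: "a \<in> zspan G \<Longrightarrow> c \<in> zspan G \<Longrightarrow> (\<lambda>n. a n - c n) \<in> zspan G"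

lemma zspan_minus: "a \<in> zspan G \<Longrightarrow> (\<lambda>n. - a n) \<in> zspan G"
  using zspan.diff[OF zspan.zero, of a G] by simp

lemma zspan_add: "a \<in> zspan G \<Longrightarrow> c \<in> zspan G \<Longrightarrow> (\<lambda>n. a n + c n) \<in> zspan G"
  using zspan.diff[OF _ zspan_minus, of a G c] by simp

lemma zspan_scale_nat: "a \<in> zspan G \<Longrightarrow> (\<lambda>n. of_nat z * a n) \<in> zspan G"
proof (induction z)
  case (Suc z)
  then show ?case using zspan_add[of "\<lambda>n. of_nat z * a n" G a] by (simp add: algebra_simps)
qed (simp add: zspan.zero)

lemma zspan_sum: "finite I \<Longrightarrow> (\<And>i. i \<in> I \<Longrightarrow> a i \<in> zspan G) \<Longrightarrow> (\<lambda>n. \<Sum>i\<in>I. a i n) \<in> zspan G"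
proof (induction I rule: finite_induct)
  case (insert i I)
  then show ?case using zspan_add[of "a i" G "\<lambda>n. \<Sum>i\<in>I. a i n"] by simp
qed (simp add: zspan.zero)

lemma zspan_subst:
  assumes "a \<in> zspan G" "\<And>g. g \<in> G \<Longrightarrow> (\<lambda>n. g (L n)) \<in> zspan H"
  shows "(\<lambda>n. a (L n)) \<in> zspan H"
  using assms(1) by (induction a rule: zspan.induct) (auto intro: zspan.intros assms(2))

lemma zspan_trans: "a \<in> zspan G \<Longrightarrow> G \<subseteq> zspan H \<Longrightarrow> a \<in> zspan H"
  using zspan_subst[of a G "\<lambda>n. n" H] by auto

lemma zspan_mono: "a \<in> zspan G \<Longrightarrow> G \<subseteq> H \<Longrightarrow> a \<in> zspan H"
  by (erule zspan_trans) (auto intro: zspan.incl)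

definition rreg :: "nat \<Rightarrow> (nat \<Rightarrow> rat) \<Rightarrow> bool" where
  "rreg k c \<longleftrightarrow> (\<exists>G. finite G \<and> c \<in> zspan G \<and> (\<forall>g\<in>G. \<forall>j<k. (\<lambda>n. g (k * n + j)) \<in> zspan G))"

lemma rreg_kernel:
  assumes "rreg k c"
  shows "\<exists>G. finite G \<and> (\<forall>i. \<forall>j<k ^ i. (\<lambda>n. c (k ^ i * n + j)) \<in> zspan G)"
proof -
  obtain G where G: "finite G" "c \<in> zspan G" "\<And>g j. g \<in> G \<Longrightarrow> j < k \<Longrightarrow> (\<lambda>n. g (k * n + j)) \<in> zspan G"
    using assms unfolding rreg_def by blast
  have "(\<lambda>n. c (k ^ i * n + j)) \<in> zspan G" if "j < k ^ i" for i j
    using that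
  proof (induction i arbitrary: j)
    case 0
    then show ?case using G(2) by simp
  next
    case (Suc i)
    define j1 j2 where "j1 = j div k ^ i" and "j2 = j mod k ^ i"
    have k: "k ^ i > 0" using Suc.prems by (cases "k = 0") auto
    have j1: "j1 < k" using Suc.prems k by (simp add: j1_def less_mult_imp_div_less)
    have j2: "j2 < k ^ i" using k by (simp add: j2_def)
    have j: "j = k ^ i * j1 + j2" by (simp add: j1_def j2_def)
    have e: "k ^ Suc i * n + j = k ^ i * (k * n + j1) + j2" for n by (simp add: j algebra_simps)
    show ?case unfolding e by (rule zspan_subst[OF Suc.IH[OF j2]]) (rule G(3)[OF _ j1])
  qed
  then show ?thesis using G(1) by blast
qed

lemma rreg_extend:
  assumes G: "finite G"
    and st: "\<And>g j. g \<in> G \<Longrightarrow> j < k \<Longrightarrow> \<exists>u v. (\<lambda>n. g (k * n + j)) = (\<lambda>n. u n + v n) \<and> u \<in> zspan G \<and> rreg k v"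
    and c: "c \<in> zspan G"
  shows "rreg k c"
proof -
  have "\<forall>x\<in>G \<times> {..<k}. \<exists>H. finite H \<and> (\<lambda>n. fst x (k * n + snd x)) \<in> zspan (G \<union> H) \<and>
      (\<forall>g\<in>H. \<forall>j<k. (\<lambda>n. g (k * n + j)) \<in> zspan H)"
  proof
    fix x assume "x \<in> G \<times> {..<k}"
    then obtain u v where uv: "(\<lambda>n. fst x (k * n + snd x)) = (\<lambda>n. u n + v n)" "u \<in> zspan G" "rreg k v"
      using st[of "fst x" "snd x"] by auto
    then obtain H where H: "finite H" "v \<in> zspan H" "\<forall>g\<in>H. \<forall>j<k. (\<lambda>n. g (k * n + j)) \<in> zspan H"
      unfolding rreg_def by blast
    have "u \<in> zspan (G \<union> H)" "v \<in> zspan (G \<union> H)"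
      using zspan_mono[OF uv(2), of "G \<union> H"] zspan_mono[OF H(2), of "G \<union> H"] by auto
    then have "(\<lambda>n. fst x (k * n + snd x)) \<in> zspan (G \<union> H)" unfolding uv(1) by (rule zspan_add)
    then show "\<exists>H. finite H \<and> (\<lambda>n. fst x (k * n + snd x)) \<in> zspan (G \<union> H) \<and>
      (\<forall>g\<in>H. \<forall>j<k. (\<lambda>n. g (k * n + j)) \<in> zspan H)" using H by blast
  qed
  then obtain H where H: "\<And>x. x \<in> G \<times> {..<k} \<Longrightarrow> finite (H x) \<and> (\<lambda>n. fst x (k * n + snd x)) \<in> zspan (G \<union> H x) \<and>
      (\<forall>g\<in>H x. \<forall>j<k. (\<lambda>n. g (k * n + j)) \<in> zspan (H x))" by metis
  define K where "K = G \<union> (\<Union>x\<in>G \<times> {..<k}. H x)"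
  have "finite K" unfolding K_def using G H by auto
  moreover have "c \<in> zspan K" using zspan_mono[OF c] by (simp add: K_def)
  moreover have "(\<lambda>n. g (k * n + j)) \<in> zspan K" if g: "g \<in> K" and j: "j < k" for g j
  proof (cases "g \<in> G")
    case True
    then have "(\<lambda>n. g (k * n + j)) \<in> zspan (G \<union> H (g, j))" using H[of "(g, j)"] j by simp
    then show ?thesis by (rule zspan_mono) (use True j in \<open>auto simp: K_def\<close>)
  next
    case False
    then obtain x where x: "x \<in> G \<times> {..<k}" "g \<in> H x" using g by (auto simp: K_def)
    then have "(\<lambda>n. g (k * n + j)) \<in> zspan (H x)" using H[OF x(1)] j by blast
    then show ?thesis by (rule zspan_mono) (use x in \<open>auto simp: K_def\<close>)
  qed
  ultimately show ?thesis unfolding rreg_def by blast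
qed

lemma rreg_zero: "rreg k (\<lambda>n. 0)"
  unfolding rreg_def by (rule exI[of _ "{}"]) (simp add: zspan.zero)

lemma rreg_diff: assumes "rreg k a" "rreg k c" shows "rreg k (\<lambda>n. a n - c n)"
proof -
  obtain G where G: "finite G" "a \<in> zspan G" "\<And>g j. g \<in> G \<Longrightarrow> j < k \<Longrightarrow> (\<lambda>n. g (k * n + j)) \<in> zspan G"
    using assms unfolding rreg_def by blast
  obtain H where H: "finite H" "c \<in> zspan H" "\<And>g j. g \<in> H \<Longrightarrow> j < k \<Longrightarrow> (\<lambda>n. g (k * n + j)) \<in> zspan H"
    using assms unfolding rreg_def by blast
  have m: "x \<in> zspan G \<Longrightarrow> x \<in> zspan (G \<union> H)" "x \<in> zspan H \<Longrightarrow> x \<in> zspan (G \<union> H)" for x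
    by (auto elim: zspan_mono)
  have "(\<lambda>n. g (k * n + j)) \<in> zspan (G \<union> H)" if "g \<in> G \<union> H" "j < k" for g j
    using that G(3) H(3) m by blast
  moreover have "(\<lambda>n. a n - c n) \<in> zspan (G \<union> H)" using G(2) H(2) m by (intro zspan.diff)
  ultimately show ?thesis unfolding rreg_def using G(1) H(1) by (intro exI[of _ "G \<union> H"]) simp
qed

lemma rreg_add: assumes "rreg k a" "rreg k c" shows "rreg k (\<lambda>n. a n + c n)"
  using rreg_diff[OF assms(1) rreg_diff[OF rreg_zero assms(2)]] by simp

lemma rreg_sum: "finite I \<Longrightarrow> (\<And>i. i \<in> I \<Longrightarrow> rreg k (a i)) \<Longrightarrow> rreg k (\<lambda>n. \<Sum>i\<in>I. a i n)"
proof (induction I rule: finite_induct)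
  case (insert i I)
  then show ?case using rreg_add[of k "a i" "\<lambda>n. \<Sum>i\<in>I. a i n"] by simp
qed (simp add: rreg_zero)

lemma rreg_scale_nat: "rreg k a \<Longrightarrow> rreg k (\<lambda>n. of_nat z * a n)"
  using rreg_sum[of "{..<z}" k "\<lambda>_. a"] by simp

lemma affine_power:
  "(x * of_nat n + y) ^ m = (\<Sum>d\<le>m. of_nat (m choose d) * x ^ d * y ^ (m - d) * (of_nat n ^ d :: rat))"
  by (subst binomial_ring) (simp add: power_mult_distrib algebra_simps)

lemma affine_nat_power:
  "(of_nat (k * n + j) ^ e :: rat) = (\<Sum>d\<le>e. of_nat ((e choose d) * k ^ d * j ^ (e - d)) * of_nat n ^ d)"
  using affine_power[of "of_nat k" n "of_nat j" e] by simp

lemma rreg_periodic_power: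
  fixes \<psi> :: "nat \<Rightarrow> rat"
  assumes M: "M > 0" and per: "\<And>n. \<psi> (n mod M) = \<psi> n"
  shows "rreg k (\<lambda>n. \<psi> n * of_nat n ^ h)"
proof -
  define g where "g = (\<lambda>(r, r', e) n. if n mod M = r then \<psi> r' * of_nat n ^ e else (0::rat))"
  define G where "G = g ` ({..<M} \<times> {..<M} \<times> {..h})"
  have gG: "g (r, r', e) \<in> zspan G" if "r < M" "r' < M" "e \<le> h" for r r' e
    using that by (intro zspan.incl) (auto simp: G_def)
  have "(\<lambda>n. \<psi> n * of_nat n ^ h) = (\<lambda>n. \<Sum>r<M. g (r, r, h) n)"
  proof
    fix n
    have "(\<Sum>r<M. g (r, r, h) n) = (\<Sum>r<M. if n mod M = r then \<psi> r * of_nat n ^ h else 0)" by (simp add: g_def)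
    also have "\<dots> = \<psi> n * of_nat n ^ h" using M per by (subst sum.delta') auto
    finally show "\<psi> n * of_nat n ^ h = (\<Sum>r<M. g (r, r, h) n)" by simp
  qed
  also have "\<dots> \<in> zspan G" by (intro zspan_sum gG) auto
  finally have c: "(\<lambda>n. \<psi> n * of_nat n ^ h) \<in> zspan G" .
  have st: "(\<lambda>n. f (k * n + j)) \<in> zspan G" if fG: "f \<in> G" for f j
  proof -
    obtain r r' e where f: "f = g (r, r', e)" "r < M" "r' < M" "e \<le> h"
      using fG unfolding G_def by auto
    let ?c = "\<lambda>d. (e choose d) * k ^ d * j ^ (e - d)"
    let ?S = "{t. t < M \<and> (k * t + j) mod M = r}"
    have "f (k * n + j) = (\<Sum>t\<in>?S. \<Sum>d\<le>e. of_nat (?c d) * g (t, r', d) n)" for n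
    proof -
      have eq: "(\<Sum>d\<le>e. of_nat (?c d) * g (t, r', d) n) =
          (if n mod M = t then \<psi> r' * of_nat (k * n + j) ^ e else 0)" for t
      proof (cases "n mod M = t")
        case True
        have "of_nat (k * n + j) ^ e = (\<Sum>d\<le>e. of_nat (?c d) * (of_nat n ^ d :: rat))"
          by (rule affine_nat_power)
        then show ?thesis using True by (simp add: g_def sum_distrib_left algebra_simps)
      qed (simp add: g_def)
      have "(\<Sum>t\<in>?S. \<Sum>d\<le>e. of_nat (?c d) * g (t, r', d) n) =
          (if n mod M \<in> ?S then \<psi> r' * of_nat (k * n + j) ^ e else 0)"
        unfolding eq by (subst sum.delta') auto
      moreover have "n mod M \<in> ?S \<longleftrightarrow> (k * n + j) mod M = r"
        using M by (simp add: mod_add_left_eq[of "k * (n mod M)", symmetric] mod_mult_right_eq) (simp add: mod_add_left_eq)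
      ultimately show ?thesis using f by (simp add: g_def)
    qed
    moreover have "(\<lambda>n. \<Sum>t\<in>?S. \<Sum>d\<le>e. of_nat (?c d) * g (t, r', d) n) \<in> zspan G"
      using f by (intro zspan_sum zspan_scale_nat gG) auto
    ultimately show ?thesis by simp
  qed
  show ?thesis unfolding rreg_def using c st by (intro exI[of _ G]) (simp add: G_def)
qed

lemma rreg_periodic_poly:
  fixes \<psi> :: "nat \<Rightarrow> rat"
  assumes M: "M > 0" and per: "\<And>n. \<psi> (n mod M) = \<psi> n"
  shows "rreg k (\<lambda>n. \<psi> n * ((x * of_nat n + y) ^ m * of_nat n ^ h))"
proof -
  have "(\<lambda>n. \<psi> n * ((x * of_nat n + y) ^ m * of_nat n ^ h)) =
      (\<lambda>n. \<Sum>d\<le>m. (of_nat (m choose d) * x ^ d * y ^ (m - d) * \<psi> n) * of_nat n ^ (d + h))"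
    by (intro ext, subst affine_power) (simp add: sum_distrib_left sum_distrib_right power_add algebra_simps)
  then show ?thesis using per by (simp only:) (intro rreg_sum rreg_periodic_power[OF M], auto)
qed

lemma rreg_orbit:
  fixes \<beta> :: "rat \<Rightarrow> rat"
  assumes Y: "finite Y" and \<beta>: "\<And>x. \<beta> (of_nat k * x) = \<beta> x"
    and st: "\<And>y j. y \<in> Y \<Longrightarrow> j < k \<Longrightarrow> (\<exists>y'\<in>Y. y = of_nat j + of_nat k * y') \<or>
        (\<forall>h. rreg k (\<lambda>n. \<beta> (of_nat (k * n + j) - y) * of_nat n ^ h))"
    and y: "y \<in> Y"
  shows "rreg k (\<lambda>n. \<beta> (of_nat n - y) * of_nat n ^ h)"
proof -
  define g where "g = (\<lambda>(y, e) n. \<beta> (of_nat n - y) * (of_nat n ^ e :: rat))"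
  define G where "G = g ` (Y \<times> {..h})"
  have gG: "g (y, e) \<in> zspan G" if "y \<in> Y" "e \<le> h" for y e
    using that by (intro zspan.incl) (auto simp: G_def)
  show ?thesis
  proof (rule rreg_extend)
    show "finite G" using Y by (simp add: G_def)
    show "(\<lambda>n. \<beta> (of_nat n - y) * of_nat n ^ h) \<in> zspan G" using gG[OF y, of h] by (simp add: g_def)
    fix f j assume f: "f \<in> G" and j: "j < k"
    obtain z e where z: "f = g (z, e)" "z \<in> Y" "e \<le> h" using f by (auto simp: G_def)
    let ?c = "\<lambda>d. (e choose d) * k ^ d * j ^ (e - d)"
    have ex: "of_nat (k * n + j) ^ e = (\<Sum>d\<le>e. of_nat (?c d) * (of_nat n ^ d :: rat))" for n
      by (rule affine_nat_power)
    have fe: "f (k * n + j) = (\<Sum>d\<le>e. of_nat (?c d) * (\<beta> (of_nat (k * n + j) - z) * of_nat n ^ d))" for n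
      unfolding z(1) g_def by (simp only: prod.case ex sum_distrib_left) (simp add: algebra_simps)
    from st[OF z(2) j] show "\<exists>u v. (\<lambda>n. f (k * n + j)) = (\<lambda>n. u n + v n) \<and> u \<in> zspan G \<and> rreg k v"
    proof
      assume "\<exists>y'\<in>Y. z = of_nat j + of_nat k * y'"
      then obtain y' where y': "y' \<in> Y" "z = of_nat j + of_nat k * y'" by blast
      have "\<beta> (of_nat (k * n + j) - z) = \<beta> (of_nat n - y')" for n
        using \<beta>[of "of_nat n - y'"] by (simp add: y'(2) algebra_simps)
      then have fe': "(\<lambda>n. f (k * n + j)) = (\<lambda>n. \<Sum>d\<le>e. of_nat (?c d) * g (y', d) n)"
        unfolding fe by (simp add: g_def)
      have "(\<lambda>n. \<Sum>d\<le>e. of_nat (?c d) * g (y', d) n) \<in> zspan G"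
        using z y' by (intro zspan_sum zspan_scale_nat gG) auto
      then show ?thesis using fe' rreg_zero by (intro exI[of _ "\<lambda>n. f (k * n + j)"] exI[of _ "\<lambda>n. 0"]) auto
    next
      assume "\<forall>h. rreg k (\<lambda>n. \<beta> (of_nat (k * n + j) - z) * of_nat n ^ h)"
      then have "rreg k (\<lambda>n. f (k * n + j))" unfolding fe by (intro rreg_sum rreg_scale_nat) auto
      then show ?thesis using zspan.zero by (intro exI[of _ "\<lambda>n. 0"] exI[of _ "\<lambda>n. f (k * n + j)"]) auto
    qed
  qed
qed

section \<open>Sufficient conditions for regularity\<close>

lemma le_div_int_iff: "(c::int) > 0 \<Longrightarrow> e \<le> a div c \<longleftrightarrow> c * e \<le> a"
proof
  assume c: "c > 0" and "e \<le> a div c"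
  then have "c * e \<le> c * (a div c)" by simp
  also have "\<dots> \<le> a" using c by (simp add: minus_mod_eq_mult_div [symmetric])
  finally show "c * e \<le> a" .
next
  assume "c > 0" "c * e \<le> a"
  then show "e \<le> a div c" using zdiv_mono1[of "c * e" a c] by simp
qed

locale prime_powers = multi_padic s p for s :: nat and p :: "nat \<Rightarrow> nat" +
  fixes l :: "nat \<Rightarrow> nat"
  assumes s1: "s \<ge> 1" and inj: "inj_on p {1..s}" and l1: "\<And>i. i \<in> {1..s} \<Longrightarrow> l i \<ge> 1"
begin

definition b :: nat where "b = (\<Prod>i=1..s. p i ^ l i)"

abbreviation Q :: "nat \<Rightarrow> padic ring" where "Q i \<equiv> Qp (p i)"
abbreviation V :: "nat \<Rightarrow> int \<Rightarrow> padic set" where "V i \<equiv> padic.Ov (p i)"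
abbreviation io :: "nat \<Rightarrow> rat \<Rightarrow> padic" where "io i \<equiv> padic_of_rat (p i)"

lemma p_pos: "i \<in> {1..s} \<Longrightarrow> p i > 0" using primes prime_gt_0_nat by blast

lemma coprime_pow:
  assumes "i \<in> {1..s}" "j \<in> {1..s}" "i \<noteq> j" shows "coprime (p i ^ e) (p j ^ f)"
  using primes_coprime[OF primes primes] assms inj_onD[OF inj] by (metis coprime_power_left_iff coprime_power_right_iff)

lemma multiplicity_prod:
  assumes i: "i \<in> {1..s}" shows "multiplicity (p i) (\<Prod>j=1..s. p j ^ e j) = e i"
proof -
  have pe: "prime_elem (p i)" using primes[OF i] by simp
  have "multiplicity (p i) (p j ^ e j) = (if j = i then e i else 0)" if j: "j \<in> {1..s}" for j
  proof (cases "j = i")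
    case True
    then show ?thesis using primes[OF i] pe by (simp add: prime_elem_multiplicity_power_distrib)
  next
    case False
    then have "p j \<noteq> p i" using inj i j by (auto dest: inj_onD)
    then show ?thesis using primes[OF i] primes[OF j] pe False
      by (simp add: prime_elem_multiplicity_power_distrib prime_multiplicity_other prime_gt_0_nat)
  qed
  moreover have "multiplicity (p i) (\<Prod>j=1..s. p j ^ e j) = (\<Sum>j=1..s. multiplicity (p i) (p j ^ e j))"
    using p_pos by (intro prime_elem_multiplicity_prod_distrib[OF pe]) force+
  ultimately have "multiplicity (p i) (\<Prod>j=1..s. p j ^ e j) = (\<Sum>j=1..s. if j = i then e i else 0)" by simp
  also have "\<dots> = e i" using i by (subst sum.delta) auto
  finally show ?thesis .
qed

lemma b_pos: "b > 0" using primes by (auto simp: b_def prime_gt_0_nat intro!: prod_pos)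

lemma rat_val_b: "i \<in> {1..s} \<Longrightarrow> rat_val (p i) (of_nat b) = int (l i)"
  using rat_val_of_nat[OF primes, of i b] b_pos multiplicity_prod[of i l] by (simp add: b_def)

definition nu :: "(nat \<Rightarrow> padic) \<Rightarrow> int" where "nu x = (THE v. nu_b s p l x = Fin v)"

lemma Qb_comp: "x \<in> carrier (Qb s p) \<Longrightarrow> i \<in> {1..s} \<Longrightarrow> x i \<in> carrier (Q i)"
  by (auto simp: Qb_simps)

lemma Qb_eqI: "x \<in> carrier (Qb s p) \<Longrightarrow> y \<in> carrier (Qb s p) \<Longrightarrow> (\<And>i. i \<in> {1..s} \<Longrightarrow> x i = y i) \<Longrightarrow> x = y"
  unfolding Qb_simps by (rule PiE_ext)

lemma Qb_zero: "\<zero>\<^bsub>Qb s p\<^esub> \<in> carrier (Qb s p)" "i \<in> {1..s} \<Longrightarrow> \<zero>\<^bsub>Qb s p\<^esub> i = \<zero>\<^bsub>Q i\<^esub>"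
proof -
  have "\<zero>\<^bsub>Q i\<^esub> \<in> carrier (Q i)" if "i \<in> {1..s}" for i
    using padic.Ov_closed[OF padic[OF that] padic.Ov_zero[OF padic[OF that]]] .
  then show "\<zero>\<^bsub>Qb s p\<^esub> \<in> carrier (Qb s p)" by (simp add: Qb_simps)
qed (simp add: Qb_simps)

lemma Qb_nonzero: "x \<in> carrier (Qb s p) \<Longrightarrow> x \<noteq> \<zero>\<^bsub>Qb s p\<^esub> \<Longrightarrow> \<exists>i\<in>{1..s}. x i \<noteq> \<zero>\<^bsub>Q i\<^esub>"
  using Qb_eqI Qb_zero by metis

lemma nu_iff:
  assumes x: "x \<in> carrier (Qb s p)" "x \<noteq> \<zero>\<^bsub>Qb s p\<^esub>"
  shows "e \<le> nu x \<longleftrightarrow> (\<forall>i\<in>{1..s}. x i \<in> V i (int (l i) * e))"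
proof -
  define f where "f = (\<lambda>i. map_extended (\<lambda>v. \<lfloor>real_of_int v / real (l i)\<rfloor>) (padic_val (p i) (x i)))"
  have nb: "nu_b s p l x = Min (f ` {1..s})" by (simp add: nu_b_def f_def)
  have fin: "finite (f ` {1..s})" "f ` {1..s} \<noteq> {}" using s1 by auto
  have f0: "f i = \<infinity>" if "i \<in> {1..s}" "x i = \<zero>\<^bsub>Q i\<^esub>" for i
    using that padic.padic_val_zero[OF padic[OF that(1)]] by (simp add: f_def)
  have f1: "f i = Fin (padic.pv (p i) (x i) div int (l i))" if i: "i \<in> {1..s}" "x i \<noteq> \<zero>\<^bsub>Q i\<^esub>" for i
    using padic.padic_val_nonzero[OF padic[OF i(1)] Qb_comp[OF x(1) i(1)] i(2)]
      floor_divide_of_int_eq[of "padic.pv (p i) (x i)" "int (l i)"]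
    by (simp add: f_def)
  have fe: "Fin e \<le> f i \<longleftrightarrow> x i \<in> V i (int (l i) * e)" if i: "i \<in> {1..s}" for i e
  proof (cases "x i = \<zero>\<^bsub>Q i\<^esub>")
    case True
    then show ?thesis using f0[OF i] padic.Ov_zero[OF padic[OF i]] by simp
  next
    case False
    have "e \<le> padic.pv (p i) (x i) div int (l i) \<longleftrightarrow> int (l i) * e \<le> padic.pv (p i) (x i)"
      using l1[OF i] by (intro le_div_int_iff) simp
    then show ?thesis using f1[OF i False] padic.Ov_pv[OF padic[OF i] Qb_comp[OF x(1) i] False] by simp
  qed
  have "nu_b s p l x \<in> f ` {1..s}" unfolding nb using fin by (rule Min_in)
  moreover obtain j where "j \<in> {1..s}" "x j \<noteq> \<zero>\<^bsub>Q j\<^esub>" using Qb_nonzero[OF x] by blast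
  then have "nu_b s p l x \<le> Fin (padic.pv (p j) (x j) div int (l j))"
    unfolding nb using f1 fin by (metis Min_le imageI)
  ultimately obtain v where v: "nu_b s p l x = Fin v" using f0 f1 by (metis (no_types, lifting) Pinf_le extended.distinct(1) imageE)
  then have "nu x = v" by (simp add: nu_def)
  then have "e \<le> nu x \<longleftrightarrow> Fin e \<le> nu_b s p l x" using v by simp
  also have "\<dots> \<longleftrightarrow> (\<forall>i\<in>{1..s}. Fin e \<le> f i)" unfolding nb using Min_ge_iff[OF fin] by simp
  finally show ?thesis using fe by simp
qed

lemma L_b_comp:
  assumes "x \<noteq> \<zero>\<^bsub>Qb s p\<^esub>" "i \<in> {1..s}"
  shows "L_b s p l x i = io i (of_nat b powi (- nu x)) \<otimes>\<^bsub>Q i\<^esub> x i"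
  using assms by (simp add: L_b_def diag_rat_def Qb_simps nu_def b_def)

lemma pv_b: "i \<in> {1..s} \<Longrightarrow> io i (of_nat b powi e) \<in> V i (int (l i) * e)"
  using padic.iota_Ov[OF padic] rat_val_powi[OF primes, of i "of_nat b" e] rat_val_b b_pos
  by (simp add: rge_def)

lemma L_b_Zb:
  assumes x: "x \<in> carrier (Qb s p)" shows "L_b s p l x \<in> carrier (Zb s p)"
proof (cases "x = \<zero>\<^bsub>Qb s p\<^esub>")
  case True
  then show ?thesis using padic.Ov_zero[OF padic] by (auto simp: L_b_def carrier_Zb Qb_simps)
next
  case False
  have "L_b s p l x i \<in> V i 0" if i: "i \<in> {1..s}" for i
  proof -
    interpret padic "p i" using padic i .
    have "x i \<in> V i (int (l i) * nu x)" using nu_iff[OF x False, of "nu x"] i by simp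
    then show ?thesis unfolding L_b_comp[OF False i] using Ov_mult[OF pv_b[OF i, of "- nu x"]] by fastforce
  qed
  moreover have "L_b s p l x \<in> extensional {1..s}" using False by (simp add: L_b_def Qb_simps)
  ultimately show ?thesis by (simp add: carrier_Zb PiE_iff)
qed

lemma eval_tuple_Qb:
  assumes "\<And>i. i \<in> {1..s} \<Longrightarrow> set (f i) \<subseteq> carrier (Q i)"
  shows "eval_tuple s p f n \<in> carrier (Qb s p)"
proof -
  have "ring.eval (Q i) (f i) (io i (of_nat n)) \<in> carrier (Q i)" if i: "i \<in> {1..s}" for i
  proof -
    interpret padic "p i" using padic i .
    show ?thesis using assms[OF i] by (rule Q.eval_in_carrier) simp
  qed
  then show ?thesis by (simp add: eval_tuple_def Qb_simps)
qed

definition ucont :: "(nat \<Rightarrow> nat \<Rightarrow> padic) \<Rightarrow> bool" where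
  "ucont F \<longleftrightarrow> (\<forall>n. F n \<in> carrier (Qb s p)) \<and>
     (\<forall>i\<in>{1..s}. \<exists>C. \<forall>n n' N. [n = n'] (mod p i ^ nat (N + C)) \<longrightarrow> F n i \<ominus>\<^bsub>Q i\<^esub> F n' i \<in> V i N)"

lemma nu_periodic:
  assumes F: "ucont F" and A: "\<And>n. n \<in> A \<Longrightarrow> F n \<noteq> \<zero>\<^bsub>Qb s p\<^esub> \<and> nu (F n) < E"
  shows "\<exists>M>0. \<forall>n\<in>A. \<forall>n'\<in>A. [n = n'] (mod M) \<longrightarrow> nu (F n) = nu (F n')"
proof -
  have Fc: "F n \<in> carrier (Qb s p)" for n using F by (simp add: ucont_def)
  obtain C where C: "\<And>i n n' N. i \<in> {1..s} \<Longrightarrow> [n = n'] (mod p i ^ nat (N + C i)) \<Longrightarrow> F n i \<ominus>\<^bsub>Q i\<^esub> F n' i \<in> V i N"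
    using F unfolding ucont_def by metis
  define M where "M = (\<Prod>i=1..s. p i ^ nat (int (l i) * E + C i))"
  have "M > 0" using primes by (auto simp: M_def prime_gt_0_nat intro!: prod_pos)
  have le: "nu (F n) \<le> nu (F n')" if n: "n \<in> A" "n' \<in> A" and c: "[n = n'] (mod M)" for n n'
  proof -
    have "F n' i \<in> V i (int (l i) * nu (F n))" if i: "i \<in> {1..s}" for i
    proof -
      interpret padic "p i" using padic i .
      have "p i ^ nat (int (l i) * E + C i) dvd M" unfolding M_def using i by (intro dvd_prodI) auto
      then have "[n = n'] (mod p i ^ nat (int (l i) * E + C i))" using c cong_dvd_modulus_nat by blast
      then have "F n i \<ominus>\<^bsub>Q i\<^esub> F n' i \<in> V i (int (l i) * E)" by (rule C[OF i])
      then have "F n i \<ominus>\<^bsub>Q i\<^esub> F n' i \<in> V i (int (l i) * nu (F n))"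
        by (rule Ov_mono) (use A[OF n(1)] in \<open>simp add: mult_left_mono\<close>)
      moreover have "F n i \<in> V i (int (l i) * nu (F n))" using nu_iff[OF Fc, of n "nu (F n)"] A[OF n(1)] i by simp
      ultimately show ?thesis using Ov_cong[OF Qb_comp[OF Fc i] Qb_comp[OF Fc i]] by blast
    qed
    then show ?thesis using nu_iff[OF Fc, of n' "nu (F n)"] A[OF n(2)] by simp
  qed
  then have "\<forall>n\<in>A. \<forall>n'\<in>A. [n = n'] (mod M) \<longrightarrow> nu (F n) = nu (F n')"
    using cong_sym by (metis order_antisym)
  then show ?thesis using \<open>M > 0\<close> by blast
qed

lemma ucont_eval_tuple:
  assumes f: "\<And>i. i \<in> {1..s} \<Longrightarrow> set (f i) \<subseteq> carrier (Q i)"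
  shows "ucont (eval_tuple s p f)"
  unfolding ucont_def
proof (intro conjI allI ballI)
  show "eval_tuple s p f n \<in> carrier (Qb s p)" for n by (rule eval_tuple_Qb[OF f])
  fix i assume i: "i \<in> {1..s}"
  interpret padic "p i" using padic i .
  obtain C where C: "\<And>x y N. x \<in> Ov 0 \<Longrightarrow> y \<in> Ov 0 \<Longrightarrow> x \<ominus>\<^bsub>Qp (p i)\<^esub> y \<in> Ov (N + C) \<Longrightarrow> Q.eval (f i) x \<ominus>\<^bsub>Qp (p i)\<^esub> Q.eval (f i) y \<in> Ov N"
    using eval_continuous[OF f[OF i]] by blast
  have "Q.eval (f i) (io i (of_nat n)) \<ominus>\<^bsub>Q i\<^esub> Q.eval (f i) (io i (of_nat n')) \<in> V i N"
    if c: "[n = n'] (mod p i ^ nat (N + C))" for n n' N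
  proof -
    have "io i (of_nat n) \<ominus>\<^bsub>Q i\<^esub> io i (of_nat n') \<in> Ov (int (nat (N + C)))" using c iota_diff_Ov by blast
    then have "io i (of_nat n) \<ominus>\<^bsub>Q i\<^esub> io i (of_nat n') \<in> Ov (N + C)" by (rule Ov_mono) simp
    then show ?thesis by (intro C) auto
  qed
  then show "\<exists>C. \<forall>n n' N. [n = n'] (mod p i ^ nat (N + C)) \<longrightarrow> eval_tuple s p f n i \<ominus>\<^bsub>Q i\<^esub> eval_tuple s p f n' i \<in> V i N"
    using i unfolding eval_tuple_def by (intro exI[of _ C]) simp
qed

definition freg :: "nat \<Rightarrow> (nat \<Rightarrow> nat \<Rightarrow> padic) \<Rightarrow> bool" where
  "freg k a \<longleftrightarrow> a \<in> carrier (seq_group (Qb s p)) \<and>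
     (\<exists>S. finite S \<and> S \<subseteq> carrier (seq_group (Qb s p)) \<and> k_kernel k a \<subseteq> generate (seq_group (Qb s p)) S)"

lemma freg_add:
  assumes "freg k a" "freg k c" shows "freg k (a \<otimes>\<^bsub>seq_group (Qb s p)\<^esub> c)"
proof -
  obtain S where S: "finite S" "S \<subseteq> carrier (seq_group (Qb s p))" "k_kernel k a \<subseteq> generate (seq_group (Qb s p)) S"
    using assms(1) unfolding freg_def by blast
  obtain T where T: "finite T" "T \<subseteq> carrier (seq_group (Qb s p))" "k_kernel k c \<subseteq> generate (seq_group (Qb s p)) T"
    using assms(2) unfolding freg_def by blast
  have ST: "S \<union> T \<subseteq> carrier (seq_group (Qb s p))" using S T by blast
  have "k_kernel k (a \<otimes>\<^bsub>seq_group (Qb s p)\<^esub> c) \<subseteq> generate (seq_group (Qb s p)) (S \<union> T)"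
  proof
    fix u assume "u \<in> k_kernel k (a \<otimes>\<^bsub>seq_group (Qb s p)\<^esub> c)"
    then obtain i j where ij: "j \<le> k ^ i - 1" "u = (\<lambda>n. (a \<otimes>\<^bsub>seq_group (Qb s p)\<^esub> c) (k ^ i * n + j))"
      unfolding k_kernel_def by blast
    have "(\<lambda>n. a (k ^ i * n + j)) \<in> generate (seq_group (Qb s p)) (S \<union> T)"
      using ij S(3) SG.mono_generate[of S "S \<union> T"] unfolding k_kernel_def by blast
    moreover have "(\<lambda>n. c (k ^ i * n + j)) \<in> generate (seq_group (Qb s p)) (S \<union> T)"
      using ij T(3) SG.mono_generate[of T "S \<union> T"] unfolding k_kernel_def by blast
    ultimately have "(\<lambda>n. a (k ^ i * n + j)) \<otimes>\<^bsub>seq_group (Qb s p)\<^esub> (\<lambda>n. c (k ^ i * n + j)) \<in> generate (seq_group (Qb s p)) (S \<union> T)"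
      by (rule generate.eng)
    moreover have "u = (\<lambda>n. a (k ^ i * n + j)) \<otimes>\<^bsub>seq_group (Qb s p)\<^esub> (\<lambda>n. c (k ^ i * n + j))"
      unfolding ij(2) seq_group_simps ..
    ultimately show "u \<in> generate (seq_group (Qb s p)) (S \<union> T)" by simp
  qed
  moreover have "a \<otimes>\<^bsub>seq_group (Qb s p)\<^esub> c \<in> carrier (seq_group (Qb s p))"
    using assms by (intro SG.m_closed) (auto simp: freg_def)
  ultimately show ?thesis unfolding freg_def using S(1) T(1) ST by blast
qed

lemma freg_zero: "freg k (\<lambda>n. \<lambda>i\<in>{1..s}. \<zero>\<^bsub>Q i\<^esub>)"
proof -
  have e: "(\<lambda>n. \<lambda>i\<in>{1..s}. \<zero>\<^bsub>Q i\<^esub>) = \<one>\<^bsub>seq_group (Qb s p)\<^esub>" by (simp only: seq_group_simps Qb_simps)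
  have "k_kernel k \<one>\<^bsub>seq_group (Qb s p)\<^esub> \<subseteq> {\<one>\<^bsub>seq_group (Qb s p)\<^esub>}"
    unfolding k_kernel_def seq_group_simps by auto
  then show ?thesis unfolding e freg_def
    by (intro conjI exI[of _ "{}"]) (simp_all only: finite.emptyI empty_subsetI SG.generate_empty SG.one_closed)
qed

definition emb :: "nat \<Rightarrow> (nat \<Rightarrow> padic) \<Rightarrow> (nat \<Rightarrow> nat \<Rightarrow> padic)" where
  "emb i0 u = (\<lambda>n. \<lambda>i\<in>{1..s}. if i = i0 then u n else \<zero>\<^bsub>Q i\<^esub>)"

lemma emb_closed:
  assumes "i0 \<in> {1..s}" "\<And>n. u n \<in> carrier (Q i0)" shows "emb i0 u \<in> carrier (seq_group (Qb s p))"
  unfolding mem_seq_Qb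
proof (intro allI conjI ballI)
  fix n i assume i: "i \<in> {1..s}"
  interpret padic "p i" using padic i .
  show "emb i0 u n i \<in> carrier (Q i)" using i assms by (simp add: emb_def)
qed (simp add: emb_def)

lemma emb_add:
  assumes "i0 \<in> {1..s}"
  shows "emb i0 u \<otimes>\<^bsub>seq_group (Qb s p)\<^esub> emb i0 v = emb i0 (\<lambda>n. u n \<oplus>\<^bsub>Q i0\<^esub> v n)"
proof -
  have "\<zero>\<^bsub>Q i\<^esub> \<oplus>\<^bsub>Q i\<^esub> \<zero>\<^bsub>Q i\<^esub> = \<zero>\<^bsub>Q i\<^esub>" if i: "i \<in> {1..s}" for i
  proof -
    interpret padic "p i" using padic i .
    show ?thesis by simp
  qed
  then show ?thesis unfolding seq_mult emb_def by (intro ext restrict_ext) simp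
qed

lemma emb_zspan:
  assumes i: "i \<in> {1..s}" and \<beta>: "\<beta> \<in> carrier (Q i)" and c: "c \<in> zspan G"
  shows "emb i (\<lambda>n. \<beta> \<otimes>\<^bsub>Q i\<^esub> io i (c n)) \<in> generate (seq_group (Qb s p)) ((\<lambda>c. emb i (\<lambda>n. \<beta> \<otimes>\<^bsub>Q i\<^esub> io i (c n))) ` G)"
    (is "?P c \<in> generate ?S ?I")
proof -
  interpret padic "p i" using padic i .
  have cl: "?P c \<in> carrier ?S" for c using \<beta> by (intro emb_closed[OF i]) simp
  have sg: "subgroup (generate ?S ?I) ?S" by (rule SG.generate_is_subgroup) (use cl in blast)
  show ?thesis using c
  proof (induction c rule: zspan.induct)
    case zero
    have "?P (\<lambda>n. 0) = \<one>\<^bsub>?S\<^esub>" using \<beta>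
      by (simp only: seq_group_simps Qb_simps emb_def iota_0 Q.r_null) (intro ext restrict_ext, simp)
    then show ?case by (simp only: generate.one)
  next
    case (incl g)
    then show ?case by (intro generate.incl) blast
  next
    case (diff u v)
    have "?P u = ?P (\<lambda>n. u n - v n) \<otimes>\<^bsub>?S\<^esub> ?P v"
      unfolding emb_add[OF i]
    proof (rule arg_cong[of _ _ "emb i"], rule ext)
      fix n
      have "io i (u n) = io i (u n - v n) \<oplus>\<^bsub>Q i\<^esub> io i (v n)" by (simp flip: iota_add)
      then show "\<beta> \<otimes>\<^bsub>Q i\<^esub> io i (u n) = \<beta> \<otimes>\<^bsub>Q i\<^esub> io i (u n - v n) \<oplus>\<^bsub>Q i\<^esub> \<beta> \<otimes>\<^bsub>Q i\<^esub> io i (v n)"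
        using \<beta> by (simp add: Q.r_distr)
    qed
    then have "?P (\<lambda>n. u n - v n) = ?P u \<otimes>\<^bsub>?S\<^esub> inv\<^bsub>?S\<^esub> ?P v"
      using cl by (simp add: SG.m_assoc)
    then show ?case using subgroup.m_closed[OF sg diff.IH(1) subgroup.m_inv_closed[OF sg diff.IH(2)]] by simp
  qed
qed

lemma freg_emb:
  assumes i: "i \<in> {1..s}" and \<beta>: "\<beta> \<in> carrier (Q i)" and c: "rreg k c" and k: "k \<ge> 1"
  shows "freg k (emb i (\<lambda>n. \<beta> \<otimes>\<^bsub>Q i\<^esub> io i (c n)))"
proof -
  interpret padic "p i" using padic i .
  have cl: "emb i (\<lambda>n. \<beta> \<otimes>\<^bsub>Q i\<^esub> io i (c n)) \<in> carrier (seq_group (Qb s p))" for c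
    using \<beta> by (intro emb_closed[OF i]) simp
  obtain G where G: "finite G" "\<And>t j. j < k ^ t \<Longrightarrow> (\<lambda>n. c (k ^ t * n + j)) \<in> zspan G"
    using rreg_kernel[OF c] by blast
  let ?I = "(\<lambda>c. emb i (\<lambda>n. \<beta> \<otimes>\<^bsub>Q i\<^esub> io i (c n))) ` G"
  have "k_kernel k (emb i (\<lambda>n. \<beta> \<otimes>\<^bsub>Q i\<^esub> io i (c n))) \<subseteq> generate (seq_group (Qb s p)) ?I"
  proof
    fix u assume "u \<in> k_kernel k (emb i (\<lambda>n. \<beta> \<otimes>\<^bsub>Q i\<^esub> io i (c n)))"
    then obtain t j where tj: "j \<le> k ^ t - 1" "u = (\<lambda>n. emb i (\<lambda>n. \<beta> \<otimes>\<^bsub>Q i\<^esub> io i (c n)) (k ^ t * n + j))"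
      unfolding k_kernel_def by blast
    have "k ^ t > 0" using k by simp
    then have "j < k ^ t" using tj(1) by linarith
    from emb_zspan[OF i \<beta> G(2)[OF this]] show "u \<in> generate (seq_group (Qb s p)) ?I"
      unfolding tj(2) by (simp add: emb_def)
  qed
  then show ?thesis unfolding freg_def using G(1) cl by (intro conjI exI[of _ ?I]) auto
qed

lemma freg_eval:
  assumes i: "i \<in> {1..s}" and g: "set g \<subseteq> carrier (Q i)" and k: "k \<ge> 1"
    and \<psi>: "\<And>h. rreg k (\<lambda>n. \<psi> n * of_nat n ^ h)"
  shows "freg k (emb i (\<lambda>n. io i (\<psi> n) \<otimes>\<^bsub>Q i\<^esub> ring.eval (Q i) g (io i (of_nat n))))"
  using g
proof (induction g)
  case Nil
  interpret padic "p i" using padic i .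
  have e: "emb i (\<lambda>n. io i (\<psi> n) \<otimes>\<^bsub>Q i\<^esub> Q.eval [] (io i (of_nat n))) = (\<lambda>n. \<lambda>i\<in>{1..s}. \<zero>\<^bsub>Q i\<^esub>)"
    unfolding emb_def by (intro ext restrict_ext) simp
  show ?case unfolding e by (rule freg_zero)
next
  case (Cons a g)
  interpret padic "p i" using padic i .
  have a: "a \<in> carrier (Q i)" and g: "set g \<subseteq> carrier (Q i)" using Cons.prems by auto
  have "io i (\<psi> n) \<otimes>\<^bsub>Q i\<^esub> Q.eval (a # g) (io i (of_nat n)) =
     a \<otimes>\<^bsub>Q i\<^esub> io i (\<psi> n * of_nat n ^ length g) \<oplus>\<^bsub>Q i\<^esub> io i (\<psi> n) \<otimes>\<^bsub>Q i\<^esub> Q.eval g (io i (of_nat n))" for n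
    using a Q.eval_in_carrier[OF g, of "io i (of_nat n)"]
    by (simp add: iota_mult iota_pow Q.r_distr Q.m_lcomm)
  then have e: "emb i (\<lambda>n. io i (\<psi> n) \<otimes>\<^bsub>Q i\<^esub> Q.eval (a # g) (io i (of_nat n))) =
     emb i (\<lambda>n. a \<otimes>\<^bsub>Q i\<^esub> io i (\<psi> n * of_nat n ^ length g)) \<otimes>\<^bsub>seq_group (Qb s p)\<^esub>
     emb i (\<lambda>n. io i (\<psi> n) \<otimes>\<^bsub>Q i\<^esub> Q.eval g (io i (of_nat n)))"
    by (simp only: emb_add[OF i])
  show ?case unfolding e by (rule freg_add[OF freg_emb[OF i a \<psi> k] Cons.IH[OF g]])
qed

lemma freg_components:
  assumes a: "a \<in> carrier (seq_group (Qb s p))" and c: "\<And>i. i \<in> {1..s} \<Longrightarrow> freg k (emb i (\<lambda>n. a n i))"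
  shows "freg k a"
proof -
  have "freg k (\<lambda>n. \<lambda>i\<in>{1..s}. if i \<in> I then a n i else \<zero>\<^bsub>Q i\<^esub>)" if "finite I" "I \<subseteq> {1..s}" for I
    using that
  proof (induction I rule: finite_induct)
    case empty
    show ?case unfolding empty_iff if_False by (rule freg_zero)
  next
    case (insert j I)
    have j: "j \<in> {1..s}" using insert.prems by blast
    have z: "\<zero>\<^bsub>Q i\<^esub> \<oplus>\<^bsub>Q i\<^esub> \<zero>\<^bsub>Q i\<^esub> = \<zero>\<^bsub>Q i\<^esub>" "a n i \<oplus>\<^bsub>Q i\<^esub> \<zero>\<^bsub>Q i\<^esub> = a n i" "\<zero>\<^bsub>Q i\<^esub> \<oplus>\<^bsub>Q i\<^esub> a n i = a n i"
      if i: "i \<in> {1..s}" for n i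
    proof -
      interpret padic "p i" using padic i .
      show "\<zero>\<^bsub>Q i\<^esub> \<oplus>\<^bsub>Q i\<^esub> \<zero>\<^bsub>Q i\<^esub> = \<zero>\<^bsub>Q i\<^esub>" "a n i \<oplus>\<^bsub>Q i\<^esub> \<zero>\<^bsub>Q i\<^esub> = a n i" "\<zero>\<^bsub>Q i\<^esub> \<oplus>\<^bsub>Q i\<^esub> a n i = a n i"
        using a i unfolding mem_seq_Qb by simp_all
    qed
    have e: "(\<lambda>n. \<lambda>i\<in>{1..s}. if i \<in> insert j I then a n i else \<zero>\<^bsub>Q i\<^esub>) =
      emb j (\<lambda>n. a n j) \<otimes>\<^bsub>seq_group (Qb s p)\<^esub> (\<lambda>n. \<lambda>i\<in>{1..s}. if i \<in> I then a n i else \<zero>\<^bsub>Q i\<^esub>)"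
      unfolding seq_mult emb_def using z insert.hyps(2) by (intro ext restrict_ext) simp
    have I: "I \<subseteq> {1..s}" using insert.prems by blast
    show ?case unfolding e by (rule freg_add[OF c[OF j] insert.IH[OF I]])
  qed
  from this[of "{1..s}"] have "freg k (\<lambda>n. \<lambda>i\<in>{1..s}. if i \<in> {1..s} then a n i else \<zero>\<^bsub>Q i\<^esub>)" by simp
  moreover have "(\<lambda>n. \<lambda>i\<in>{1..s}. if i \<in> {1..s} then a n i else \<zero>\<^bsub>Q i\<^esub>) = a"
  proof (rule ext)
    fix n
    have "a n \<in> extensional {1..s}" using a unfolding mem_seq_Qb by blast
    then show "(\<lambda>i\<in>{1..s}. if i \<in> {1..s} then a n i else \<zero>\<^bsub>Q i\<^esub>) = a n"
      by (intro extensionalityI[of _ "{1..s}"]) auto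
  qed
  ultimately show ?thesis by simp
qed

lemma k_regular_L_b:
  assumes x: "\<And>n. x n \<in> carrier (Qb s p)" and r: "\<And>i. i \<in> {1..s} \<Longrightarrow> freg k (emb i (\<lambda>n. L_b s p l (x n) i))"
  shows "k_regular (Zb s p) k (\<lambda>n. L_b s p l (x n))"
proof -
  have "(\<lambda>n. L_b s p l (x n)) \<in> carrier (seq_group (Zb s p))"
    using L_b_Zb[OF x] by (simp only: seq_group_simps) blast
  then have "freg k (\<lambda>n. L_b s p l (x n))" using freg_components[OF _ r] seq_Zb_sub by blast
  then show ?thesis unfolding k_regular_iff[OF L_b_Zb[OF x]] freg_def by blast
qed

lemma k_regular_if_no_root:
  assumes f: "\<And>i. i \<in> {1..s} \<Longrightarrow> f i \<in> carrier (poly_ring (Q i))" "\<And>i. i \<in> {1..s} \<Longrightarrow> f i \<noteq> []"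
    and no: "Zb_roots s p f = {}" and k: "k \<ge> 1"
  shows "k_regular (Zb s p) k (\<lambda>n. L_b s p l (eval_tuple s p f n))"
proof -
  obtain j where j: "j \<in> {1..s}" "Zp_roots (p j) (f j) = {}"
    using no unfolding Zb_roots_def PiE_eq_empty_iff by blast
  have fs: "set (f i) \<subseteq> carrier (Q i)" if "i \<in> {1..s}" for i
    using padic.poly_set[OF padic[OF that] f(1)[OF that]] .
  have x: "eval_tuple s p f n \<in> carrier (Qb s p)" for n by (rule eval_tuple_Qb[OF fs])
  interpret J: padic "p j" using padic j(1) .
  obtain C where C: "\<And>n::nat. J.Q.eval (f j) (io j (of_nat n)) \<notin> V j C"
    using J.val_bounded_if_no_root[OF f(1)[OF j(1)] f(2)[OF j(1)] j(2)] by blast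
  have ej: "eval_tuple s p f n j = J.Q.eval (f j) (io j (of_nat n))" for n using j by (simp add: eval_tuple_def)
  have nz: "eval_tuple s p f n \<noteq> \<zero>\<^bsub>Qb s p\<^esub>" for n
    using C[of n] ej[of n] J.Ov_zero[of C] Qb_zero(2)[OF j(1)] by metis
  have bd: "nu (eval_tuple s p f n) < \<bar>C\<bar>" for n
  proof (rule ccontr)
    assume "\<not> ?thesis"
    then have "eval_tuple s p f n j \<in> V j (int (l j) * \<bar>C\<bar>)" using nu_iff[OF x nz, of "\<bar>C\<bar>" n] j(1) by auto
    then have "eval_tuple s p f n j \<in> V j C"
      by (rule J.Ov_mono) (use l1[OF j(1)] mult_right_mono[of 1 "int (l j)" "\<bar>C\<bar>"] in linarith)
    then show False using C ej by simp
  qed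
  obtain M where M: "M > 0" "\<And>n n'. [n = n'] (mod M) \<Longrightarrow> nu (eval_tuple s p f n) = nu (eval_tuple s p f n')"
    using nu_periodic[OF ucont_eval_tuple[of f, OF fs], of UNIV "\<bar>C\<bar>"] nz bd by auto
  show ?thesis
  proof (rule k_regular_L_b[OF x])
    fix i assume i: "i \<in> {1..s}"
    have "L_b s p l (eval_tuple s p f n) i = io i (of_nat b powi (- nu (eval_tuple s p f n))) \<otimes>\<^bsub>Q i\<^esub> ring.eval (Q i) (f i) (io i (of_nat n))" for n
      using i by (simp only: L_b_comp[OF nz i]) (simp add: eval_tuple_def)
    moreover have "freg k (emb i (\<lambda>n. io i (of_nat b powi (- nu (eval_tuple s p f n))) \<otimes>\<^bsub>Q i\<^esub> ring.eval (Q i) (f i) (io i (of_nat n))))"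
    proof (rule freg_eval[OF i fs[OF i] k], rule rreg_periodic_power[OF M(1)])
      fix n
      have "[n mod M = n] (mod M)" by (simp add: cong_def)
      from M(2)[OF this] show "of_nat b powi (- nu (eval_tuple s p f (n mod M))) = (of_nat b powi (- nu (eval_tuple s p f n)) :: rat)" by simp
    qed
    ultimately show "freg k (emb i (\<lambda>n. L_b s p l (eval_tuple s p f n) i))" by simp
  qed
qed

end

context padic
begin

lemma Ov_scale:
  assumes "c \<in> carrier (Qp p)" "c \<noteq> \<zero>\<^bsub>Qp p\<^esub>" "x \<in> carrier (Qp p)"
  shows "c \<otimes>\<^bsub>Qp p\<^esub> x \<in> Ov N \<longleftrightarrow> x \<in> Ov (N - pv c)"
proof (cases "x = \<zero>\<^bsub>Qp p\<^esub>")
  case True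
  then show ?thesis using assms by simp
next
  case False
  then have "c \<otimes>\<^bsub>Qp p\<^esub> x \<noteq> \<zero>\<^bsub>Qp p\<^esub>" using assms by (simp add: Q.integral_iff)
  then show ?thesis using assms False by (auto simp: Ov_pv pv_mult)
qed

lemma iota_nonzero: "q \<noteq> 0 \<Longrightarrow> \<iota> q \<noteq> \<zero>\<^bsub>Qp p\<^esub>" by (simp add: iota_eq_0)

lemma iota_scale: "q \<noteq> 0 \<Longrightarrow> x \<in> carrier (Qp p) \<Longrightarrow> \<iota> q \<otimes>\<^bsub>Qp p\<^esub> x \<in> Ov N \<longleftrightarrow> x \<in> Ov (N - rat_val p q)"
  using Ov_scale[OF iota_closed iota_nonzero] by (simp add: pv_iota)

lemma power_scale_bound:
  assumes x: "\<not> rge p N x" and m: "m \<ge> 1" and c: "c \<in> carrier (Qp p)" "c \<notin> Ov C"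
  shows "\<iota> (x ^ m) \<otimes>\<^bsub>Qp p\<^esub> c \<notin> Ov (int m * N + C)"
proof
  assume a: "\<iota> (x ^ m) \<otimes>\<^bsub>Qp p\<^esub> c \<in> Ov (int m * N + C)"
  have x0: "x \<noteq> 0" "rat_val p x < N" using x by (auto simp: rge_def)
  have "c \<in> Ov (int m * N + C - int m * rat_val p x)" using a iota_scale[of "x ^ m" c] x0 c rat_val_power[OF prime] by simp
  moreover have "int m * rat_val p x \<le> int m * N" using x0 by (intro mult_left_mono) auto
  ultimately have "c \<in> Ov C" using Ov_mono by (smt (verit))
  then show False using c by simp
qed

end

context prime_powers
begin

lemma nu_eqI:
  assumes x: "x \<in> carrier (Qb s p)" "x \<noteq> \<zero>\<^bsub>Qb s p\<^esub>" and y: "y \<in> carrier (Qb s p)" "y \<noteq> \<zero>\<^bsub>Qb s p\<^esub>"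
    and e: "\<And>i e. i \<in> {1..s} \<Longrightarrow> x i \<in> V i (int (l i) * e) \<longleftrightarrow> y i \<in> V i (int (l i) * (e + z))"
  shows "nu y = nu x + z"
proof -
  have "e \<le> nu x \<longleftrightarrow> e + z \<le> nu y" for e using nu_iff[OF x, of e] nu_iff[OF y, of "e + z"] e by simp
  from this[of "nu x"] this[of "nu y - z"] show ?thesis by simp
qed

lemma prod_dvd_if_all_dvd:
  fixes d :: int
  assumes "\<And>i. i \<in> {1..s} \<Longrightarrow> int (p i) ^ e i dvd d"
  shows "int (\<Prod>i=1..s. p i ^ e i) dvd d"
proof -
  have "int (\<Prod>i\<in>I. p i ^ e i) dvd d" if "finite I" "I \<subseteq> {1..s}" for I
    using that
  proof (induction I rule: finite_induct)
    case (insert j I)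
    have "coprime (p j ^ e j) (\<Prod>i\<in>I. p i ^ e i)"
      using insert by (intro prod_coprime_right coprime_pow) auto
    then have "coprime (int (p j ^ e j)) (int (\<Prod>i\<in>I. p i ^ e i))" using coprime_int_iff by blast
    then have "int (p j ^ e j) * int (\<Prod>i\<in>I. p i ^ e i) dvd d"
      using insert assms[of j] by (intro divides_mult) auto
    then show ?case using insert by simp
  qed simp
  then show ?thesis by blast
qed

context
  fixes \<delta> :: "nat \<Rightarrow> padic" and m :: nat
  assumes \<delta>: "\<And>i. i \<in> {1..s} \<Longrightarrow> \<delta> i \<in> carrier (Q i) \<and> \<delta> i \<noteq> \<zero>\<^bsub>Q i\<^esub>" and m: "m \<ge> 1"
begin

definition \<Phi> :: "rat \<Rightarrow> nat \<Rightarrow> padic" where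
  "\<Phi> x = (\<lambda>i\<in>{1..s}. io i (x ^ m) \<otimes>\<^bsub>Q i\<^esub> \<delta> i)"

definition \<beta> :: "rat \<Rightarrow> rat" where
  "\<beta> x = of_nat b powi (- nu (\<Phi> x)) * x ^ m"

lemma Phi_closed: "\<Phi> x \<in> carrier (Qb s p)"
proof -
  have "io i (x ^ m) \<otimes>\<^bsub>Q i\<^esub> \<delta> i \<in> carrier (Q i)" if i: "i \<in> {1..s}" for i
  proof -
    interpret padic "p i" using padic i .
    show ?thesis using \<delta>[OF i] by simp
  qed
  then show ?thesis by (simp add: \<Phi>_def Qb_simps)
qed

lemma Phi_comp: "i \<in> {1..s} \<Longrightarrow> \<Phi> x i = io i (x ^ m) \<otimes>\<^bsub>Q i\<^esub> \<delta> i" by (simp add: \<Phi>_def)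

lemma Phi_nonzero: assumes "x \<noteq> 0" shows "\<Phi> x \<noteq> \<zero>\<^bsub>Qb s p\<^esub>"
proof
  assume z: "\<Phi> x = \<zero>\<^bsub>Qb s p\<^esub>"
  obtain i where i: "i \<in> {1..s}" using s1 by force
  interpret padic "p i" using padic[OF i] .
  have "io i (x ^ m) \<otimes>\<^bsub>Q i\<^esub> \<delta> i = \<zero>\<^bsub>Q i\<^esub>" using fun_cong[OF z, of i] Qb_zero(2)[OF i] i by (simp add: \<Phi>_def)
  then show False using \<delta>[OF i] iota_nonzero[of "x ^ m"] assms by (simp add: Q.integral_iff)
qed

lemma beta_scale: "\<beta> (of_nat b * x) = \<beta> x"
proof (cases "x = 0")
  case False
  have b0: "(of_nat b :: rat) \<noteq> 0" using b_pos by simp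
  have "nu (\<Phi> (of_nat b * x)) = nu (\<Phi> x) + int m"
  proof (rule nu_eqI[OF Phi_closed Phi_nonzero[OF False] Phi_closed Phi_nonzero])
    fix i e assume i: "i \<in> {1..s}"
    interpret padic "p i" using padic i .
    have e: "io i ((of_nat b * x) ^ m) \<otimes>\<^bsub>Q i\<^esub> \<delta> i = io i (of_nat b ^ m) \<otimes>\<^bsub>Q i\<^esub> (io i (x ^ m) \<otimes>\<^bsub>Q i\<^esub> \<delta> i)"
      using \<delta>[OF i] by (simp add: power_mult_distrib iota_mult Q.m_assoc)
    have "int (l i) * (e + int m) - rat_val (p i) (of_nat b ^ m) = int (l i) * e"
      using rat_val_power[OF prime b0] rat_val_b[OF i] by (simp add: algebra_simps)
    then show "\<Phi> x i \<in> V i (int (l i) * e) \<longleftrightarrow> \<Phi> (of_nat b * x) i \<in> V i (int (l i) * (e + int m))"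
      using i iota_scale[of "of_nat b ^ m" "io i (x ^ m) \<otimes>\<^bsub>Q i\<^esub> \<delta> i" "int (l i) * (e + int m)"] b0 \<delta>[OF i]
      by (simp add: \<Phi>_def e)
  qed (use b0 False in simp)
  then have "\<beta> (of_nat b * x) = of_nat b powi (- nu (\<Phi> x) - int m) * (of_nat b ^ m * x ^ m)"
    by (simp add: \<beta>_def power_mult_distrib)
  also have "\<dots> = \<beta> x" using b0 by (simp add: \<beta>_def power_int_diff)
  finally show ?thesis .
qed (use m in \<open>simp add: \<beta>_def\<close>)

lemma ucont_Phi:
  assumes v: "\<And>i. i \<in> {1..s} \<Longrightarrow> rge (p i) 0 v"
  shows "ucont (\<lambda>n. \<Phi> (of_nat u * of_nat n + v))"
  unfolding ucont_def
proof (intro conjI allI ballI)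
  fix i assume i: "i \<in> {1..s}"
  interpret padic "p i" using padic i .
  obtain D where D: "\<delta> i \<in> Ov D" using Ov_ex \<delta>[OF i] by blast
  let ?x = "\<lambda>n. of_nat u * of_nat n + v"
  have x0: "io i (?x n) \<in> Ov 0" for n
    using rge_add[OF prime rge_of_nat[OF prime, of "u * n"] v[OF i]] by (simp add: iota_Ov)
  have "\<Phi> (?x n) i \<ominus>\<^bsub>Q i\<^esub> \<Phi> (?x n') i \<in> V i N" if c: "[n = n'] (mod p i ^ nat (N + (- D)))" for n n' N
  proof -
    have "io i (of_nat n) \<ominus>\<^bsub>Q i\<^esub> io i (of_nat n') \<in> Ov (int (nat (N + - D)))" using c unfolding iota_diff_Ov .
    then have "rge (p i) (N - D) (of_nat n - of_nat n')"
      by (simp only: iota_Ov flip: iota_diff) (erule rge_mono, simp)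
    then have "rge (p i) (0 + (N - D)) (of_nat u * (of_nat n - of_nat n'))"
      by (intro rge_mult[OF prime] rge_of_nat[OF prime])
    then have "rge (p i) (N - D) (?x n - ?x n')" by (simp add: algebra_simps)
    then have "io i (?x n) \<ominus>\<^bsub>Q i\<^esub> io i (?x n') \<in> Ov (N - D)" by (simp only: iota_Ov flip: iota_diff)
    then have "io i (?x n) [^]\<^bsub>Q i\<^esub> m \<ominus>\<^bsub>Q i\<^esub> io i (?x n') [^]\<^bsub>Q i\<^esub> m \<in> Ov (N - D)"
      by (rule pow_diff_Ov[OF x0 x0])
    then have "(io i (?x n ^ m) \<ominus>\<^bsub>Q i\<^esub> io i (?x n' ^ m)) \<otimes>\<^bsub>Q i\<^esub> \<delta> i \<in> Ov (N - D + D)"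
      unfolding iota_pow using D by (rule Ov_mult)
    moreover have "(a \<ominus>\<^bsub>Q i\<^esub> c) \<otimes>\<^bsub>Q i\<^esub> d = a \<otimes>\<^bsub>Q i\<^esub> d \<ominus>\<^bsub>Q i\<^esub> c \<otimes>\<^bsub>Q i\<^esub> d"
      if "a \<in> carrier (Q i)" "c \<in> carrier (Q i)" "d \<in> carrier (Q i)" for a c d
      using that by algebra
    ultimately show ?thesis using \<delta>[OF i] i by (simp add: \<Phi>_def)
  qed
  then show "\<exists>C. \<forall>n n' N. [n = n'] (mod p i ^ nat (N + C)) \<longrightarrow> \<Phi> (?x n) i \<ominus>\<^bsub>Q i\<^esub> \<Phi> (?x n') i \<in> V i N"
    by blast
qed (rule Phi_closed)

lemma Phi_bounded: "\<exists>E. \<forall>x. \<forall>i\<in>{1..s}. \<not> rge (p i) N x \<longrightarrow> nu (\<Phi> x) < E"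
proof -
  have "\<exists>C. \<delta> i \<notin> V i C" if i: "i \<in> {1..s}" for i
    using padic.Ov_zeroI[OF padic[OF i]] \<delta>[OF i] by blast
  then obtain C where C: "\<And>i. i \<in> {1..s} \<Longrightarrow> \<delta> i \<notin> V i (C i)" by metis
  define E where "E = (\<Sum>i\<in>{1..s}. \<bar>int m * N + C i\<bar>)"
  have "nu (\<Phi> x) < E" if i: "i \<in> {1..s}" and x: "\<not> rge (p i) N x" for x i
  proof (rule ccontr)
    interpret padic "p i" using padic i .
    assume "\<not> nu (\<Phi> x) < E"
    moreover have x0: "x \<noteq> 0" using x by auto
    ultimately have "\<Phi> x i \<in> V i (int (l i) * E)" using nu_iff[OF Phi_closed Phi_nonzero[OF x0], of E] i by simp
    moreover have "\<bar>int m * N + C i\<bar> \<le> E" unfolding E_def using i by (intro member_le_sum) auto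
    then have "int m * N + C i \<le> int (l i) * E"
      using l1[OF i] mult_right_mono[of 1 "int (l i)" E] by linarith
    ultimately have "io i (x ^ m) \<otimes>\<^bsub>Q i\<^esub> \<delta> i \<in> Ov (int m * N + C i)" using i Ov_mono by (simp add: \<Phi>_def)
    then show False using power_scale_bound[OF x m _ C[OF i]] \<delta>[OF i] by blast
  qed
  then show ?thesis by blast
qed

lemma rreg_beta:
  assumes q: "\<And>i. i \<in> {1..s} \<Longrightarrow> rge (p i) 0 q"
  shows "rreg b (\<lambda>n. \<beta> (of_nat n - q) * of_nat n ^ h)"
proof -
  obtain u w where uw: "quotient_of q = (u, w)" by fastforce
  have w: "w > 0" and quw: "q = of_int u / of_int w" and co: "coprime u w"
    using quotient_of_denom_pos[OF uw] quotient_of_div[OF uw] quotient_of_coprime[OF uw] by auto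
  have pw: "\<not> int (p i) dvd w" if i: "i \<in> {1..s}" for i
  proof
    assume pd: "int (p i) dvd w"
    have nu: "\<not> is_unit (int (p i))" using primes[OF i] not_prime_unit[of "int (p i)"] by auto
    have "\<not> int (p i) dvd u" using co nu pd by (meson coprime_common_divisor)
    then have u0: "u \<noteq> 0" and "multiplicity (int (p i)) u = 0" by (auto simp: not_dvd_imp_multiplicity_0)
    moreover have "multiplicity (int (p i)) w > 0" using pd w nu by (simp add: multiplicity_gt_zero_iff)
    ultimately have "rat_val (p i) q < 0" using rat_val_divide[OF primes[OF i] u0, of w] w quw by simp
    moreover have "q \<noteq> 0" using u0 w quw by simp
    ultimately show False using q[OF i] by (simp add: rge_def)
  qed
  define Y where "Y = {y. \<exists>z::int. y = of_int z / of_int w \<and> \<bar>y\<bar> \<le> \<bar>q\<bar> + 1}"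
  define K where "K = \<lceil>of_int w * (\<bar>q\<bar> + 1)\<rceil>"
  have "Y \<subseteq> (\<lambda>z. of_int z / of_int w) ` {-K..K}"
  proof
    fix y assume "y \<in> Y"
    then obtain z where z: "y = of_int z / of_int w" "\<bar>y\<bar> \<le> \<bar>q\<bar> + 1" unfolding Y_def by blast
    have "\<bar>of_int z :: rat\<bar> = of_int w * \<bar>y\<bar>" using z w by (simp add: abs_mult)
    also have "\<dots> \<le> of_int w * (\<bar>q\<bar> + 1)" using z w by (intro mult_left_mono) auto
    also have "\<dots> \<le> of_int K" by (simp add: K_def)
    finally have "\<bar>z\<bar> \<le> K" by (simp only: of_int_abs[symmetric] of_int_le_iff)
    then show "y \<in> (\<lambda>z. of_int z / of_int w) ` {-K..K}" using z by (intro image_eqI[of _ _ z]) auto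
  qed
  then have Y: "finite Y" by (rule finite_subset) simp
  have Yint: "rge (p i) 0 y" if "y \<in> Y" and i: "i \<in> {1..s}" for y i
  proof -
    obtain z where z: "y = of_int z / of_int w" using \<open>y \<in> Y\<close> by (auto simp: Y_def)
    show ?thesis using rat_val_divide[OF primes[OF i], of z w] w pw[OF i] z
      by (cases "z = 0") (auto simp: rge_def not_dvd_imp_multiplicity_0)
  qed
  show ?thesis
  proof (rule rreg_orbit[where Y = Y and \<beta> = \<beta>, OF Y beta_scale])
    show "q \<in> Y" using quw by (auto simp: Y_def)
    fix y j assume y: "y \<in> Y" and j: "j < b"
    obtain z where z: "y = of_int z / of_int w" "\<bar>y\<bar> \<le> \<bar>q\<bar> + 1" using y unfolding Y_def by blast
    show "(\<exists>y'\<in>Y. y = of_nat j + of_nat b * y') \<or> (\<forall>h. rreg b (\<lambda>n. \<beta> (of_nat (b * n + j) - y) * of_nat n ^ h))"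
    proof (cases "int b dvd z - w * int j")
      case True
      then obtain t where t: "z - w * int j = int b * t" by blast
      define y' :: rat where "y' = of_int t / of_int w"
      have "(of_int (z - w * int j) :: rat) = of_int (int b * t)" using t by simp
      then have yy: "y = of_nat j + of_nat b * y'" using w z by (simp add: y'_def field_simps)
      have b1: "(1::rat) \<le> of_nat b" using b_pos by (simp add: Suc_le_eq)
      have jb: "(of_nat j :: rat) \<le> of_nat b - 1"
      proof -
        have "of_nat (j + 1) \<le> (of_nat b :: rat)" using j by (simp only: of_nat_le_iff)
        then show ?thesis by simp
      qed
      have "of_nat b * \<bar>y'\<bar> = \<bar>y - of_nat j\<bar>" using yy by (simp add: abs_mult)
      also have "\<dots> \<le> \<bar>q\<bar> + 1 + (of_nat b - 1)" using z(2) jb by linarith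
      also have "\<dots> \<le> of_nat b * (\<bar>q\<bar> + 1)" using mult_right_mono[OF b1, of "\<bar>q\<bar>"] by (simp add: algebra_simps)
      finally have "\<bar>y'\<bar> \<le> \<bar>q\<bar> + 1" using b1 by (simp add: mult_le_cancel_left_pos)
      then have "y' \<in> Y" by (auto simp: Y_def y'_def)
      then show ?thesis using yy by blast
    next
      case False
      obtain i where i: "i \<in> {1..s}" and nd: "\<not> int (p i) ^ l i dvd z - w * int j"
        using False prod_dvd_if_all_dvd[of l "z - w * int j"] unfolding b_def by blast
      interpret padic "p i" using padic i .
      have "p i ^ l i dvd b" unfolding b_def using i by (intro dvd_prodI) auto
      then have bd: "int (p i) ^ l i dvd int b" by (simp flip: of_nat_power)
      let ?x = "\<lambda>n. of_nat b * of_nat n + (of_nat j - y) :: rat"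
      have nr: "\<not> rge (p i) (int (l i)) (?x n)" for n
      proof
        assume "rge (p i) (int (l i)) (?x n)"
        then have "rge (p i) (0 + int (l i)) (of_int w * ?x n)" by (intro rge_mult[OF prime] rge_of_int[OF prime])
        moreover have "of_int w * ?x n = of_int (int b * (w * int n) - (z - w * int j))"
          using w z by (simp add: field_simps)
        ultimately have "int (p i) ^ l i dvd int b * (w * int n) - (z - w * int j)"
          using rge_of_int_iff[OF prime] by (simp only: add_0)
        then have "int (p i) ^ l i dvd int b * (w * int n) - (int b * (w * int n) - (z - w * int j))"
          by (rule dvd_diff[OF dvd_mult2[OF bd]])
        then show False using nd by simp
      qed
      obtain E where E: "\<And>n. nu (\<Phi> (?x n)) < E" using Phi_bounded[of "int (l i)"] nr i by blast
      have x0: "?x n \<noteq> 0" for n using nr[of n] rge_0 by metis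
      have uc: "ucont (\<lambda>n. \<Phi> (?x n))"
        by (rule ucont_Phi) (use rge_diff[OF primes rge_of_nat[OF primes] Yint[OF y]] in blast)
      obtain M where M: "M > 0" "\<And>n n'. [n = n'] (mod M) \<Longrightarrow> nu (\<Phi> (?x n)) = nu (\<Phi> (?x n'))"
        using nu_periodic[OF uc, of UNIV E] E Phi_nonzero[OF x0] by auto
      have "rreg b (\<lambda>n. \<beta> (of_nat (b * n + j) - y) * of_nat n ^ h)" for h
      proof -
        have "rreg b (\<lambda>n. of_nat b powi (- nu (\<Phi> (?x n))) * (?x n ^ m * of_nat n ^ h))"
        proof (rule rreg_periodic_poly[OF M(1)])
          fix n
          have "[n mod M = n] (mod M)" by (simp add: cong_def)
          from M(2)[OF this] show "of_nat b powi (- nu (\<Phi> (?x (n mod M)))) = (of_nat b powi (- nu (\<Phi> (?x n))) :: rat)" by simp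
        qed
        moreover have "of_nat (b * n + j) - y = ?x n" for n by simp
        ultimately show ?thesis by (simp only: \<beta>_def mult.assoc)
      qed
      then show ?thesis by blast
    qed
  qed
qed

end

lemma unique_root_regular:
  assumes g: "\<And>i. i \<in> {1..s} \<Longrightarrow> g i \<in> carrier (poly_ring (Q i))"
    and f: "\<And>i. i \<in> {1..s} \<Longrightarrow> f i \<in> carrier (poly_ring (Q i))"
    and q: "\<And>i. i \<in> {1..s} \<Longrightarrow> rge (p i) 0 q" and m: "m \<ge> 1"
    and gq: "\<And>i. i \<in> {1..s} \<Longrightarrow> ring.eval (Q i) (g i) (io i q) \<noteq> \<zero>\<^bsub>Q i\<^esub>"
    and gC: "\<And>i n. i \<in> {1..s} \<Longrightarrow> ring.eval (Q i) (g i) (io i (of_nat n)) \<notin> V i (C i)"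
    and fg: "\<And>i n. i \<in> {1..s} \<Longrightarrow> ring.eval (Q i) (f i) (io i (of_nat n)) =
      io i ((of_nat n - q) ^ m) \<otimes>\<^bsub>Q i\<^esub> ring.eval (Q i) (g i) (io i (of_nat n))"
  shows "k_regular (Zb s p) b (\<lambda>n. L_b s p l (eval_tuple s p f n))"
proof -
  let ?F = "\<lambda>n. eval_tuple s p f n"
  let ?g = "\<lambda>i n. ring.eval (Q i) (g i) (io i (of_nat n))"
  define \<delta> where "\<delta> = (\<lambda>i. ring.eval (Q i) (g i) (io i q))"
  have gs: "set (g i) \<subseteq> carrier (Q i)" and fs: "set (f i) \<subseteq> carrier (Q i)" if "i \<in> {1..s}" for i
    using padic.poly_set[OF padic[OF that]] g[OF that] f[OF that] by auto
  have gc: "?g i n \<in> carrier (Q i)" if i: "i \<in> {1..s}" for i n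
  proof -
    interpret padic "p i" using padic i .
    show ?thesis using gs[OF i] by (rule Q.eval_in_carrier) simp
  qed
  have \<delta>: "\<delta> i \<in> carrier (Q i) \<and> \<delta> i \<noteq> \<zero>\<^bsub>Q i\<^esub>" if i: "i \<in> {1..s}" for i
  proof -
    interpret padic "p i" using padic i .
    show ?thesis using Q.eval_in_carrier[OF gs[OF i] iota_closed] gq[OF i] by (simp add: \<delta>_def)
  qed
  note Phi_closed = Phi_closed[OF \<delta> m] and Phi_nonzero = Phi_nonzero[OF \<delta> m]
  let ?P = "\<Phi> \<delta> m"
  have Pi: "?P x i = io i (x ^ m) \<otimes>\<^bsub>Q i\<^esub> \<delta> i" if "i \<in> {1..s}" for x i
    by (rule Phi_comp[OF \<delta> m that])
  have Be: "\<beta> \<delta> m x = of_nat b powi (- nu (?P x)) * x ^ m" for x by (rule \<beta>_def[OF \<delta> m])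
  have Fc: "?F n \<in> carrier (Qb s p)" for n by (rule eval_tuple_Qb[OF fs])
  have Fi: "?F n i = io i ((of_nat n - q) ^ m) \<otimes>\<^bsub>Q i\<^esub> ?g i n" if "i \<in> {1..s}" for i n
    using that fg[OF that] by (simp add: eval_tuple_def)
  have gnz: "?g i n \<noteq> \<zero>\<^bsub>Q i\<^esub>" if i: "i \<in> {1..s}" for i n
    using gC[OF i, of n] padic.Ov_zero[OF padic[OF i], of "C i"] by metis
  have Fnz: "?F n \<noteq> \<zero>\<^bsub>Qb s p\<^esub>" if n: "of_nat n \<noteq> q" for n
  proof
    assume z: "?F n = \<zero>\<^bsub>Qb s p\<^esub>"
    obtain i where i: "i \<in> {1..s}" using s1 by force
    interpret padic "p i" using padic[OF i] .
    have "io i ((of_nat n - q) ^ m) \<otimes>\<^bsub>Q i\<^esub> ?g i n = \<zero>\<^bsub>Q i\<^esub>"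
      using fun_cong[OF z, of i] Qb_zero(2)[OF i] Fi[OF i] by simp
    then show False using gnz[OF i] gc[OF i] iota_nonzero[of "(of_nat n - q) ^ m"] n by (simp add: Q.integral_iff)
  qed
  have "\<exists>N::nat. \<forall>n. rge (p i) (int N) (of_nat n - q) \<longrightarrow> padic.pv (p i) (?g i n) = padic.pv (p i) (\<delta> i)" if i: "i \<in> {1..s}" for i
  proof -
    interpret padic "p i" using padic i .
    obtain D where D: "\<And>x y N. x \<in> Ov 0 \<Longrightarrow> y \<in> Ov 0 \<Longrightarrow> x \<ominus>\<^bsub>Q i\<^esub> y \<in> Ov (N + D) \<Longrightarrow> Q.eval (g i) x \<ominus>\<^bsub>Q i\<^esub> Q.eval (g i) y \<in> Ov N"
      using eval_continuous[OF gs[OF i]] by blast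
    have "pv (?g i n) = pv (\<delta> i)" if r: "rge (p i) (int (nat (pv (\<delta> i) + 1 + D))) (of_nat n - q)" for n
    proof (rule pv_perturb(2)[OF gc[OF i]])
      have "io i (of_nat n - q) \<in> Ov (pv (\<delta> i) + 1 + D)" unfolding iota_Ov using r by (rule rge_mono) simp
      then show "?g i n \<ominus>\<^bsub>Q i\<^esub> \<delta> i \<in> Ov (pv (\<delta> i) + 1)" unfolding \<delta>_def
        using q[OF i] by (intro D) (simp_all add: iota_Ov rge_of_nat[OF prime] iota_diff)
    qed (use \<delta>[OF i] in auto)
    then show ?thesis by blast
  qed
  then obtain N0 where N0: "\<And>i n. i \<in> {1..s} \<Longrightarrow> rge (p i) (int (N0 i)) (of_nat n - q) \<Longrightarrow> padic.pv (p i) (?g i n) = padic.pv (p i) (\<delta> i)"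
    by metis
  define N where "N = (\<Sum>i\<in>{1..s}. N0 i)"
  have N0N: "N0 i \<le> N" if "i \<in> {1..s}" for i unfolding N_def using that by (intro member_le_sum) auto
  define near where "near = (\<lambda>n::nat. \<forall>i\<in>{1..s}. rge (p i) (int N) (of_nat n - q))"
  have near_eq: "nu (?P (of_nat n - q)) = nu (?F n)" if nr: "near n" and nq: "of_nat n \<noteq> q" for n
  proof -
    have "nu (?P (of_nat n - q)) = nu (?F n) + 0"
    proof (rule nu_eqI[OF Fc Fnz[OF nq] Phi_closed Phi_nonzero])
      fix i e assume i: "i \<in> {1..s}"
      interpret padic "p i" using padic i .
      have "rge (p i) (int N) (of_nat n - q)" using nr i by (simp add: near_def)
      then have "rge (p i) (int (N0 i)) (of_nat n - q)" by (rule rge_mono) (use N0N[OF i] in simp)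
      then have "pv (?g i n) = pv (\<delta> i)" using N0[OF i] by blast
      then have "?g i n \<in> Ov K \<longleftrightarrow> \<delta> i \<in> Ov K" for K
        using Ov_pv[OF gc[OF i] gnz[OF i]] Ov_pv[of "\<delta> i"] \<delta>[OF i] by simp
      then show "?F n i \<in> V i (int (l i) * e) \<longleftrightarrow> ?P (of_nat n - q) i \<in> V i (int (l i) * (e + 0))"
        using iota_scale[of "(of_nat n - q) ^ m"] nq gc[OF i] \<delta>[OF i]
        by (simp add: Pi[OF i] Fi[OF i])
    qed (use nq in simp_all)
    then show ?thesis by simp
  qed
  define A where "A = {n. \<not> near n}"
  have Aq: "of_nat n \<noteq> q" if "n \<in> A" for n using that by (auto simp: A_def near_def)
  obtain E where E: "\<And>x i. i \<in> {1..s} \<Longrightarrow> \<not> rge (p i) (int N) x \<Longrightarrow> nu (?P x) < E"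
    using Phi_bounded[OF \<delta> m, of "int N"] by blast
  have EP: "nu (?P (of_nat n - q)) < E" if "n \<in> A" for n using E that by (auto simp: A_def near_def)
  define E' where "E' = (\<Sum>i\<in>{1..s}. \<bar>int m * int N + C i\<bar>)"
  have EF: "nu (?F n) < E'" if n: "n \<in> A" for n
  proof (rule ccontr)
    assume a: "\<not> nu (?F n) < E'"
    obtain i where i: "i \<in> {1..s}" "\<not> rge (p i) (int N) (of_nat n - q)" using n by (auto simp: A_def near_def)
    interpret padic "p i" using padic i(1) .
    have "?F n i \<in> V i (int (l i) * E')" using nu_iff[OF Fc Fnz[OF Aq[OF n]], of E'] i a by simp
    moreover have "\<bar>int m * int N + C i\<bar> \<le> E'" unfolding E'_def using i by (intro member_le_sum) auto
    then have "int m * int N + C i \<le> int (l i) * E'"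
      using l1[OF i(1)] mult_right_mono[of 1 "int (l i)" E'] by linarith
    ultimately have "io i ((of_nat n - q) ^ m) \<otimes>\<^bsub>Q i\<^esub> ?g i n \<in> Ov (int m * int N + C i)"
      using Fi[OF i(1)] Ov_mono by simp
    then show False using power_scale_bound[OF i(2) m gc[OF i(1)] gC[OF i(1)]] by blast
  qed
  have ucF: "ucont ?F" by (rule ucont_eval_tuple[OF fs])
  have ucP: "ucont (\<lambda>n. ?P (of_nat n - q))"
    using ucont_Phi[OF \<delta> m, of "- q" 1] q by (simp add: rge_minus)
  obtain M1 where M1: "M1 > 0" "\<And>n n'. n \<in> A \<Longrightarrow> n' \<in> A \<Longrightarrow> [n = n'] (mod M1) \<Longrightarrow> nu (?F n) = nu (?F n')"
    using nu_periodic[OF ucF, of A E'] EF Fnz Aq by meson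
  have PA: "?P (of_nat n - q) \<noteq> \<zero>\<^bsub>Qb s p\<^esub> \<and> nu (?P (of_nat n - q)) < E" if "n \<in> A" for n
    using Phi_nonzero[of "of_nat n - q"] Aq[OF that] EP[OF that] by simp
  obtain M2 where M2: "M2 > 0" "\<And>n n'. n \<in> A \<Longrightarrow> n' \<in> A \<Longrightarrow> [n = n'] (mod M2) \<Longrightarrow> nu (?P (of_nat n - q)) = nu (?P (of_nat n' - q))"
    using nu_periodic[OF ucP, of A E] PA by meson
  define M0 where "M0 = (\<Prod>i=1..s. p i ^ N)"
  have M0: "M0 > 0" unfolding M0_def using p_pos by (intro prod_pos) simp
  have near_per: "near n'" if c: "[n = n'] (mod M0)" and nn: "near n" for n n'
    unfolding near_def
  proof
    fix i assume i: "i \<in> {1..s}"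
    interpret padic "p i" using padic i .
    have "p i ^ N dvd M0" unfolding M0_def using i by (intro dvd_prodI) auto
    then have "[n' = n] (mod p i ^ N)" using c cong_dvd_modulus_nat cong_sym by blast
    then have "rge (p i) (int N) (of_nat n' - of_nat n)" using iota_diff_Ov iota_Ov by (simp flip: iota_diff)
    moreover have "rge (p i) (int N) (of_nat n - q)" using nn i by (simp add: near_def)
    ultimately have "rge (p i) (int N) ((of_nat n' - of_nat n) + (of_nat n - q))" by (rule rge_add[OF prime])
    then show "rge (p i) (int N) (of_nat n' - q)" by simp
  qed
  define M where "M = M0 * M1 * M2"
  have Mpos: "M > 0" using M0 M1 M2 by (simp add: M_def)
  define \<psi> :: "nat \<Rightarrow> rat" where "\<psi> n = (if near n then 0 else of_nat b powi (- nu (?F n)) - of_nat b powi (- nu (?P (of_nat n - q))))" for n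
  have per: "\<psi> (n mod M) = \<psi> n" for n
  proof -
    have c: "[n mod M = n] (mod M)" by (simp add: cong_def)
    have c0: "[n mod M = n] (mod M0)" by (rule cong_dvd_modulus_nat[OF c]) (simp add: M_def)
    have c1: "[n mod M = n] (mod M1)" by (rule cong_dvd_modulus_nat[OF c]) (simp add: M_def)
    have c2: "[n mod M = n] (mod M2)" by (rule cong_dvd_modulus_nat[OF c]) (simp add: M_def)
    have "near (n mod M) \<longleftrightarrow> near n" using near_per[OF c0] near_per[OF cong_sym[OF c0]] by blast
    then show ?thesis using M1(2)[OF _ _ c1] M2(2)[OF _ _ c2] by (auto simp: \<psi>_def A_def)
  qed
  have reg: "rreg b (\<lambda>n. (of_nat b powi (- nu (?F n)) * (of_nat n - q) ^ m) * of_nat n ^ h)" for h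
  proof -
    have "rreg b (\<lambda>n. \<beta> \<delta> m (of_nat n - q) * of_nat n ^ h + \<psi> n * ((1 * of_nat n + - q) ^ m * of_nat n ^ h))"
      by (rule rreg_add[OF _ rreg_periodic_poly[of M \<psi> b 1 "- q" m h, OF Mpos per]])
        (rule rreg_beta[OF \<delta> m q])
    moreover have "\<beta> \<delta> m (of_nat n - q) * of_nat n ^ h + \<psi> n * ((1 * of_nat n + - q) ^ m * of_nat n ^ h) =
       (of_nat b powi (- nu (?F n)) * (of_nat n - q) ^ m) * of_nat n ^ h" for n
    proof (cases "of_nat n = q")
      case True
      then show ?thesis using m by (simp add: Be power_0_left)
    next
      case False
      then show ?thesis using near_eq[of n] by (simp add: Be \<psi>_def algebra_simps)
    qed
    ultimately show ?thesis by simp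
  qed
  show ?thesis
  proof (rule k_regular_L_b[OF Fc])
    fix i assume i: "i \<in> {1..s}"
    interpret padic "p i" using padic i .
    have "L_b s p l (?F n) i = io i (of_nat b powi (- nu (?F n)) * (of_nat n - q) ^ m) \<otimes>\<^bsub>Q i\<^esub> ?g i n" for n
    proof (cases "?F n = \<zero>\<^bsub>Qb s p\<^esub>")
      case True
      then have "of_nat n = q" using Fnz by blast
      then have "of_nat b powi (- nu (?F n)) * (of_nat n - q) ^ m = 0" using m by simp
      then have "io i (of_nat b powi (- nu (?F n)) * (of_nat n - q) ^ m) = \<zero>\<^bsub>Q i\<^esub>" by (simp only: iota_0)
      then show ?thesis using True Qb_zero(2)[OF i] gc[OF i] by (simp add: L_b_def)
    next
      case False
      then show ?thesis using Fi[OF i] gc[OF i] by (simp add: L_b_comp[OF _ i] iota_mult Q.m_assoc)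
    qed
    then show "freg b (emb i (\<lambda>n. L_b s p l (?F n) i))"
      using freg_eval[OF i gs[OF i] _ reg] b_pos by (simp add: Suc_le_eq)
  qed
qed

end

section \<open>Points of discontinuity and the kernel\<close>

lemma (in padic) root_local:
  assumes f: "f \<in> carrier (poly_ring (Qp p))" and root: "\<theta> \<in> Zp_roots p f"
  shows "Q.alg_mult f \<theta> \<ge> 1" "\<exists>c N. \<forall>x\<in>Ov 0. x \<ominus>\<^bsub>Qp p\<^esub> \<theta> \<in> Ov (int N) \<longrightarrow>
    (\<forall>M. Q.eval f x \<in> Ov M \<longleftrightarrow> x = \<theta> \<or> M \<le> int (Q.alg_mult f \<theta>) * pv (x \<ominus>\<^bsub>Qp p\<^esub> \<theta>) + c)"
proof -
  have th: "\<theta> \<in> Ov 0" "\<theta> \<in> carrier (Qp p)" "f \<noteq> []" "Q.is_root f \<theta>"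
    using root by (auto simp: Zp_roots_def carrier_Zp Q.is_root_def)
  then show m: "Q.alg_mult f \<theta> \<ge> 1" using Q.alg_mult_gt_zero_iff_is_root[OF f] by (simp add: Suc_le_eq)
  obtain g where g: "g \<in> carrier (poly_ring (Qp p))" "Q.eval g \<theta> \<noteq> \<zero>\<^bsub>Qp p\<^esub>"
    "\<And>x. x \<in> carrier (Qp p) \<Longrightarrow> Q.eval f x = (x \<ominus>\<^bsub>Qp p\<^esub> \<theta>) [^]\<^bsub>Qp p\<^esub> (Q.alg_mult f \<theta>) \<otimes>\<^bsub>Qp p\<^esub> Q.eval g x"
    using eval_factor[OF f th(3,2)] by blast
  have gc: "Q.eval g x \<in> carrier (Qp p)" if "x \<in> carrier (Qp p)" for x
    using Q.eval_in_carrier poly_set[OF g(1)] that by blast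
  obtain D where D: "\<And>x y N. x \<in> Ov 0 \<Longrightarrow> y \<in> Ov 0 \<Longrightarrow> x \<ominus>\<^bsub>Qp p\<^esub> y \<in> Ov (N + D) \<Longrightarrow> Q.eval g x \<ominus>\<^bsub>Qp p\<^esub> Q.eval g y \<in> Ov N"
    using eval_continuous[OF poly_set[OF g(1)]] by blast
  define c where "c = pv (Q.eval g \<theta>)"
  define N where "N = nat (c + 1 + D)"
  have "Q.eval f x \<in> Ov M \<longleftrightarrow> x = \<theta> \<or> M \<le> int (Q.alg_mult f \<theta>) * pv (x \<ominus>\<^bsub>Qp p\<^esub> \<theta>) + c"
    if x: "x \<in> Ov 0" and xN: "x \<ominus>\<^bsub>Qp p\<^esub> \<theta> \<in> Ov (int N)" for x M
  proof (cases "x = \<theta>")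
    case True
    then show ?thesis using th(4) by (simp add: Q.is_root_def)
  next
    case False
    have xc: "x \<in> carrier (Qp p)" using Ov_closed[OF x] .
    have "x \<ominus>\<^bsub>Qp p\<^esub> \<theta> \<in> Ov (c + 1 + D)" using xN by (rule Ov_mono) (simp add: N_def)
    then have "Q.eval g x \<ominus>\<^bsub>Qp p\<^esub> Q.eval g \<theta> \<in> Ov (pv (Q.eval g \<theta>) + 1)"
      unfolding c_def by (intro D x th(1))
    then have gx: "Q.eval g x \<noteq> \<zero>\<^bsub>Qp p\<^esub>" "pv (Q.eval g x) = c"
      using pv_perturb[OF gc[OF xc] gc[OF th(2)] g(2)] by (auto simp: c_def)
    have d: "x \<ominus>\<^bsub>Qp p\<^esub> \<theta> \<in> carrier (Qp p)" "x \<ominus>\<^bsub>Qp p\<^esub> \<theta> \<noteq> \<zero>\<^bsub>Qp p\<^esub>"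
      using xc th False by (auto simp: Q.r_right_minus_eq)
    have dm: "(x \<ominus>\<^bsub>Qp p\<^esub> \<theta>) [^]\<^bsub>Qp p\<^esub> Q.alg_mult f \<theta> \<noteq> \<zero>\<^bsub>Qp p\<^esub>" using pow_nonzero[OF d] .
    have "Q.eval f x \<noteq> \<zero>\<^bsub>Qp p\<^esub>" unfolding g(3)[OF xc] using dm gx gc[OF xc] d by (simp add: Q.integral_iff)
    moreover have "pv (Q.eval f x) = int (Q.alg_mult f \<theta>) * pv (x \<ominus>\<^bsub>Qp p\<^esub> \<theta>) + c"
      unfolding g(3)[OF xc] using pv_mult[OF _ gc[OF xc] dm gx(1)] pv_pow[OF d] gx d by simp
    ultimately show ?thesis using Ov_pv[of "Q.eval f x" M] False Q.eval_in_carrier[OF poly_set[OF f] xc] by simp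
  qed
  then show "\<exists>c N. \<forall>x\<in>Ov 0. x \<ominus>\<^bsub>Qp p\<^esub> \<theta> \<in> Ov (int N) \<longrightarrow>
    (\<forall>M. Q.eval f x \<in> Ov M \<longleftrightarrow> x = \<theta> \<or> M \<le> int (Q.alg_mult f \<theta>) * pv (x \<ominus>\<^bsub>Qp p\<^esub> \<theta>) + c)" by blast
qed

context prime_powers
begin

lemma Zb_comp: "x \<in> carrier (Zb s p) \<Longrightarrow> i \<in> {1..s} \<Longrightarrow> x i \<in> V i 0"
  by (auto simp: carrier_Zb)

lemma Zb_Qb: "x \<in> carrier (Zb s p) \<Longrightarrow> x \<in> carrier (Qb s p)"
  unfolding carrier_Zb Qb_simps PiE_iff using padic.Ov_closed[OF padic] by blast

lemma k_regularE:
  assumes "k_regular (Zb s p) k a" and a: "\<And>n. a n \<in> carrier (Zb s p)" and k: "k \<ge> 1"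
  obtains S where "finite S" "S \<subseteq> carrier (seq_group (Qb s p))"
    "generate (seq_group (Qb s p)) S \<subseteq> carrier (seq_group (Zb s p))"
    "\<And>t j. j < k ^ t \<Longrightarrow> (\<lambda>n. a (k ^ t * n + j)) \<in> generate (seq_group (Qb s p)) S"
proof -
  obtain S where S: "finite S" "S \<subseteq> carrier (seq_group (Zb s p))"
    "generate (seq_group (Zb s p)) S = generate (seq_group (Zb s p)) (k_kernel k a)"
    using assms(1) unfolding k_regular_def by blast
  have K: "k_kernel k a \<subseteq> carrier (seq_group (Zb s p))"
    using a by (auto simp: k_kernel_def seq_group_simps)
  have "(\<lambda>n. a (k ^ t * n + j)) \<in> generate (seq_group (Qb s p)) S" if "j < k ^ t" for t j
  proof -
    have "j \<le> k ^ t - 1" using that by simp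
    then have "(\<lambda>n. a (k ^ t * n + j)) \<in> k_kernel k a" unfolding k_kernel_def by blast
    then show ?thesis using generate.incl S(3) unfolding generate_seq_Zb[OF S(2)] generate_seq_Zb[OF K] by fast
  qed
  moreover have "generate (seq_group (Qb s p)) S \<subseteq> carrier (seq_group (Zb s p))"
    by (rule SG.generate_subgroup_incl[OF S(2) subgroup_seq_Zb])
  ultimately show ?thesis using that[OF S(1)] S(2) seq_Zb_sub by blast
qed

lemma seq_pow:
  assumes h: "h \<in> carrier (seq_group (Qb s p))" and i: "i \<in> {1..s}"
  shows "(h [^]\<^bsub>seq_group (Qb s p)\<^esub> (e::nat)) n i = io i (of_nat e) \<otimes>\<^bsub>Q i\<^esub> h n i"
proof (induction e)
  case 0
  interpret padic "p i" using padic i .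
  have "h n i \<in> carrier (Q i)" using h i unfolding mem_seq_Qb by blast
  then show ?case using i by (simp add: seq_group_simps Qb_simps iota_0)
next
  case (Suc e)
  interpret padic "p i" using padic i .
  have "h n i \<in> carrier (Q i)" using h i unfolding mem_seq_Qb by blast
  then show ?case using Suc i by (simp add: seq_mult iota_add iota_1 Q.l_distr Q.a_comm)
qed

text \<open>A finitely generated abelian group has finitely many classes modulo \<open>p\<^sub>i\<^sup>L\<close>.\<close>

lemma finite_kernel_sets:
  assumes reg: "k_regular (Zb s p) k a" and a: "\<And>n. a n \<in> carrier (Zb s p)" and k: "k \<ge> 1" and i: "i \<in> {1..s}"
  shows "finite {{n. a (k ^ t * n + j) i \<in> V i (int L)} | t j. j < k ^ t}"
proof -
  interpret padic "p i" using padic i .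
  obtain S where S: "finite S" "S \<subseteq> carrier (seq_group (Qb s p))"
    "generate (seq_group (Qb s p)) S \<subseteq> carrier (seq_group (Zb s p))"
    "\<And>t j. j < k ^ t \<Longrightarrow> (\<lambda>n. a (k ^ t * n + j)) \<in> generate (seq_group (Qb s p)) S"
    using k_regularE[OF reg a k] by blast
  have e0: "int (p i ^ L) > 0" using p_pos[OF i] by simp
  obtain F where F: "finite F" "F \<subseteq> carrier (seq_group (Qb s p))"
    and Fc: "\<forall>c\<in>generate (seq_group (Qb s p)) S. \<exists>f\<in>F. \<exists>h\<in>generate (seq_group (Qb s p)) S.
      c = f \<otimes>\<^bsub>seq_group (Qb s p)\<^esub> h [^]\<^bsub>seq_group (Qb s p)\<^esub> int (p i ^ L)"
    using SG.fg_mod_finite[OF S(1,2) e0] by (elim exE conjE) (rule that)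
  have "{{n. a (k ^ t * n + j) i \<in> V i (int L)} | t j. j < k ^ t} \<subseteq> (\<lambda>f. {n. f n i \<in> V i (int L)}) ` F"
  proof clarify
    fix t j assume jt: "j < k ^ t"
    obtain f h where fh: "f \<in> F" "h \<in> generate (seq_group (Qb s p)) S"
      "(\<lambda>n. a (k ^ t * n + j)) = f \<otimes>\<^bsub>seq_group (Qb s p)\<^esub> h [^]\<^bsub>seq_group (Qb s p)\<^esub> int (p i ^ L)"
      using bspec[OF Fc S(4)[OF jt]] by (elim bexE) (rule that)
    have hz: "h \<in> carrier (seq_group (Zb s p))" by (rule subsetD[OF S(3) fh(2)])
    have hc: "h \<in> carrier (seq_group (Qb s p))" by (rule subsetD[OF seq_Zb_sub hz])
    have hi: "h n i \<in> V i 0" for n using hz i unfolding mem_seq_Zb by blast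
    have "f \<in> carrier (seq_group (Qb s p))" by (rule subsetD[OF F(2) fh(1)])
    then have fc: "f n i \<in> carrier (Q i)" for n using i unfolding mem_seq_Qb by blast
    have ae: "a (k ^ t * n + j) i = f n i \<oplus>\<^bsub>Q i\<^esub> io i (of_nat (p i ^ L)) \<otimes>\<^bsub>Q i\<^esub> h n i" for n
      using fun_cong[OF fun_cong[OF fh(3), of n], of i] i
      by (simp only: int_pow_int seq_mult seq_pow[OF hc i] restrict_apply if_True)
    have pL: "io i (of_nat (p i ^ L)) \<otimes>\<^bsub>Q i\<^esub> h n i \<in> V i (int L)" for n
    proof -
      have "io i (of_nat (p i ^ L)) \<in> V i (int L)"
        using rge_of_int_iff[OF prime, of L "int (p i ^ L)"] by (simp add: iota_Ov)
      from Ov_mult[OF this hi] show ?thesis by simp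
    qed
    have fu: "f n i \<oplus>\<^bsub>Q i\<^esub> u \<in> V i (int L) \<longleftrightarrow> f n i \<in> V i (int L)" if u: "u \<in> V i (int L)" for n u
    proof (rule Ov_cong)
      have "f n i \<oplus>\<^bsub>Q i\<^esub> u \<ominus>\<^bsub>Q i\<^esub> f n i = u" using fc[of n] Ov_closed[OF u] by algebra
      then show "f n i \<oplus>\<^bsub>Q i\<^esub> u \<ominus>\<^bsub>Q i\<^esub> f n i \<in> V i (int L)" using u by simp
    qed (use fc Ov_closed[OF u] in auto)
    have "{n. a (k ^ t * n + j) i \<in> V i (int L)} = {n. f n i \<in> V i (int L)}"
      by (rule Collect_cong) (simp only: ae fu[OF pL])
    then show "{n. a (k ^ t * n + j) i \<in> V i (int L)} \<in> (\<lambda>f. {n. f n i \<in> V i (int L)}) ` F"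
      using fh(1) by blast
  qed
  then show ?thesis by (rule finite_surj[OF F(1)])
qed

lemma L_b_Ov_iff:
  assumes x: "x \<in> carrier (Qb s p)" "x \<noteq> \<zero>\<^bsub>Qb s p\<^esub>" and i: "i \<in> {1..s}"
  shows "L_b s p l x i \<in> V i (int (l i)) \<longleftrightarrow> x i \<in> V i (int (l i) * (nu x + 1))"
proof -
  interpret padic "p i" using padic i .
  have b0: "(of_nat b :: rat) powi (- nu x) \<noteq> 0" using b_pos by simp
  have "rat_val (p i) (of_nat b powi (- nu x)) = - nu x * int (l i)"
    using rat_val_powi[OF prime, of "of_nat b" "- nu x"] rat_val_b[OF i] b_pos by simp
  then show ?thesis unfolding L_b_comp[OF x(2) i] iota_scale[OF b0 Qb_comp[OF x(1) i]]
    by (simp add: algebra_simps)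
qed

lemma exact_approximation:
  assumes x: "x \<in> carrier (Zb s p)"
  shows "\<exists>n. \<forall>i\<in>{1..s}. io i (of_nat n) \<ominus>\<^bsub>Q i\<^esub> x i \<noteq> \<zero>\<^bsub>Q i\<^esub> \<and>
    padic.pv (p i) (io i (of_nat n) \<ominus>\<^bsub>Q i\<^esub> x i) = int (E i)"
proof -
  have "\<exists>u. x i \<ominus>\<^bsub>Q i\<^esub> io i (of_nat u) \<in> V i (int (E i + 1))" if i: "i \<in> {1..s}" for i
    by (rule padic.Zp_dense[OF padic[OF i] Zb_comp[OF x i], of "E i + 1"]) (rule exI)
  then obtain u where u: "\<And>i. i \<in> {1..s} \<Longrightarrow> x i \<ominus>\<^bsub>Q i\<^esub> io i (of_nat (u i)) \<in> V i (int (E i + 1))" by metis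
  have "\<exists>n. \<forall>i\<in>{1..s}. [n = u i + p i ^ E i] (mod p i ^ (E i + 1))"
    by (rule chinese_remainder_nat) (use coprime_pow in blast)+
  then obtain n where n: "\<And>i. i \<in> {1..s} \<Longrightarrow> [n = u i + p i ^ E i] (mod p i ^ (E i + 1))" by blast
  show ?thesis
  proof (intro exI[of _ n] ballI)
    fix i assume i: "i \<in> {1..s}"
    interpret padic "p i" using padic i .
    have xc: "x i \<in> carrier (Q i)" using Qb_comp[OF Zb_Qb[OF x] i] .
    define P where "P = p i ^ E i"
    have P0: "(of_nat P :: rat) \<noteq> 0" using p_pos[OF i] by (simp add: P_def)
    have "multiplicity (p i) P = E i" unfolding P_def using prime by simp
    then have rP: "rat_val (p i) (of_nat P) = int (E i)" using rat_val_of_nat[OF prime, of P] P0 by simp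
    have y: "io i (of_nat P) \<noteq> \<zero>\<^bsub>Q i\<^esub>" "pv (io i (of_nat P)) = int (E i)"
      using iota_nonzero[OF P0] pv_iota[OF P0] rP by simp_all
    have alg: "(a \<ominus>\<^bsub>Q i\<^esub> z) \<ominus>\<^bsub>Q i\<^esub> d = (a \<ominus>\<^bsub>Q i\<^esub> (v \<oplus>\<^bsub>Q i\<^esub> d)) \<ominus>\<^bsub>Q i\<^esub> (z \<ominus>\<^bsub>Q i\<^esub> v)"
      if "a \<in> carrier (Q i)" "z \<in> carrier (Q i)" "d \<in> carrier (Q i)" "v \<in> carrier (Q i)" for a z d v
      using that by algebra
    have n1: "io i (of_nat n) \<ominus>\<^bsub>Q i\<^esub> (io i (of_nat (u i)) \<oplus>\<^bsub>Q i\<^esub> io i (of_nat P)) \<in> V i (int (E i + 1))"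
      using n[OF i] unfolding iota_add[symmetric] of_nat_add[symmetric] P_def iota_diff_Ov .
    have eq: "(io i (of_nat n) \<ominus>\<^bsub>Q i\<^esub> x i) \<ominus>\<^bsub>Q i\<^esub> io i (of_nat P) =
        (io i (of_nat n) \<ominus>\<^bsub>Q i\<^esub> (io i (of_nat (u i)) \<oplus>\<^bsub>Q i\<^esub> io i (of_nat P))) \<ominus>\<^bsub>Q i\<^esub> (x i \<ominus>\<^bsub>Q i\<^esub> io i (of_nat (u i)))"
      by (rule alg[OF iota_closed xc iota_closed iota_closed])
    have "(io i (of_nat n) \<ominus>\<^bsub>Q i\<^esub> x i) \<ominus>\<^bsub>Q i\<^esub> io i (of_nat P) \<in> V i (int (E i + 1))"
      unfolding eq by (rule Ov_diff[OF n1 u[OF i]])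
    then have near: "(io i (of_nat n) \<ominus>\<^bsub>Q i\<^esub> x i) \<ominus>\<^bsub>Q i\<^esub> io i (of_nat P) \<in> V i (pv (io i (of_nat P)) + 1)"
      by (simp only: y(2) of_nat_add of_nat_1)
    have c: "io i (of_nat n) \<ominus>\<^bsub>Q i\<^esub> x i \<in> carrier (Q i)" using xc by simp
    show "io i (of_nat n) \<ominus>\<^bsub>Q i\<^esub> x i \<noteq> \<zero>\<^bsub>Q i\<^esub> \<and> pv (io i (of_nat n) \<ominus>\<^bsub>Q i\<^esub> x i) = int (E i)"
      by (intro conjI pv_perturb(1)[OF c iota_closed y(1) near] trans[OF pv_perturb(2)[OF c iota_closed y(1) near] y(2)])
  qed
qed

text \<open>The points of \<open>\<int>\<^sub>b\<close> at which the indicator function of \<open>D \<subseteq> \<nat>\<close> is not locally constant.\<close>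

definition disc :: "nat set \<Rightarrow> (nat \<Rightarrow> padic) set" where
  "disc D = {x \<in> carrier (Zb s p). \<forall>N::nat.
     (\<exists>n\<in>D. \<forall>i\<in>{1..s}. io i (of_nat n) \<ominus>\<^bsub>Q i\<^esub> x i \<in> V i (int N)) \<and>
     (\<exists>n. n \<notin> D \<and> (\<forall>i\<in>{1..s}. io i (of_nat n) \<ominus>\<^bsub>Q i\<^esub> x i \<in> V i (int N)))}"

definition shift :: "nat \<Rightarrow> nat \<Rightarrow> nat \<Rightarrow> (nat \<Rightarrow> padic) \<Rightarrow> nat \<Rightarrow> padic" where
  "shift k t j x = (\<lambda>i\<in>{1..s}. io i (of_nat (k ^ t)) \<otimes>\<^bsub>Q i\<^esub> x i \<oplus>\<^bsub>Q i\<^esub> io i (of_nat j))"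

lemma shift_Zb: assumes x: "x \<in> carrier (Zb s p)" shows "shift k t j x \<in> carrier (Zb s p)"
proof -
  have "io i (of_nat (k ^ t)) \<otimes>\<^bsub>Q i\<^esub> x i \<oplus>\<^bsub>Q i\<^esub> io i (of_nat j) \<in> V i 0" if i: "i \<in> {1..s}" for i
  proof -
    interpret padic "p i" using padic i .
    show ?thesis using Ov_mult[OF Ov_iota_of_nat Zb_comp[OF x i], of "k ^ t"] by (intro Ov_add) auto
  qed
  then show ?thesis by (simp add: shift_def carrier_Zb)
qed

lemma shift_diff:
  assumes x: "x \<in> carrier (Zb s p)" and i: "i \<in> {1..s}"
  shows "io i (of_nat (k ^ t * n + j)) \<ominus>\<^bsub>Q i\<^esub> shift k t j x i = io i (of_nat (k ^ t)) \<otimes>\<^bsub>Q i\<^esub> (io i (of_nat n) \<ominus>\<^bsub>Q i\<^esub> x i)"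
proof -
  interpret padic "p i" using padic i .
  have e: "io i (of_nat (k ^ t * n + j)) = io i (of_nat (k ^ t)) \<otimes>\<^bsub>Q i\<^esub> io i (of_nat n) \<oplus>\<^bsub>Q i\<^esub> io i (of_nat j)"
    by (simp only: of_nat_add of_nat_mult iota_add iota_mult)
  have "a \<otimes>\<^bsub>Q i\<^esub> c \<oplus>\<^bsub>Q i\<^esub> d \<ominus>\<^bsub>Q i\<^esub> (a \<otimes>\<^bsub>Q i\<^esub> z \<oplus>\<^bsub>Q i\<^esub> d) = a \<otimes>\<^bsub>Q i\<^esub> (c \<ominus>\<^bsub>Q i\<^esub> z)"
    if "a \<in> carrier (Q i)" "c \<in> carrier (Q i)" "d \<in> carrier (Q i)" "z \<in> carrier (Q i)" for a c d z
    using that by algebra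
  from this[OF iota_closed iota_closed iota_closed Qb_comp[OF Zb_Qb[OF x] i]]
  show ?thesis unfolding e using i by (simp only: shift_def restrict_apply if_True)
qed

lemma shift_inj:
  assumes k: "k \<ge> 1" and x: "x \<in> carrier (Zb s p)" "y \<in> carrier (Zb s p)" and e: "shift k t j x = shift k t j y"
  shows "x = y"
proof (rule Qb_eqI[OF Zb_Qb[OF x(1)] Zb_Qb[OF x(2)]])
  fix i assume i: "i \<in> {1..s}"
  interpret padic "p i" using padic i .
  have c: "x i \<in> carrier (Q i)" "y i \<in> carrier (Q i)" using Qb_comp[OF Zb_Qb i] x by auto
  have "io i (of_nat (k ^ t)) \<otimes>\<^bsub>Q i\<^esub> x i \<oplus>\<^bsub>Q i\<^esub> io i (of_nat j) = io i (of_nat (k ^ t)) \<otimes>\<^bsub>Q i\<^esub> y i \<oplus>\<^bsub>Q i\<^esub> io i (of_nat j)"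
    using fun_cong[OF e, of i] i by (simp only: shift_def restrict_apply if_True)
  then have "io i (of_nat (k ^ t)) \<otimes>\<^bsub>Q i\<^esub> x i = io i (of_nat (k ^ t)) \<otimes>\<^bsub>Q i\<^esub> y i" using c by simp
  moreover have "io i (of_nat (k ^ t)) \<noteq> \<zero>\<^bsub>Q i\<^esub>" using k by (intro iota_nonzero) simp
  ultimately show "x i = y i" using c by (simp add: Q.m_lcancel)
qed

lemma disc_shift:
  assumes "x \<in> disc {n. k ^ t * n + j \<in> D}" shows "shift k t j x \<in> disc D"
proof -
  have x: "x \<in> carrier (Zb s p)" using assms by (simp add: disc_def)
  have *: "\<forall>i\<in>{1..s}. io i (of_nat (k ^ t * n + j)) \<ominus>\<^bsub>Q i\<^esub> shift k t j x i \<in> V i (int N)"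
    if n: "\<forall>i\<in>{1..s}. io i (of_nat n) \<ominus>\<^bsub>Q i\<^esub> x i \<in> V i (int N)" for n N
  proof
    fix i assume i: "i \<in> {1..s}"
    interpret padic "p i" using padic i .
    show "io i (of_nat (k ^ t * n + j)) \<ominus>\<^bsub>Q i\<^esub> shift k t j x i \<in> V i (int N)"
      unfolding shift_diff[OF x i] using Ov_mult[OF Ov_iota_of_nat, of "io i (of_nat n) \<ominus>\<^bsub>Q i\<^esub> x i" "int N" "k ^ t"] n i by simp
  qed
  show ?thesis unfolding disc_def
  proof (intro CollectI conjI allI)
    show "shift k t j x \<in> carrier (Zb s p)" by (rule shift_Zb[OF x])
    fix N
    obtain n where "k ^ t * n + j \<in> D" "\<forall>i\<in>{1..s}. io i (of_nat n) \<ominus>\<^bsub>Q i\<^esub> x i \<in> V i (int N)"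
      using assms unfolding disc_def by blast
    then show "\<exists>n\<in>D. \<forall>i\<in>{1..s}. io i (of_nat n) \<ominus>\<^bsub>Q i\<^esub> shift k t j x i \<in> V i (int N)" using * by blast
    obtain n where "k ^ t * n + j \<notin> D" "\<forall>i\<in>{1..s}. io i (of_nat n) \<ominus>\<^bsub>Q i\<^esub> x i \<in> V i (int N)"
      using assms unfolding disc_def by blast
    then show "\<exists>n. n \<notin> D \<and> (\<forall>i\<in>{1..s}. io i (of_nat n) \<ominus>\<^bsub>Q i\<^esub> shift k t j x i \<in> V i (int N))" using * by blast
  qed
qed

end

context prime_powers
begin

lemma L_b_Ov_iff_div:
  assumes x: "x \<in> carrier (Qb s p)" and w: "\<And>i M. i \<in> {1..s} \<Longrightarrow> x i \<in> V i M \<longleftrightarrow> M \<le> w i" and i: "i \<in> {1..s}"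
  shows "L_b s p l x i \<in> V i (int (l i)) \<longleftrightarrow> (\<exists>j\<in>{1..s}. w j div int (l j) < w i div int (l i))"
proof -
  have nz: "x \<noteq> \<zero>\<^bsub>Qb s p\<^esub>"
  proof
    assume "x = \<zero>\<^bsub>Qb s p\<^esub>"
    then have "x i \<in> V i (w i + 1)" using Qb_zero(2)[OF i] padic.Ov_zero[OF padic[OF i]] by metis
    then show False using w[OF i] by simp
  qed
  have div: "int (l j) * e \<le> w j \<longleftrightarrow> e \<le> w j div int (l j)" if "j \<in> {1..s}" for j e
    using le_div_int_iff[of "int (l j)" e "w j"] l1[OF that] by simp
  have nu: "e \<le> nu x \<longleftrightarrow> (\<forall>j\<in>{1..s}. e \<le> w j div int (l j))" for e
    using nu_iff[OF x nz, of e] w div by simp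
  have "L_b s p l x i \<in> V i (int (l i)) \<longleftrightarrow> nu x + 1 \<le> w i div int (l i)"
    unfolding L_b_Ov_iff[OF x nz i] using w[OF i] div[OF i] by simp
  also have "\<dots> \<longleftrightarrow> (\<exists>j\<in>{1..s}. w j div int (l j) < w i div int (l i))"
  proof
    assume a: "nu x + 1 \<le> w i div int (l i)"
    obtain j where "j \<in> {1..s}" "\<not> nu x + 1 \<le> w j div int (l j)" using nu[of "nu x + 1"] by auto
    then show "\<exists>j\<in>{1..s}. w j div int (l j) < w i div int (l i)" using a by (intro bexI[of _ j]) auto
  next
    assume "\<exists>j\<in>{1..s}. w j div int (l j) < w i div int (l i)"
    then obtain j where j: "j \<in> {1..s}" "w j div int (l j) < w i div int (l i)" by blast
    moreover have "nu x \<le> w j div int (l j)" using nu[of "nu x"] j(1) by simp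
    ultimately show "nu x + 1 \<le> w i div int (l i)" by linarith
  qed
  finally show ?thesis .
qed

lemma disc_subset_roots:
  assumes f: "\<And>i. i \<in> {1..s} \<Longrightarrow> f i \<in> carrier (poly_ring (Q i))" "\<And>i. i \<in> {1..s} \<Longrightarrow> f i \<noteq> []" and i0: "i0 \<in> {1..s}"
  shows "disc {n. L_b s p l (eval_tuple s p f n) i0 \<in> V i0 (int (l i0))} \<subseteq> Zb_roots s p f"
proof (rule subsetI, rule ccontr)
  let ?F = "eval_tuple s p f"
  let ?D = "{n. L_b s p l (?F n) i0 \<in> V i0 (int (l i0))}"
  fix x assume x: "x \<in> disc ?D" and nr: "x \<notin> Zb_roots s p f"
  have xZ: "x \<in> carrier (Zb s p)" using x by (simp add: disc_def)
  have fs: "set (f i) \<subseteq> carrier (Q i)" if "i \<in> {1..s}" for i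
    using padic.poly_set[OF padic[OF that] f(1)[OF that]] .
  define Y where "Y = (\<lambda>i\<in>{1..s}. ring.eval (Q i) (f i) (x i))"
  have Yi: "Y i = ring.eval (Q i) (f i) (x i)" if "i \<in> {1..s}" for i using that by (simp add: Y_def)
  have Yc: "Y \<in> carrier (Qb s p)"
  proof -
    have "ring.eval (Q i) (f i) (x i) \<in> carrier (Q i)" if i: "i \<in> {1..s}" for i
    proof -
      interpret padic "p i" using padic i .
      show ?thesis by (rule Q.eval_in_carrier[OF fs[OF i] Qb_comp[OF Zb_Qb[OF xZ] i]])
    qed
    then show ?thesis by (simp add: Y_def Qb_simps)
  qed
  have Ynz: "Y \<noteq> \<zero>\<^bsub>Qb s p\<^esub>"
  proof
    assume Y0: "Y = \<zero>\<^bsub>Qb s p\<^esub>"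
    have "x i \<in> Zp_roots (p i) (f i)" if i: "i \<in> {1..s}" for i
    proof -
      interpret padic "p i" using padic i .
      have "Q.eval (f i) (x i) = \<zero>\<^bsub>Q i\<^esub>" using Y0 Yi[OF i] Qb_zero(2)[OF i] by metis
      then show ?thesis using Zb_comp[OF xZ i] Qb_comp[OF Zb_Qb[OF xZ] i] f(2)[OF i]
        by (simp add: Zp_roots_def carrier_Zp Q.is_root_def)
    qed
    then have "x \<in> Zb_roots s p f" using xZ by (simp add: Zb_roots_def carrier_Zb PiE_iff)
    then show False using nr by contradiction
  qed
  define K where "K = (\<lambda>i. int (l i) * (nu Y + 1))"
  have "\<exists>N::nat. \<forall>n. io i (of_nat n) \<ominus>\<^bsub>Q i\<^esub> x i \<in> V i (int N) \<longrightarrow> ?F n i \<ominus>\<^bsub>Q i\<^esub> Y i \<in> V i (K i)" if i: "i \<in> {1..s}" for i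
  proof -
    interpret padic "p i" using padic i .
    obtain C where C: "\<And>x y N. x \<in> Ov 0 \<Longrightarrow> y \<in> Ov 0 \<Longrightarrow> x \<ominus>\<^bsub>Q i\<^esub> y \<in> Ov (N + C) \<Longrightarrow> Q.eval (f i) x \<ominus>\<^bsub>Q i\<^esub> Q.eval (f i) y \<in> Ov N"
      using eval_continuous[OF fs[OF i]] by blast
    have "?F n i \<ominus>\<^bsub>Q i\<^esub> Y i \<in> V i (K i)" if n: "io i (of_nat n) \<ominus>\<^bsub>Q i\<^esub> x i \<in> V i (int (nat (K i + C)))" for n
    proof -
      have "io i (of_nat n) \<ominus>\<^bsub>Q i\<^esub> x i \<in> V i (K i + C)" using n by (rule Ov_mono) simp
      then have "Q.eval (f i) (io i (of_nat n)) \<ominus>\<^bsub>Q i\<^esub> Q.eval (f i) (x i) \<in> V i (K i)"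
        by (intro C Zb_comp[OF xZ i] Ov_iota_of_nat)
      then show ?thesis using i by (simp add: eval_tuple_def Y_def)
    qed
    then show ?thesis by blast
  qed
  then obtain N where N: "\<And>i n. i \<in> {1..s} \<Longrightarrow> io i (of_nat n) \<ominus>\<^bsub>Q i\<^esub> x i \<in> V i (int (N i)) \<Longrightarrow> ?F n i \<ominus>\<^bsub>Q i\<^esub> Y i \<in> V i (K i)"
    by metis
  define M where "M = (\<Sum>i\<in>{1..s}. N i)"
  have NM: "N i \<le> M" if "i \<in> {1..s}" for i unfolding M_def using that by (intro member_le_sum) auto
  have *: "n \<in> ?D \<longleftrightarrow> Y i0 \<in> V i0 (K i0)" if n: "\<forall>i\<in>{1..s}. io i (of_nat n) \<ominus>\<^bsub>Q i\<^esub> x i \<in> V i (int M)" for n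
  proof -
    have Fc: "?F n \<in> carrier (Qb s p)" by (rule eval_tuple_Qb[OF fs])
    have near: "?F n i \<in> V i (int (l i) * e) \<longleftrightarrow> Y i \<in> V i (int (l i) * e)" if i: "i \<in> {1..s}" and e: "e \<le> nu Y + 1" for i e
    proof -
      interpret padic "p i" using padic i .
      have "io i (of_nat n) \<ominus>\<^bsub>Q i\<^esub> x i \<in> V i (int M)" using n i by blast
      then have "io i (of_nat n) \<ominus>\<^bsub>Q i\<^esub> x i \<in> V i (int (N i))" by (rule Ov_mono) (use NM[OF i] in simp)
      then have "?F n i \<ominus>\<^bsub>Q i\<^esub> Y i \<in> V i (K i)" by (rule N[OF i])
      then have "?F n i \<ominus>\<^bsub>Q i\<^esub> Y i \<in> V i (int (l i) * e)"
        by (rule Ov_mono) (use e in \<open>simp add: K_def mult_left_mono\<close>)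
      then show ?thesis by (rule Ov_cong[OF Qb_comp[OF Fc i] Qb_comp[OF Yc i]])
    qed
    have Fnz: "?F n \<noteq> \<zero>\<^bsub>Qb s p\<^esub>"
    proof
      assume F0: "?F n = \<zero>\<^bsub>Qb s p\<^esub>"
      have "Y i \<in> V i (int (l i) * (nu Y + 1))" if i: "i \<in> {1..s}" for i
        using near[OF i order_refl] F0 Qb_zero(2)[OF i] padic.Ov_zero[OF padic[OF i]] by metis
      then have "nu Y + 1 \<le> nu Y" using nu_iff[OF Yc Ynz] by blast
      then show False by simp
    qed
    have "e \<le> nu (?F n) \<longleftrightarrow> e \<le> nu Y" if e: "e \<le> nu Y + 1" for e
      using nu_iff[OF Fc Fnz, of e] nu_iff[OF Yc Ynz, of e] near[OF _ e] by simp
    from this[of "nu Y"] this[of "nu Y + 1"] have "nu (?F n) = nu Y" by simp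
    then show ?thesis using L_b_Ov_iff[OF Fc Fnz i0] near[OF i0 order_refl] by (simp add: K_def)
  qed
  obtain n where "n \<in> ?D" "\<forall>i\<in>{1..s}. io i (of_nat n) \<ominus>\<^bsub>Q i\<^esub> x i \<in> V i (int M)"
    using x unfolding disc_def by blast
  moreover obtain n' where "n' \<notin> ?D" "\<forall>i\<in>{1..s}. io i (of_nat n') \<ominus>\<^bsub>Q i\<^esub> x i \<in> V i (int M)"
    using x unfolding disc_def by blast
  ultimately show False using * by blast
qed

lemma finite_Zb_roots:
  assumes f: "\<And>i. i \<in> {1..s} \<Longrightarrow> f i \<in> carrier (poly_ring (Q i))"
  shows "finite (Zb_roots s p f)"
  unfolding Zb_roots_def
proof (rule finite_PiE)
  fix i assume i: "i \<in> {1..s}"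
  interpret padic "p i" using padic i .
  have "finite {x. Q.is_root (f i) x}" by (rule Q.finite_number_of_roots[OF f[OF i]])
  then show "finite (Zp_roots (p i) (f i))" by (rule finite_subset[rotated]) (auto simp: Zp_roots_def)
qed simp

end

text \<open>The assumption \<open>loc\<close> says that \<open>v(f\<^sub>i(x)) = m\<^sub>i v(x - \<theta>\<^sub>i) + c\<^sub>i\<close> for \<open>x\<close> close to \<open>\<theta>\<^sub>i\<close>.\<close>

locale near_root = prime_powers s p l for s :: nat and p l :: "nat \<Rightarrow> nat" +
  fixes f :: "nat \<Rightarrow> padic list" and \<theta> :: "nat \<Rightarrow> padic" and m N :: "nat \<Rightarrow> nat" and c :: "nat \<Rightarrow> int"
    and k :: nat and e :: "nat \<Rightarrow> nat" and i0 :: nat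
  assumes s2: "s \<ge> 2" and f: "\<And>i. i \<in> {1..s} \<Longrightarrow> f i \<in> carrier (poly_ring (Q i))" "\<And>i. i \<in> {1..s} \<Longrightarrow> f i \<noteq> []"
    and \<theta>: "\<theta> \<in> Zb_roots s p f"
    and m_def: "m = (\<lambda>i. ring.alg_mult (Q i) (f i) (\<theta> i))"
    and loc: "\<And>i x M. i \<in> {1..s} \<Longrightarrow> x \<in> V i 0 \<Longrightarrow> x \<ominus>\<^bsub>Q i\<^esub> \<theta> i \<in> V i (int (N i)) \<Longrightarrow>
      ring.eval (Q i) (f i) x \<in> V i M \<longleftrightarrow> x = \<theta> i \<or> M \<le> int (m i) * padic.pv (p i) (x \<ominus>\<^bsub>Q i\<^esub> \<theta> i) + c i"
    and k: "k \<ge> 2" and reg: "k_regular (Zb s p) k (\<lambda>n. L_b s p l (eval_tuple s p f n))"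
    and e_def: "e = (\<lambda>i. multiplicity (p i) k)" and i0: "i0 \<in> {1..s}"
begin

abbreviation F :: "nat \<Rightarrow> nat \<Rightarrow> padic" where "F \<equiv> eval_tuple s p f"

definition D :: "nat set" where "D = {n. L_b s p l (F n) i0 \<in> V i0 (int (l i0))}"

definition W :: "nat \<Rightarrow> nat \<Rightarrow> nat \<Rightarrow> int" where "W i t E = int (m i) * (int t * int (e i) + int E) + c i"

lemma f_set: "i \<in> {1..s} \<Longrightarrow> set (f i) \<subseteq> carrier (Q i)"
  using padic.poly_set[OF padic f(1)] by blast

lemma F_closed: "F n \<in> carrier (Qb s p)" by (rule eval_tuple_Qb[OF f_set])

lemma theta_Zb: "\<theta> \<in> carrier (Zb s p)"
proof -
  have "\<theta> i \<in> V i 0" if i: "i \<in> {1..s}" for i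
    using \<theta> i padic.carrier_Zp[OF padic[OF i]] by (auto simp: Zb_roots_def Zp_roots_def)
  moreover have "\<theta> \<in> extensional {1..s}" using \<theta> unfolding Zb_roots_def PiE_iff by blast
  ultimately show ?thesis unfolding carrier_Zb PiE_iff by blast
qed

lemma m1: assumes i: "i \<in> {1..s}" shows "m i \<ge> 1"
proof -
  have "\<theta> i \<in> Zp_roots (p i) (f i)" using \<theta> i unfolding Zb_roots_def PiE_iff by blast
  from padic.root_local(1)[OF padic[OF i] f(1)[OF i] this] show ?thesis by (simp add: m_def)
qed

lemma rat_val_k: "i \<in> {1..s} \<Longrightarrow> rat_val (p i) (of_nat (k ^ t)) = int t * int (e i)"
  using rat_val_power[OF primes, of i "of_nat k" t] rat_val_of_nat[OF primes, of i k] k by (simp add: e_def)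

lemma F_shift:
  assumes x: "x \<in> carrier (Zb s p)" "shift k t j x = \<theta>"
    and n: "\<And>i. i \<in> {1..s} \<Longrightarrow> io i (of_nat n) \<ominus>\<^bsub>Q i\<^esub> x i \<noteq> \<zero>\<^bsub>Q i\<^esub> \<and>
      padic.pv (p i) (io i (of_nat n) \<ominus>\<^bsub>Q i\<^esub> x i) = int (E i)"
    and E: "\<And>i. i \<in> {1..s} \<Longrightarrow> E i \<ge> N i" and i: "i \<in> {1..s}"
  shows "F (k ^ t * n + j) i \<in> V i M \<longleftrightarrow> M \<le> W i t (E i)"
proof -
  interpret padic "p i" using padic i .
  let ?y = "io i (of_nat (k ^ t * n + j))" and ?d = "io i (of_nat n) \<ominus>\<^bsub>Q i\<^esub> x i"
  have xc: "x i \<in> carrier (Q i)" using Qb_comp[OF Zb_Qb[OF x(1)] i] .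
  have d: "?d \<in> carrier (Q i)" "?d \<noteq> \<zero>\<^bsub>Q i\<^esub>" "pv ?d = int (E i)" using xc n[OF i] by auto
  have k0: "(of_nat (k ^ t) :: rat) \<noteq> 0" using k by simp
  have yd: "?y \<ominus>\<^bsub>Q i\<^esub> \<theta> i = io i (of_nat (k ^ t)) \<otimes>\<^bsub>Q i\<^esub> ?d" using shift_diff[OF x(1) i, of k t n j] unfolding x(2) .
  have nz: "?y \<ominus>\<^bsub>Q i\<^esub> \<theta> i \<noteq> \<zero>\<^bsub>Q i\<^esub>" unfolding yd using d iota_nonzero[OF k0] by (simp add: Q.integral_iff)
  have pvy: "pv (?y \<ominus>\<^bsub>Q i\<^esub> \<theta> i) = int t * int (e i) + int (E i)"
    unfolding yd pv_mult[OF iota_closed d(1) iota_nonzero[OF k0] d(2)] pv_iota[OF k0] rat_val_k[OF i] d(3) ..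
  have thc: "\<theta> i \<in> carrier (Q i)" using Qb_comp[OF Zb_Qb[OF theta_Zb] i] .
  have "?y \<noteq> \<theta> i" using nz thc by (auto simp: Q.minus_eq Q.r_neg)
  moreover have "int (N i) \<le> int t * int (e i) + int (E i)" using E[OF i] by (simp add: add_increasing)
  then have "?y \<ominus>\<^bsub>Q i\<^esub> \<theta> i \<in> V i (int (N i))"
    using Ov_pv[of "?y \<ominus>\<^bsub>Q i\<^esub> \<theta> i" "int (N i)"] thc nz pvy by simp
  ultimately show ?thesis using loc[OF i Ov_iota_of_nat, of "k ^ t * n + j" M] pvy i
    by (simp only: eval_tuple_def W_def restrict_apply if_True) simp
qed

lemma D_shift_iff:
  assumes x: "x \<in> carrier (Zb s p)" "shift k t j x = \<theta>"
    and n: "\<And>i. i \<in> {1..s} \<Longrightarrow> io i (of_nat n) \<ominus>\<^bsub>Q i\<^esub> x i \<noteq> \<zero>\<^bsub>Q i\<^esub> \<and>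
      padic.pv (p i) (io i (of_nat n) \<ominus>\<^bsub>Q i\<^esub> x i) = int (E i)"
    and E: "\<And>i. i \<in> {1..s} \<Longrightarrow> E i \<ge> N i"
  shows "k ^ t * n + j \<in> D \<longleftrightarrow> (\<exists>i\<in>{1..s}. W i t (E i) div int (l i) < W i0 t (E i0) div int (l i0))"
  unfolding D_def mem_Collect_eq
  by (rule L_b_Ov_iff_div[OF F_closed F_shift[OF x n E] i0])

lemma W_large: assumes i: "i \<in> {1..s}" and E: "int E \<ge> int (l i) * \<bar>B\<bar> + \<bar>c i\<bar>" shows "B \<le> W i t E div int (l i)"
proof -
  have "int E \<le> int t * int (e i) + int E" by simp
  also have "\<dots> \<le> int (m i) * (int t * int (e i) + int E)"
    using mult_right_mono[of 1 "int (m i)" "int t * int (e i) + int E"] m1[OF i] by simp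
  finally have "int (l i) * \<bar>B\<bar> \<le> W i t E" using E by (simp add: W_def)
  moreover have "int (l i) * B \<le> int (l i) * \<bar>B\<bar>" by (intro mult_left_mono) auto
  ultimately have "int (l i) * B \<le> W i t E" by linarith
  then show ?thesis using le_div_int_iff[of "int (l i)" B "W i t E"] l1[OF i] by simp
qed

lemma shift_in_disc:
  assumes x: "x \<in> carrier (Zb s p)" "shift k t j x = \<theta>"
  shows "x \<in> disc {n. k ^ t * n + j \<in> D}"
proof -
  have "(\<exists>n\<in>{n. k ^ t * n + j \<in> D}. \<forall>i\<in>{1..s}. io i (of_nat n) \<ominus>\<^bsub>Q i\<^esub> x i \<in> V i (int K))
     \<and> (\<exists>n. n \<notin> {n. k ^ t * n + j \<in> D} \<and> (\<forall>i\<in>{1..s}. io i (of_nat n) \<ominus>\<^bsub>Q i\<^esub> x i \<in> V i (int K)))" for K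
  proof
    have near: "\<forall>i\<in>{1..s}. io i (of_nat n) \<ominus>\<^bsub>Q i\<^esub> x i \<in> V i (int K)"
      if n: "\<And>i. i \<in> {1..s} \<Longrightarrow> io i (of_nat n) \<ominus>\<^bsub>Q i\<^esub> x i \<noteq> \<zero>\<^bsub>Q i\<^esub> \<and> padic.pv (p i) (io i (of_nat n) \<ominus>\<^bsub>Q i\<^esub> x i) = int (E i)"
        and E: "\<And>i. i \<in> {1..s} \<Longrightarrow> E i \<ge> K" for n E
    proof
      fix i assume i: "i \<in> {1..s}"
      interpret padic "p i" using padic i .
      show "io i (of_nat n) \<ominus>\<^bsub>Q i\<^esub> x i \<in> V i (int K)"
        using Ov_pv[of "io i (of_nat n) \<ominus>\<^bsub>Q i\<^esub> x i" "int K"] n[OF i] E[OF i] Qb_comp[OF Zb_Qb[OF x(1)] i] by simp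
    qed
    define i1 :: nat where "i1 = (if i0 = 1 then 2 else 1)"
    have i1: "i1 \<in> {1..s}" "i1 \<noteq> i0" using s2 by (auto simp: i1_def)
    define A where "A = (\<lambda>i. N i + K)"
    define B where "B = \<bar>W i1 t (A i1) div int (l i1)\<bar> + 1"
    define E where "E = A(i0 := A i0 + nat (int (l i0) * \<bar>B\<bar> + \<bar>c i0\<bar>))"
    have E: "E i \<ge> N i" "E i \<ge> K" for i by (auto simp: E_def A_def)
    obtain n where n: "\<And>i. i \<in> {1..s} \<Longrightarrow> io i (of_nat n) \<ominus>\<^bsub>Q i\<^esub> x i \<noteq> \<zero>\<^bsub>Q i\<^esub> \<and>
      padic.pv (p i) (io i (of_nat n) \<ominus>\<^bsub>Q i\<^esub> x i) = int (E i)"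
      using exact_approximation[OF x(1), of E] by blast
    have Bup: "B \<le> W i0 t (E i0) div int (l i0)" by (rule W_large[OF i0]) (simp add: E_def)
    have Blow: "W i1 t (E i1) div int (l i1) < B" using i1(2) unfolding B_def E_def by auto
    have iff: "k ^ t * n + j \<in> D \<longleftrightarrow> (\<exists>i\<in>{1..s}. W i t (E i) div int (l i) < W i0 t (E i0) div int (l i0))"
      by (rule D_shift_iff[OF x n E(1)])
    from Blow Bup have "W i1 t (E i1) div int (l i1) < W i0 t (E i0) div int (l i0)" by linarith
    then have "k ^ t * n + j \<in> D" unfolding iff by (rule bexI[OF _ i1(1)])
    then show "\<exists>n\<in>{n. k ^ t * n + j \<in> D}. \<forall>i\<in>{1..s}. io i (of_nat n) \<ominus>\<^bsub>Q i\<^esub> x i \<in> V i (int K)"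
      using near[OF n E(2)] by (intro bexI[of _ n]) simp_all
    define B' where "B' = W i0 t (A i0) div int (l i0)"
    define E' where "E' = (\<lambda>i. A i + (if i = i0 then 0 else nat (int (l i) * \<bar>B'\<bar> + \<bar>c i\<bar>)))"
    have E': "E' i \<ge> N i" "E' i \<ge> K" for i by (auto simp: E'_def A_def)
    obtain n' where n': "\<And>i. i \<in> {1..s} \<Longrightarrow> io i (of_nat n') \<ominus>\<^bsub>Q i\<^esub> x i \<noteq> \<zero>\<^bsub>Q i\<^esub> \<and>
      padic.pv (p i) (io i (of_nat n') \<ominus>\<^bsub>Q i\<^esub> x i) = int (E' i)"
      using exact_approximation[OF x(1), of E'] by blast
    have Wge: "B' \<le> W i t (E' i) div int (l i)" if i: "i \<in> {1..s}" for i
    proof (cases "i = i0")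
      case True
      then show ?thesis by (simp add: B'_def E'_def)
    next
      case False
      then show ?thesis by (intro W_large[OF i]) (simp add: E'_def)
    qed
    have W0: "W i0 t (E' i0) div int (l i0) = B'" by (simp add: B'_def E'_def)
    have iff': "k ^ t * n' + j \<in> D \<longleftrightarrow> (\<exists>i\<in>{1..s}. W i t (E' i) div int (l i) < W i0 t (E' i0) div int (l i0))"
      by (rule D_shift_iff[OF x n' E'(1)])
    have "k ^ t * n' + j \<notin> D" unfolding iff' W0 using Wge by (simp add: not_less)
    then show "\<exists>n. n \<notin> {n. k ^ t * n + j \<in> D} \<and> (\<forall>i\<in>{1..s}. io i (of_nat n) \<ominus>\<^bsub>Q i\<^esub> x i \<in> V i (int K))"
      using near[OF n' E'(2)] by (intro exI[of _ n']) simp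
  qed
  then show ?thesis using x(1) unfolding disc_def by blast
qed

definition Pts :: "(nat \<Rightarrow> padic) set" where
  "Pts = {x \<in> carrier (Zb s p). \<exists>t j. j < k ^ t \<and> shift k t j x = \<theta>}"

definition Ds :: "nat set set" where "Ds = {{n. k ^ t * n + j \<in> D} | t j. j < k ^ t}"

lemma finite_Ds: "finite Ds"
proof -
  have "finite {{n. L_b s p l (F (k ^ t * n + j)) i0 \<in> V i0 (int (l i0))} | t j. j < k ^ t}"
    using finite_kernel_sets[OF reg L_b_Zb[OF F_closed] _ i0] k by simp
  then show ?thesis by (simp add: Ds_def D_def)
qed

lemma finite_Pts: "finite Pts"
proof (rule finite_subset)
  show "Pts \<subseteq> (\<Union>E\<in>Ds. disc E)"
  proof
    fix x assume "x \<in> Pts"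
    then obtain t j where tj: "x \<in> carrier (Zb s p)" "j < k ^ t" "shift k t j x = \<theta>" by (auto simp: Pts_def)
    then show "x \<in> (\<Union>E\<in>Ds. disc E)" using shift_in_disc[OF tj(1,3)] by (auto simp: Ds_def)
  qed
  have "finite (disc E)" if E: "E \<in> Ds" for E
  proof -
    obtain t j where tj: "E = {n. k ^ t * n + j \<in> D}" using E by (auto simp: Ds_def)
    have sub: "shift k t j ` disc E \<subseteq> Zb_roots s p f"
      using disc_shift[of _ k t j D] disc_subset_roots[OF f i0] unfolding tj D_def by blast
    have "inj_on (shift k t j) (disc E)"
    proof (rule inj_onI)
      fix x y assume xy: "x \<in> disc E" "y \<in> disc E" and eq: "shift k t j x = shift k t j y"
      have "x \<in> carrier (Zb s p)" "y \<in> carrier (Zb s p)" using xy unfolding disc_def by blast+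
      moreover have "k \<ge> 1" using k by simp
      ultimately show "x = y" using shift_inj eq by blast
    qed
    then show ?thesis using finite_imageD[OF finite_subset[OF sub finite_Zb_roots[OF f(1)]]] by simp
  qed
  then show "finite (\<Union>E\<in>Ds. disc E)" using finite_Ds by simp
qed

end

lemma infinite_nat_ex_ge: "infinite (T :: nat set) \<Longrightarrow> \<exists>t\<in>T. t \<ge> B"
  by (meson infinite_nat_iff_unbounded_le)

lemma slope_le:
  fixes a0 a1 b0 b1 l0 l1 :: int
  assumes T: "infinite (T :: nat set)" and l: "l0 > 0" "l1 > 0"
    and le: "\<And>t. t \<in> T \<Longrightarrow> (int t * a0 + b0) div l0 \<le> (int t * a1 + b1) div l1"
  shows "a0 * l1 \<le> a1 * l0"
proof (rule ccontr)
  assume "\<not> ?thesis"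
  then have gt: "a0 * l1 - a1 * l0 \<ge> 1" by simp
  define B where "B = \<bar>b1 * l0 - b0 * l1 + l0 * l1\<bar> + 1"
  obtain t where t: "t \<in> T" "t \<ge> nat B" using infinite_nat_ex_ge[OF T] by blast
  define u v where "u = int t * a0 + b0" and "v = int t * a1 + b1"
  have "u - l0 < l0 * (u div l0)" using l(1) pos_mod_bound[OF l(1), of u] mult_div_mod_eq[of l0 u] by linarith
  then have "(u - l0) * l1 < l0 * (u div l0) * l1" using l(2) by simp
  also have "\<dots> \<le> l0 * (v div l1) * l1" using le[OF t(1)] l by (simp add: u_def v_def)
  also have "\<dots> = l0 * (l1 * (v div l1))" by simp
  also have "\<dots> \<le> l0 * v"
  proof (rule mult_left_mono)
    show "l1 * (v div l1) \<le> v" using pos_mod_sign[OF l(2), of v] mult_div_mod_eq[of l1 v] by linarith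
  qed (use l in simp)
  finally have "int t * (a0 * l1 - a1 * l0) < b1 * l0 - b0 * l1 + l0 * l1"
    by (simp add: u_def v_def algebra_simps)
  moreover have "int t \<le> int t * (a0 * l1 - a1 * l0)" using gt mult_left_mono[of 1 "a0 * l1 - a1 * l0" "int t"] by simp
  moreover have "B \<le> int t" using t(2) by linarith
  ultimately show False by (simp add: B_def)
qed

context near_root
begin

lemma kp_dvd: "i \<in> {1..s} \<Longrightarrow> p i ^ e i dvd k" by (simp add: e_def multiplicity_dvd)

lemma ex_point:
  assumes j: "\<And>i. i \<in> {1..s} \<Longrightarrow> \<theta> i \<ominus>\<^bsub>Q i\<^esub> io i (of_nat j) \<in> V i (int t * int (e i))" and jk: "j < k ^ t"
  shows "\<exists>x\<in>Pts. shift k t j x = \<theta>"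
proof -
  define x where "x = (\<lambda>i\<in>{1..s}. io i (inverse (of_nat (k ^ t))) \<otimes>\<^bsub>Q i\<^esub> (\<theta> i \<ominus>\<^bsub>Q i\<^esub> io i (of_nat j)))"
  have k0: "(of_nat (k ^ t) :: rat) \<noteq> 0" using k by simp
  have xi: "x i \<in> V i 0 \<and> io i (of_nat (k ^ t)) \<otimes>\<^bsub>Q i\<^esub> x i \<oplus>\<^bsub>Q i\<^esub> io i (of_nat j) = \<theta> i" if i: "i \<in> {1..s}" for i
  proof -
    interpret padic "p i" using padic i .
    have thc: "\<theta> i \<in> carrier (Q i)" using Qb_comp[OF Zb_Qb[OF theta_Zb] i] .
    let ?d = "\<theta> i \<ominus>\<^bsub>Q i\<^esub> io i (of_nat j)"
    have dc: "?d \<in> carrier (Q i)" using thc by simp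
    have xe: "x i = io i (inverse (of_nat (k ^ t))) \<otimes>\<^bsub>Q i\<^esub> ?d" using i by (simp add: x_def)
    have "x i \<in> V i 0" unfolding xe
      using iota_scale[of "inverse (of_nat (k ^ t))" ?d 0] k0 dc j[OF i] rat_val_inverse[OF prime k0] rat_val_k[OF i, of t] by simp
    moreover have "io i (of_nat (k ^ t)) \<otimes>\<^bsub>Q i\<^esub> x i = ?d"
    proof -
      have "io i (of_nat (k ^ t)) \<otimes>\<^bsub>Q i\<^esub> x i = (io i (of_nat (k ^ t)) \<otimes>\<^bsub>Q i\<^esub> io i (inverse (of_nat (k ^ t)))) \<otimes>\<^bsub>Q i\<^esub> ?d"
        unfolding xe using dc by (simp add: Q.m_assoc)
      also have "\<dots> = io i 1 \<otimes>\<^bsub>Q i\<^esub> ?d" unfolding iota_mult[symmetric] right_inverse[OF k0] ..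
      finally show ?thesis using dc by (simp add: iota_1)
    qed
    moreover have "?d \<oplus>\<^bsub>Q i\<^esub> io i (of_nat j) = \<theta> i"
    proof -
      have "(a \<ominus>\<^bsub>Q i\<^esub> z) \<oplus>\<^bsub>Q i\<^esub> z = a" if "a \<in> carrier (Q i)" "z \<in> carrier (Q i)" for a z using that by algebra
      then show ?thesis using thc by simp
    qed
    ultimately show ?thesis by simp
  qed
  have xZ: "x \<in> carrier (Zb s p)" using xi by (simp add: carrier_Zb PiE_iff x_def)
  have "shift k t j x = \<theta>"
  proof (rule Qb_eqI[OF Zb_Qb[OF shift_Zb[OF xZ]] Zb_Qb[OF theta_Zb]])
    fix i assume i: "i \<in> {1..s}"
    show "shift k t j x i = \<theta> i" using xi[OF i] i by (simp only: shift_def restrict_apply if_True)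
  qed
  then show ?thesis using xZ jk unfolding Pts_def by blast
qed

lemma approx_theta:
  "\<exists>j. \<forall>i\<in>{1..s}. \<theta> i \<ominus>\<^bsub>Q i\<^esub> io i (of_nat j) \<in> V i (int t * int (e i))"
proof -
  obtain j where j: "\<And>i. i \<in> {1..s} \<Longrightarrow> io i (of_nat j) \<ominus>\<^bsub>Q i\<^esub> \<theta> i \<noteq> \<zero>\<^bsub>Q i\<^esub> \<and>
    padic.pv (p i) (io i (of_nat j) \<ominus>\<^bsub>Q i\<^esub> \<theta> i) = int (t * e i)"
    using exact_approximation[OF theta_Zb, of "\<lambda>i. t * e i"] by blast
  have "\<theta> i \<ominus>\<^bsub>Q i\<^esub> io i (of_nat j) \<in> V i (int t * int (e i))" if i: "i \<in> {1..s}" for i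
  proof -
    interpret padic "p i" using padic i .
    have thc: "\<theta> i \<in> carrier (Q i)" using Qb_comp[OF Zb_Qb[OF theta_Zb] i] .
    have "io i (of_nat j) \<ominus>\<^bsub>Q i\<^esub> \<theta> i \<in> V i (int t * int (e i))"
      using Ov_pv[of "io i (of_nat j) \<ominus>\<^bsub>Q i\<^esub> \<theta> i"] j[OF i] thc by simp
    then show ?thesis using Ov_diff_commute[OF thc iota_closed] by blast
  qed
  then show ?thesis by blast
qed

lemma approx_theta_mod:
  assumes j: "\<forall>i\<in>{1..s}. \<theta> i \<ominus>\<^bsub>Q i\<^esub> io i (of_nat j) \<in> V i (int t * int (e i))"
    and j': "[j = j'] (mod (\<Prod>i=1..s. p i ^ e i) ^ t)"
  shows "\<forall>i\<in>{1..s}. \<theta> i \<ominus>\<^bsub>Q i\<^esub> io i (of_nat j') \<in> V i (int t * int (e i))"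
proof
  fix i assume i: "i \<in> {1..s}"
  interpret padic "p i" using padic i .
  have thc: "\<theta> i \<in> carrier (Q i)" using Qb_comp[OF Zb_Qb[OF theta_Zb] i] .
  have "p i ^ e i dvd (\<Prod>i=1..s. p i ^ e i)" using i by (intro dvd_prodI) auto
  then have "(p i ^ e i) ^ t dvd (\<Prod>i=1..s. p i ^ e i) ^ t" by (rule dvd_power_same)
  then have "[j = j'] (mod (p i ^ e i) ^ t)" using j' cong_dvd_modulus_nat by blast
  then have "[j = j'] (mod p i ^ (t * e i))" by (simp only: power_mult[symmetric] mult.commute)
  then have "io i (of_nat j) \<ominus>\<^bsub>Q i\<^esub> io i (of_nat j') \<in> V i (int (t * e i))" unfolding iota_diff_Ov .
  then show "\<theta> i \<ominus>\<^bsub>Q i\<^esub> io i (of_nat j') \<in> V i (int t * int (e i))"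
    using Ov_diff_trans[OF thc iota_closed iota_closed, of "of_nat j" "int t * int (e i)"] j i by simp
qed

lemma shift_inj_j:
  assumes x: "x \<in> carrier (Zb s p)" and eq: "shift k t j x = shift k t j' x" shows "j = j'"
proof -
  obtain i where i: "i \<in> {1..s}" using s2 by force
  interpret padic "p i" using padic i .
  have c: "io i (of_nat (k ^ t)) \<otimes>\<^bsub>Q i\<^esub> x i \<in> carrier (Q i)" using Qb_comp[OF Zb_Qb[OF x] i] by simp
  have "io i (of_nat (k ^ t)) \<otimes>\<^bsub>Q i\<^esub> x i \<oplus>\<^bsub>Q i\<^esub> io i (of_nat j) = io i (of_nat (k ^ t)) \<otimes>\<^bsub>Q i\<^esub> x i \<oplus>\<^bsub>Q i\<^esub> io i (of_nat j')"
    using fun_cong[OF eq, of i] i by (simp only: shift_def restrict_apply if_True)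
  then have "io i (of_nat j) = io i (of_nat j')" by (metis Q.add.l_cancel c iota_closed)
  then show ?thesis by (simp add: iota_inj)
qed

text \<open>A prime divisor of \<open>k\<close> outside \<open>p\<^sub>1, \<dots>, p\<^sub>s\<close> would leave several choices for the digits \<open>j\<close>,
  hence too many points.\<close>

lemma k_factorization: "k = (\<Prod>i=1..s. p i ^ e i)"
proof -
  define M where "M = (\<Prod>i=1..s. p i ^ e i)"
  have M0: "M > 0" unfolding M_def using p_pos by (intro prod_pos) simp
  have "int M dvd int k" unfolding M_def
  proof (rule prod_dvd_if_all_dvd)
    fix i assume "i \<in> {1..s}"
    from kp_dvd[OF this] show "int (p i) ^ e i dvd int k" by (simp flip: of_nat_power)
  qed
  then obtain d where d: "k = M * d" by (auto elim: dvdE)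
  have "d = 1"
  proof (rule ccontr)
    assume "d \<noteq> 1"
    then have d2: "d \<ge> 2" using d k by (cases "d = 0") auto
    define t where "t = card Pts"
    obtain j0 where j0: "\<forall>i\<in>{1..s}. \<theta> i \<ominus>\<^bsub>Q i\<^esub> io i (of_nat j0) \<in> V i (int t * int (e i))"
      using approx_theta[of t] by blast
    define j where "j u = j0 mod M ^ t + M ^ t * u" for u
    have "\<exists>x\<in>Pts. shift k t (j u) x = \<theta>" if u: "u < d ^ t" for u
    proof (rule ex_point)
      have "[j0 = j u] (mod M ^ t)" by (simp add: j_def cong_def)
      then show "\<theta> i \<ominus>\<^bsub>Q i\<^esub> io i (of_nat (j u)) \<in> V i (int t * int (e i))" if "i \<in> {1..s}" for i
        using approx_theta_mod[OF j0, of "j u"] that unfolding M_def by blast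
      have "j0 mod M ^ t < M ^ t" using M0 by simp
      then have "j u < M ^ t * (u + 1)" by (simp add: j_def)
      also have "\<dots> \<le> M ^ t * d ^ t" using u by (intro mult_left_mono) auto
      finally show "j u < k ^ t" by (simp add: d power_mult_distrib)
    qed
    then obtain x where x: "\<And>u. u < d ^ t \<Longrightarrow> x u \<in> Pts \<and> shift k t (j u) (x u) = \<theta>" by metis
    have "inj_on x {..<d ^ t}"
    proof (rule inj_onI)
      fix u v assume uv: "u \<in> {..<d ^ t}" "v \<in> {..<d ^ t}" "x u = x v"
      have xZ: "x u \<in> carrier (Zb s p)" using x[of u] uv(1) unfolding Pts_def by blast
      have "shift k t (j u) (x u) = shift k t (j v) (x u)" using x[of u] x[of v] uv by simp
      then have "j u = j v" by (rule shift_inj_j[OF xZ])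
      then show "u = v" using M0 by (simp add: j_def)
    qed
    moreover have "x ` {..<d ^ t} \<subseteq> Pts" using x by blast
    ultimately have "card {..<d ^ t} \<le> card Pts" by (rule card_inj_on_le) (rule finite_Pts)
    then have "d ^ t \<le> t" by (simp add: t_def)
    moreover have "(2::nat) ^ t \<le> d ^ t" using d2 by (rule power_mono) simp
    ultimately show False using less_exp[of t] by linarith
  qed
  then show ?thesis using d by (simp add: M_def)
qed

lemma infinite_recurrence:
  "\<exists>y D' T j. y \<in> carrier (Zb s p) \<and> infinite T \<and>
    (\<forall>t\<in>T. j t < k ^ t \<and> shift k t (j t) y = \<theta> \<and> {n. k ^ t * n + j t \<in> D} = D')"
proof -
  have "\<exists>j x. j < k ^ t \<and> x \<in> Pts \<and> shift k t j x = \<theta>" for t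
  proof -
    obtain j0 where j0: "\<forall>i\<in>{1..s}. \<theta> i \<ominus>\<^bsub>Q i\<^esub> io i (of_nat j0) \<in> V i (int t * int (e i))"
      using approx_theta[of t] by blast
    have c: "[j0 = j0 mod k ^ t] (mod (\<Prod>i=1..s. p i ^ e i) ^ t)"
      unfolding k_factorization[symmetric] by (simp add: cong_def)
    have lt: "j0 mod k ^ t < k ^ t" using k by simp
    have "\<exists>x\<in>Pts. shift k t (j0 mod k ^ t) x = \<theta>"
      by (rule ex_point[OF _ lt]) (use approx_theta_mod[OF j0 c] in blast)
    then show ?thesis using lt by blast
  qed
  then obtain j x where jx: "\<And>t. j t < k ^ t \<and> x t \<in> Pts \<and> shift k t (j t) (x t) = \<theta>" by metis
  define h where "h t = (x t, {n. k ^ t * n + j t \<in> D})" for t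
  have "range h \<subseteq> Pts \<times> Ds" using jx unfolding h_def Ds_def by blast
  then have fin: "finite (range h)" by (rule finite_subset) (simp add: finite_Pts finite_Ds)
  obtain t0 where inf: "infinite {t \<in> UNIV. h t = h t0}"
    using pigeonhole_infinite[OF infinite_UNIV_nat fin] by blast
  show ?thesis
  proof (rule exI[of _ "x t0"], rule exI[of _ "{n. k ^ t0 * n + j t0 \<in> D}"],
      rule exI[of _ "{t \<in> UNIV. h t = h t0}"], rule exI[of _ j], intro conjI ballI)
    show "infinite {t \<in> UNIV. h t = h t0}" by (rule inf)
    show "x t0 \<in> carrier (Zb s p)" using jx[of t0] by (simp add: Pts_def)
    fix t assume "t \<in> {t \<in> UNIV. h t = h t0}"
    then have "x t = x t0" "{n. k ^ t * n + j t \<in> D} = {n. k ^ t0 * n + j t0 \<in> D}" by (simp_all add: h_def)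
    then show "j t < k ^ t" "shift k t (j t) (x t0) = \<theta>" "{n. k ^ t * n + j t \<in> D} = {n. k ^ t0 * n + j t0 \<in> D}"
      using jx[of t] by simp_all
  qed
qed

lemma W_affine: "W i t E = int t * (int (m i) * int (e i)) + (int (m i) * int E + c i)"
  by (simp add: W_def algebra_simps)

lemma root_structure:
  "\<exists>\<eta> q t0 t1 j0 j1. t0 < t1 \<and> j0 < k ^ t0 \<and> j1 < k ^ t1 \<and>
    q = of_nat (k ^ t0) * \<eta> + of_nat j0 \<and> q = of_nat (k ^ t1) * \<eta> + of_nat j1 \<and>
    (\<forall>i\<in>{1..s}. rge (p i) 0 \<eta> \<and> \<theta> i = io i q \<and> m i0 * e i0 * l i = m i * e i * l i0)"
proof -
  obtain y D' T j where y: "y \<in> carrier (Zb s p)" and T: "infinite T"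
    and tT: "\<And>t. t \<in> T \<Longrightarrow> j t < k ^ t \<and> shift k t (j t) y = \<theta> \<and> {n. k ^ t * n + j t \<in> D} = D'"
    using infinite_recurrence by blast
  obtain t0 where t0: "t0 \<in> T" using infinite_nat_ex_ge[OF T] by blast
  obtain t1 where t1: "t1 \<in> T" "t1 \<ge> Suc t0" using infinite_nat_ex_ge[OF T] by blast
  have lt: "t0 < t1" using t1 by simp
  define \<eta> :: rat where "\<eta> = (of_nat (j t0) - of_nat (j t1)) / (of_nat (k ^ t1) - of_nat (k ^ t0))"
  have "k ^ t0 < k ^ t1" using lt k by (intro power_strict_increasing) auto
  then have kk: "(of_nat (k ^ t1) - of_nat (k ^ t0) :: rat) \<noteq> 0" by (simp only: right_minus_eq of_nat_eq_iff)
  have yi: "y i = io i \<eta>" if i: "i \<in> {1..s}" for i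
  proof -
    interpret padic "p i" using padic i .
    have yc: "y i \<in> carrier (Q i)" using Qb_comp[OF Zb_Qb[OF y] i] .
    have "shift k t0 (j t0) y i = shift k t1 (j t1) y i" using tT[OF t0] tT[OF t1(1)] by simp
    then have eq: "io i (of_nat (k ^ t0)) \<otimes>\<^bsub>Q i\<^esub> y i \<oplus>\<^bsub>Q i\<^esub> io i (of_nat (j t0)) = io i (of_nat (k ^ t1)) \<otimes>\<^bsub>Q i\<^esub> y i \<oplus>\<^bsub>Q i\<^esub> io i (of_nat (j t1))"
      using i by (simp only: shift_def restrict_apply if_True)
    have alg: "(u \<ominus>\<^bsub>Q i\<^esub> v) \<otimes>\<^bsub>Q i\<^esub> z = a \<ominus>\<^bsub>Q i\<^esub> c" if "v \<otimes>\<^bsub>Q i\<^esub> z \<oplus>\<^bsub>Q i\<^esub> a = u \<otimes>\<^bsub>Q i\<^esub> z \<oplus>\<^bsub>Q i\<^esub> c"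
      "a \<in> carrier (Q i)" "c \<in> carrier (Q i)" "u \<in> carrier (Q i)" "v \<in> carrier (Q i)" "z \<in> carrier (Q i)" for a c u v z
    proof -
      have "(u \<ominus>\<^bsub>Q i\<^esub> v) \<otimes>\<^bsub>Q i\<^esub> z = (u \<otimes>\<^bsub>Q i\<^esub> z \<oplus>\<^bsub>Q i\<^esub> c) \<ominus>\<^bsub>Q i\<^esub> (v \<otimes>\<^bsub>Q i\<^esub> z) \<ominus>\<^bsub>Q i\<^esub> c" using that(2-) by algebra
      also have "\<dots> = (v \<otimes>\<^bsub>Q i\<^esub> z \<oplus>\<^bsub>Q i\<^esub> a) \<ominus>\<^bsub>Q i\<^esub> (v \<otimes>\<^bsub>Q i\<^esub> z) \<ominus>\<^bsub>Q i\<^esub> c" by (simp only: that(1))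
      also have "\<dots> = a \<ominus>\<^bsub>Q i\<^esub> c" using that(2-) by algebra
      finally show ?thesis .
    qed
    have "io i (of_nat (k ^ t1) - of_nat (k ^ t0)) \<otimes>\<^bsub>Q i\<^esub> y i = io i (of_nat (j t0) - of_nat (j t1))"
      unfolding iota_diff by (rule alg[OF eq]) (use yc in auto)
    also have "\<dots> = io i (of_nat (k ^ t1) - of_nat (k ^ t0)) \<otimes>\<^bsub>Q i\<^esub> io i \<eta>"
      unfolding iota_mult[symmetric] using kk by (simp add: \<eta>_def)
    finally show ?thesis 
      using Q.m_lcancel[OF iota_nonzero[OF kk] iota_closed yc iota_closed] by blast
  qed
  define q where "q = of_nat (k ^ t0) * \<eta> + of_nat (j t0)"
  have q1: "q = of_nat (k ^ t1) * \<eta> + of_nat (j t1)"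
  proof -
    have "(of_nat (k ^ t1) - of_nat (k ^ t0)) * \<eta> = of_nat (j t0) - of_nat (j t1)" using kk by (simp only: \<eta>_def) simp
    then show ?thesis by (simp add: q_def algebra_simps)
  qed
  have \<eta>Z: "rge (p i) 0 \<eta>" if i: "i \<in> {1..s}" for i
    using Zb_comp[OF y i] padic.iota_Ov[OF padic[OF i]] yi[OF i] by simp
  have \<theta>q: "\<theta> i = io i q" if i: "i \<in> {1..s}" for i
  proof -
    interpret padic "p i" using padic i .
    have "\<theta> i = shift k t0 (j t0) y i" using tT[OF t0] by simp
    then show ?thesis using i yi[OF i] by (simp only: shift_def restrict_apply if_True q_def iota_add iota_mult)
  qed
  have rel: "m i0 * e i0 * l i = m i * e i * l i0" if i: "i \<in> {1..s}" for i
  proof (cases "i = i0")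
    case False
    have trans: "(W i t E1 div int (l i) < W i0 t E0 div int (l i0)) \<longleftrightarrow> (W i t' E1 div int (l i) < W i0 t' E0 div int (l i0))"
      if t: "t \<in> T" "t' \<in> T" and E: "E0 \<ge> N i0" "E1 \<ge> N i" for t t' E0 E1
    proof -
      define B where "B = \<bar>W i0 t E0 div int (l i0)\<bar> + \<bar>W i0 t' E0 div int (l i0)\<bar>"
      define E where "E = (\<lambda>i'. if i' = i0 then E0 else if i' = i then E1 else N i' + nat (int (l i') * \<bar>B\<bar> + \<bar>c i'\<bar>))"
      have EN: "E i' \<ge> N i'" for i' using E by (simp add: E_def)
      obtain n where n: "\<And>i. i \<in> {1..s} \<Longrightarrow> io i (of_nat n) \<ominus>\<^bsub>Q i\<^esub> y i \<noteq> \<zero>\<^bsub>Q i\<^esub> \<and>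
        padic.pv (p i) (io i (of_nat n) \<ominus>\<^bsub>Q i\<^esub> y i) = int (E i)"
        using exact_approximation[OF y, of E] by blast
      have iff: "k ^ u * n + j u \<in> D \<longleftrightarrow> W i u E1 div int (l i) < W i0 u E0 div int (l i0)"
        if u: "u \<in> T" "W i0 u E0 div int (l i0) \<le> B" for u
      proof -
        have sh: "shift k u (j u) y = \<theta>" using tT[OF u(1)] by simp
        have big: "B \<le> W i' u (E i') div int (l i')" if "i' \<in> {1..s}" "i' \<noteq> i0" "i' \<noteq> i" for i'
          using that by (intro W_large) (simp_all add: E_def)
        have Ei: "E i0 = E0" "E i = E1" using False by (simp_all add: E_def)
        have "k ^ u * n + j u \<in> D \<longleftrightarrow> (\<exists>i'\<in>{1..s}. W i' u (E i') div int (l i') < W i0 u (E i0) div int (l i0))"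
          by (rule D_shift_iff[OF y sh n EN])
        also have "\<dots> \<longleftrightarrow> W i u E1 div int (l i) < W i0 u E0 div int (l i0)"
        proof
          assume "\<exists>i'\<in>{1..s}. W i' u (E i') div int (l i') < W i0 u (E i0) div int (l i0)"
          then obtain i' where i': "i' \<in> {1..s}" "W i' u (E i') div int (l i') < W i0 u (E i0) div int (l i0)" by blast
          then have "i' = i" using big[OF i'(1)] u(2) Ei by force
          then show "W i u E1 div int (l i) < W i0 u E0 div int (l i0)" using i'(2) Ei by simp
        next
          assume "W i u E1 div int (l i) < W i0 u E0 div int (l i0)"
          then show "\<exists>i'\<in>{1..s}. W i' u (E i') div int (l i') < W i0 u (E i0) div int (l i0)"
            using i Ei by (intro bexI[of _ i]) simp_all
        qed
        finally show ?thesis .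
      qed
      have "k ^ t * n + j t \<in> D \<longleftrightarrow> n \<in> D'" "k ^ t' * n + j t' \<in> D \<longleftrightarrow> n \<in> D'" using tT[OF t(1)] tT[OF t(2)] by blast+
      then show ?thesis using iff[OF t(1)] iff[OF t(2)] by (simp add: B_def)
    qed
    have li: "int (l i) > 0" "int (l i0) > 0" using l1[OF i] l1[OF i0] by auto
    have le1: "int (m i0) * int (e i0) * int (l i) \<le> int (m i) * int (e i) * int (l i0)"
    proof (rule slope_le[OF T li(2,1)])
      let ?B = "W i0 t0 (N i0) div int (l i0)"
      let ?E1 = "N i + nat (int (l i) * \<bar>?B\<bar> + \<bar>c i\<bar>)"
      have "?B \<le> W i t0 ?E1 div int (l i)" by (rule W_large[OF i]) simp
      then have "W i0 t (N i0) div int (l i0) \<le> W i t ?E1 div int (l i)" if "t \<in> T" for t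
        using trans[OF that t0, of "N i0" ?E1] by simp
      then show "(int t * (int (m i0) * int (e i0)) + (int (m i0) * int (N i0) + c i0)) div int (l i0)
          \<le> (int t * (int (m i) * int (e i)) + (int (m i) * int ?E1 + c i)) div int (l i)" if "t \<in> T" for t
        using that unfolding W_affine by blast
    qed
    have le2: "int (m i) * int (e i) * int (l i0) \<le> int (m i0) * int (e i0) * int (l i)"
    proof (rule slope_le[OF T li])
      let ?B = "W i t0 (N i) div int (l i) + 1"
      let ?E0 = "N i0 + nat (int (l i0) * \<bar>?B\<bar> + \<bar>c i0\<bar>)"
      have "?B \<le> W i0 t0 ?E0 div int (l i0)" by (rule W_large[OF i0]) simp
      then have "W i t (N i) div int (l i) \<le> W i0 t ?E0 div int (l i0)" if "t \<in> T" for t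
        using trans[OF that t0, of ?E0 "N i"] by simp
      then show "(int t * (int (m i) * int (e i)) + (int (m i) * int (N i) + c i)) div int (l i)
          \<le> (int t * (int (m i0) * int (e i0)) + (int (m i0) * int ?E0 + c i0)) div int (l i0)" if "t \<in> T" for t
        using that unfolding W_affine by blast
    qed
    have "int (m i0 * e i0 * l i) = int (m i * e i * l i0)" using le1 le2 by simp
    then show ?thesis by (simp only: of_nat_eq_iff)
  qed simp
  have jk: "j t0 < k ^ t0" "j t1 < k ^ t1" using tT[OF t0] tT[OF t1(1)] by blast+
  show ?thesis
    by (rule exI[of _ \<eta>], rule exI[of _ q], rule exI[of _ t0], rule exI[of _ t1], rule exI[of _ "j t0"], rule exI[of _ "j t1"])
      (intro conjI ballI lt jk q_def q1 \<eta>Z \<theta>q rel)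
qed

end

section \<open>Distinct multiplicities\<close>

context padic
begin

primrec esum :: "(nat \<Rightarrow> padic) \<Rightarrow> nat \<Rightarrow> rat \<Rightarrow> padic" where
  "esum \<delta> 0 z = \<delta> 0"
| "esum \<delta> (Suc d) z = esum \<delta> d z \<oplus>\<^bsub>Qp p\<^esub> \<delta> (Suc d) \<otimes>\<^bsub>Qp p\<^esub> \<iota> (z ^ Suc d)"

lemma esum_closed [simp]: "(\<And>h. \<delta> h \<in> carrier (Qp p)) \<Longrightarrow> esum \<delta> d z \<in> carrier (Qp p)"
  by (induction d) auto

lemma esum_add:
  assumes "\<And>h. \<delta> h \<in> carrier (Qp p)" "\<And>h. \<gamma> h \<in> carrier (Qp p)"
  shows "esum (\<lambda>h. \<delta> h \<oplus>\<^bsub>Qp p\<^esub> \<gamma> h) d z = esum \<delta> d z \<oplus>\<^bsub>Qp p\<^esub> esum \<gamma> d z"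
proof (induction d)
  case (Suc d)
  have "(a \<oplus>\<^bsub>Qp p\<^esub> c) \<oplus>\<^bsub>Qp p\<^esub> (u \<oplus>\<^bsub>Qp p\<^esub> v) \<otimes>\<^bsub>Qp p\<^esub> y = (a \<oplus>\<^bsub>Qp p\<^esub> u \<otimes>\<^bsub>Qp p\<^esub> y) \<oplus>\<^bsub>Qp p\<^esub> (c \<oplus>\<^bsub>Qp p\<^esub> v \<otimes>\<^bsub>Qp p\<^esub> y)"
    if "a \<in> carrier (Qp p)" "c \<in> carrier (Qp p)" "u \<in> carrier (Qp p)" "v \<in> carrier (Qp p)" "y \<in> carrier (Qp p)" for a c u v y
    using that by algebra
  from this[OF esum_closed[OF assms(1)] esum_closed[OF assms(2)] assms iota_closed] show ?case unfolding esum.simps Suc .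
qed simp

lemma esum_iota:
  assumes a: "a \<in> carrier (Qp p)"
  shows "esum (\<lambda>h. a \<otimes>\<^bsub>Qp p\<^esub> \<iota> (r h)) d z = a \<otimes>\<^bsub>Qp p\<^esub> \<iota> (\<Sum>h\<le>d. r h * z ^ h)"
proof (induction d)
  case (Suc d)
  then show ?case using a by (simp add: iota_add iota_mult Q.r_distr Q.m_assoc)
qed simp

lemma eval_esum:
  assumes "set g \<subseteq> carrier (Qp p)"
  shows "\<exists>\<delta> d0. (\<forall>h. \<delta> h \<in> carrier (Qp p)) \<and> \<delta> 0 = Q.eval g (\<iota> q) \<and>
    (\<forall>d\<ge>d0. \<forall>z. Q.eval g (\<iota> (w * z + q)) = esum \<delta> d z)"
  using assms
proof (induction g)
  case Nil
  have "esum (\<lambda>h. \<zero>\<^bsub>Qp p\<^esub>) d z = \<zero>\<^bsub>Qp p\<^esub>" for d z by (induction d) auto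
  then show ?case by (intro exI[of _ "\<lambda>h. \<zero>\<^bsub>Qp p\<^esub>"]) auto
next
  case (Cons a g)
  have a: "a \<in> carrier (Qp p)" and g: "set g \<subseteq> carrier (Qp p)" using Cons.prems by auto
  obtain \<delta> d0 where \<delta>: "\<And>h. \<delta> h \<in> carrier (Qp p)" "\<delta> 0 = Q.eval g (\<iota> q)"
    "\<And>d z. d \<ge> d0 \<Longrightarrow> Q.eval g (\<iota> (w * z + q)) = esum \<delta> d z" using Cons.IH[OF g] by blast
  define L where "L = length g"
  define r where "r h = of_nat (L choose h) * w ^ h * q ^ (L - h)" for h
  define \<delta>' where "\<delta>' = (\<lambda>h. a \<otimes>\<^bsub>Qp p\<^esub> \<iota> (r h) \<oplus>\<^bsub>Qp p\<^esub> \<delta> h)"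
  have "Q.eval (a # g) (\<iota> (w * z + q)) = esum \<delta>' d z" if d: "d \<ge> max d0 L" for d z
  proof -
    have "(w * z + q) ^ L = (\<Sum>h\<le>L. r h * z ^ h)"
      by (subst binomial_ring) (simp add: r_def power_mult_distrib algebra_simps)
    also have "\<dots> = (\<Sum>h\<le>d. r h * z ^ h)"
      using d by (intro sum.mono_neutral_left) (auto simp: r_def binomial_eq_0)
    finally have "a \<otimes>\<^bsub>Qp p\<^esub> \<iota> ((w * z + q) ^ L) = esum (\<lambda>h. a \<otimes>\<^bsub>Qp p\<^esub> \<iota> (r h)) d z" by (simp only: esum_iota[OF a])
    then show ?thesis using \<delta>(3)[of d z] d a \<delta>(1)
      by (simp add: \<delta>'_def esum_add L_def iota_pow)
  qed
  moreover have "\<delta>' 0 = Q.eval (a # g) (\<iota> q)" by (simp add: \<delta>'_def r_def \<delta>(2) L_def iota_pow)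
  moreover have "\<delta>' h \<in> carrier (Qp p)" for h using a \<delta>(1) by (simp add: \<delta>'_def)
  ultimately show ?case by blast
qed

lemma esum_twist:
  assumes \<delta>: "\<And>h. \<delta> h \<in> carrier (Qp p)"
  shows "esum \<delta> d (y * z) \<ominus>\<^bsub>Qp p\<^esub> \<iota> C \<otimes>\<^bsub>Qp p\<^esub> esum \<delta> d z = esum (\<lambda>h. \<delta> h \<otimes>\<^bsub>Qp p\<^esub> \<iota> (y ^ h - C)) d z"
proof (induction d)
  case 0
  have "a \<ominus>\<^bsub>Qp p\<^esub> c \<otimes>\<^bsub>Qp p\<^esub> a = a \<otimes>\<^bsub>Qp p\<^esub> (\<one>\<^bsub>Qp p\<^esub> \<ominus>\<^bsub>Qp p\<^esub> c)" if "a \<in> carrier (Qp p)" "c \<in> carrier (Qp p)" for a c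
    using that by (simp add: Q.minus_eq Q.r_distr Q.r_minus Q.m_comm)
  then show ?case using \<delta> by (simp add: iota_diff iota_1)
next
  case (Suc d)
  have "(a \<oplus>\<^bsub>Qp p\<^esub> x \<otimes>\<^bsub>Qp p\<^esub> (u \<otimes>\<^bsub>Qp p\<^esub> v)) \<ominus>\<^bsub>Qp p\<^esub> c \<otimes>\<^bsub>Qp p\<^esub> (f \<oplus>\<^bsub>Qp p\<^esub> x \<otimes>\<^bsub>Qp p\<^esub> v) =
    (a \<ominus>\<^bsub>Qp p\<^esub> c \<otimes>\<^bsub>Qp p\<^esub> f) \<oplus>\<^bsub>Qp p\<^esub> x \<otimes>\<^bsub>Qp p\<^esub> (u \<ominus>\<^bsub>Qp p\<^esub> c) \<otimes>\<^bsub>Qp p\<^esub> v"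
    if "a \<in> carrier (Qp p)" "x \<in> carrier (Qp p)" "u \<in> carrier (Qp p)" "v \<in> carrier (Qp p)" "c \<in> carrier (Qp p)" "f \<in> carrier (Qp p)"
    for a x u v c f using that by algebra
  from this[OF esum_closed[OF \<delta>] \<delta> iota_closed iota_closed iota_closed esum_closed[OF \<delta>]]
  show ?case unfolding esum.simps power_mult_distrib iota_mult iota_diff[of "y ^ Suc d"] using Suc by simp
qed

text \<open>The operator \<open>x\<^sub>\<tau> \<mapsto> R x\<^sub>\<tau>\<^sub>+\<^sub>1 - K\<^sup>d x\<^sub>\<tau>\<close> removes the term \<open>K\<^sup>d\<^sup>\<tau>\<close> of an exponential sum.\<close>

lemma exponential_elimination:
  assumes V: "subgroup V (add_monoid (Qp p))" and K: "(K::nat) \<ge> 2" and R: "(R::nat) \<ge> 1"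
    and \<delta>: "\<And>h. \<delta> h \<in> carrier (Qp p)"
    and mem: "\<And>\<tau>::nat. \<iota> (\<kappa> / of_nat R ^ \<tau>) \<otimes>\<^bsub>Qp p\<^esub> esum \<delta> d (of_nat K ^ \<tau>) \<in> V"
  shows "\<exists>c. c \<noteq> 0 \<and> (\<forall>\<tau>::nat. \<iota> (c * \<kappa> / of_nat R ^ \<tau>) \<otimes>\<^bsub>Qp p\<^esub> \<delta> 0 \<in> V)"
  using \<delta> mem
proof (induction d arbitrary: \<delta>)
  case 0
  then show ?case by (intro exI[of _ 1]) simp
next
  case (Suc d)
  have Vc: "x \<in> V \<Longrightarrow> x \<in> carrier (Qp p)" for x using subgroup.subset[OF V] by auto
  have Vadd: "x \<in> V \<Longrightarrow> y \<in> V \<Longrightarrow> x \<oplus>\<^bsub>Qp p\<^esub> y \<in> V" for x y using subgroup.m_closed[OF V] by simp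
  have Vdiff: "x \<in> V \<Longrightarrow> y \<in> V \<Longrightarrow> x \<ominus>\<^bsub>Qp p\<^esub> y \<in> V" for x y
    using subgroup.m_inv_closed[OF V] Vadd by (simp add: Q.minus_eq a_inv_def)
  have Vnat: "\<iota> (of_nat n) \<otimes>\<^bsub>Qp p\<^esub> x \<in> V" if x: "x \<in> V" for n x
  proof (induction n)
    case 0
    then show ?case using subgroup.one_closed[OF V] Vc[OF x] by (simp add: iota_0)
  next
    case (Suc n)
    then show ?case using Vadd[OF x] Vc[OF x] by (simp add: iota_add iota_1 Q.l_distr)
  qed
  define C :: rat where "C = of_nat (K ^ Suc d)"
  define \<delta>' where "\<delta>' = (\<lambda>h. \<delta> h \<otimes>\<^bsub>Qp p\<^esub> \<iota> (of_nat K ^ h - C))"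
  have \<delta>'c: "\<delta>' h \<in> carrier (Qp p)" for h using Suc.prems(1) by (simp add: \<delta>'_def)
  have "\<iota> (\<kappa> / of_nat R ^ \<tau>) \<otimes>\<^bsub>Qp p\<^esub> esum \<delta>' d (of_nat K ^ \<tau>) \<in> V" for \<tau>
  proof -
    let ?z = "of_nat K ^ \<tau> :: rat" and ?a = "\<iota> (\<kappa> / of_nat R ^ \<tau>)"
    have ec: "esum \<delta> e z \<in> carrier (Qp p)" "esum \<delta>' e z \<in> carrier (Qp p)" for e z
      using esum_closed Suc.prems(1) \<delta>'c by blast+
    have "\<iota> (of_nat R) \<otimes>\<^bsub>Qp p\<^esub> (\<iota> (\<kappa> / of_nat R ^ Suc \<tau>) \<otimes>\<^bsub>Qp p\<^esub> esum \<delta> (Suc d) (of_nat K ^ Suc \<tau>)) =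
        ?a \<otimes>\<^bsub>Qp p\<^esub> esum \<delta> (Suc d) (of_nat K ^ Suc \<tau>)"
    proof -
      have "(of_nat R * (\<kappa> / of_nat R ^ Suc \<tau>) :: rat) = \<kappa> / of_nat R ^ \<tau>" using R by (simp add: field_simps)
      then show ?thesis using ec(1)[of "Suc d" "of_nat K ^ Suc \<tau>"] by (simp only: Q.m_assoc[symmetric] iota_closed iota_mult[symmetric])
    qed
    then have 1: "?a \<otimes>\<^bsub>Qp p\<^esub> esum \<delta> (Suc d) (of_nat K ^ Suc \<tau>) \<in> V" using Vnat[OF Suc.prems(2)[of "Suc \<tau>"], of R] by simp
    have 2: "\<iota> C \<otimes>\<^bsub>Qp p\<^esub> (?a \<otimes>\<^bsub>Qp p\<^esub> esum \<delta> (Suc d) ?z) \<in> V" unfolding C_def by (rule Vnat[OF Suc.prems(2)])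
    have alg: "a \<otimes>\<^bsub>Qp p\<^esub> u \<ominus>\<^bsub>Qp p\<^esub> c \<otimes>\<^bsub>Qp p\<^esub> (a \<otimes>\<^bsub>Qp p\<^esub> v) = a \<otimes>\<^bsub>Qp p\<^esub> (u \<ominus>\<^bsub>Qp p\<^esub> c \<otimes>\<^bsub>Qp p\<^esub> v)"
      if "a \<in> carrier (Qp p)" "u \<in> carrier (Qp p)" "v \<in> carrier (Qp p)" "c \<in> carrier (Qp p)" for a u v c using that by algebra
    have "?a \<otimes>\<^bsub>Qp p\<^esub> (esum \<delta> (Suc d) (of_nat K * ?z) \<ominus>\<^bsub>Qp p\<^esub> \<iota> C \<otimes>\<^bsub>Qp p\<^esub> esum \<delta> (Suc d) ?z) \<in> V"
      using Vdiff[OF 1 2] unfolding alg[OF iota_closed ec(1) ec(1) iota_closed] power_Suc .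
    then have "?a \<otimes>\<^bsub>Qp p\<^esub> esum \<delta>' (Suc d) ?z \<in> V"
      unfolding esum_twist[OF Suc.prems(1)] \<delta>'_def .
    moreover have "esum \<delta>' (Suc d) ?z = esum \<delta>' d ?z"
    proof -
      have "\<delta>' (Suc d) = \<zero>\<^bsub>Qp p\<^esub>" using Suc.prems(1) by (simp add: \<delta>'_def C_def iota_0)
      then show ?thesis using ec by simp
    qed
    ultimately show ?thesis by simp
  qed
  from Suc.IH[OF \<delta>'c this] obtain c where c: "c \<noteq> 0" "\<And>\<tau>::nat. \<iota> (c * \<kappa> / of_nat R ^ \<tau>) \<otimes>\<^bsub>Qp p\<^esub> \<delta>' 0 \<in> V" by blast
  have "(1::nat) < K ^ Suc d" using K by (intro one_less_power) auto
  then have C1: "1 - C \<noteq> 0" unfolding C_def by (metis nat_neq_iff of_nat_1 of_nat_eq_iff right_minus_eq)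
  have "\<iota> (c * \<kappa> / of_nat R ^ \<tau>) \<otimes>\<^bsub>Qp p\<^esub> \<delta>' 0 = \<iota> ((c * (1 - C)) * \<kappa> / of_nat R ^ \<tau>) \<otimes>\<^bsub>Qp p\<^esub> \<delta> 0" for \<tau>
  proof -
    have "\<iota> (c * \<kappa> / of_nat R ^ \<tau>) \<otimes>\<^bsub>Qp p\<^esub> \<delta>' 0 = (\<iota> (c * \<kappa> / of_nat R ^ \<tau>) \<otimes>\<^bsub>Qp p\<^esub> \<iota> (1 - C)) \<otimes>\<^bsub>Qp p\<^esub> \<delta> 0"
      using Suc.prems(1)[of 0] by (simp add: \<delta>'_def Q.m_ac)
    also have "\<dots> = \<iota> ((c * \<kappa> / of_nat R ^ \<tau>) * (1 - C)) \<otimes>\<^bsub>Qp p\<^esub> \<delta> 0" by (simp only: iota_mult)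
    also have "(c * \<kappa> / of_nat R ^ \<tau>) * (1 - C) = (c * (1 - C)) * \<kappa> / of_nat R ^ \<tau>" by simp
    finally show ?thesis .
  qed
  then show ?case using c C1 by (intro exI[of _ "c * (1 - C)"]) (metis mult_eq_0_iff)
qed

lemma unbounded_denominators_not_fg:
  assumes T: "finite T" "T \<subseteq> carrier (Qp p)" and R: "(R::nat) \<ge> 2" and \<kappa>: "\<kappa> \<noteq> 0"
    and \<delta>: "\<delta> \<in> carrier (Qp p)" "\<delta> \<noteq> \<zero>\<^bsub>Qp p\<^esub>"
    and mem: "\<And>\<tau>::nat. \<iota> (\<kappa> / of_nat R ^ \<tau>) \<otimes>\<^bsub>Qp p\<^esub> \<delta> \<in> generate (add_monoid (Qp p)) T"
  shows False
proof -
  note G = Q.add.group_axioms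
  define u where "u r = \<iota> r \<otimes>\<^bsub>Qp p\<^esub> \<delta>" for r
  define H where "H B = {u (of_int z * \<kappa> / of_nat R ^ \<tau>) | z \<tau>. \<tau> \<le> B}" for B :: nat
  have uc: "u r \<in> carrier (Qp p)" for r using \<delta> by (simp add: u_def)
  have uadd: "u r \<oplus>\<^bsub>Qp p\<^esub> u t = u (r + t)" for r t using \<delta> by (simp add: u_def iota_add Q.l_distr)
  have uminus: "\<ominus>\<^bsub>Qp p\<^esub> u r = u (- r)" for r using \<delta> by (simp add: u_def iota_minus Q.l_minus)
  have uinj: "r = t" if "u r = u t" for r t
    using that \<delta> Q.m_rcancel[OF \<delta>(2,1) iota_closed iota_closed] by (simp add: u_def iota_inj)
  have R0: "(of_nat R :: rat) \<noteq> 0" using R by simp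
  have norm: "x \<in> H B \<Longrightarrow> \<exists>z. x = u (of_int z * \<kappa> / of_nat R ^ B)" for x B
  proof -
    assume "x \<in> H B"
    then obtain z \<tau> where z: "x = u (of_int z * \<kappa> / of_nat R ^ \<tau>)" "\<tau> \<le> B" by (auto simp: H_def)
    have "(of_nat R ^ B :: rat) = of_nat R ^ \<tau> * of_nat R ^ (B - \<tau>)" using z(2) by (simp flip: power_add)
    then have "of_int z * \<kappa> / of_nat R ^ \<tau> = of_int (z * int R ^ (B - \<tau>)) * \<kappa> / (of_nat R ^ B :: rat)"
      using R0 by simp
    then show ?thesis using z(1) by metis
  qed
  have sub: "subgroup (H B) (add_monoid (Qp p))" for B
  proof (rule group.subgroupI[OF G])
    show "H B \<subseteq> carrier (add_monoid (Qp p))" using uc by (auto simp: H_def)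
    show "H B \<noteq> {}" by (auto simp: H_def)
    fix x assume x: "x \<in> H B"
    then obtain z where z: "x = u (of_int z * \<kappa> / of_nat R ^ B)" using norm by blast
    have "\<ominus>\<^bsub>Qp p\<^esub> x = u (of_int (- z) * \<kappa> / of_nat R ^ B)" unfolding z uminus by simp
    then show "inv\<^bsub>add_monoid (Qp p)\<^esub> x \<in> H B" unfolding a_inv_def[symmetric] H_def by blast
    fix y assume "y \<in> H B"
    then obtain w where w: "y = u (of_int w * \<kappa> / of_nat R ^ B)" using norm by blast
    have "x \<oplus>\<^bsub>Qp p\<^esub> y = u (of_int (z + w) * \<kappa> / of_nat R ^ B)" unfolding z w uadd by (simp add: add_divide_distrib algebra_simps)
    then have "x \<oplus>\<^bsub>Qp p\<^esub> y \<in> H B" unfolding H_def by blast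
    then show "x \<otimes>\<^bsub>add_monoid (Qp p)\<^esub> y \<in> H B" by simp
  qed
  define HU where "HU = (\<Union>B. H B)"
  have mono: "H B \<subseteq> H B'" if "B \<le> B'" for B B' unfolding H_def using that by fastforce
  have subI: "subgroup HU (add_monoid (Qp p))"
  proof (rule group.subgroupI[OF G])
    show "HU \<subseteq> carrier (add_monoid (Qp p))" unfolding HU_def using subgroup.subset[OF sub] by blast
    show "HU \<noteq> {}" unfolding HU_def using subgroup.one_closed[OF sub] by blast
    fix x assume "x \<in> HU"
    then obtain B where B: "x \<in> H B" by (auto simp: HU_def)
    then show "inv\<^bsub>add_monoid (Qp p)\<^esub> x \<in> HU" using subgroup.m_inv_closed[OF sub] unfolding HU_def by blast
    fix y assume "y \<in> HU"
    then obtain B' where B': "y \<in> H B'" by (auto simp: HU_def)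
    have "x \<in> H (max B B')" "y \<in> H (max B B')" using B B' mono[of B "max B B'"] mono[of B' "max B B'"] by auto
    then show "x \<otimes>\<^bsub>add_monoid (Qp p)\<^esub> y \<in> HU" using subgroup.m_closed[OF sub] unfolding HU_def by blast
  qed
  have Tc: "T \<subseteq> carrier (add_monoid (Qp p))" using T(2) by simp
  have gT: "subgroup (generate (add_monoid (Qp p)) T) (add_monoid (Qp p))" by (rule group.generate_is_subgroup[OF G Tc])
  have inc: "HU \<subseteq> generate (add_monoid (Qp p)) T"
  proof
    fix x assume "x \<in> HU"
    then obtain z \<tau> where x: "x = u (of_int z * \<kappa> / of_nat R ^ \<tau>)" by (auto simp: HU_def H_def)
    define y where "y = u (\<kappa> / of_nat R ^ \<tau>)"
    have y: "y \<in> generate (add_monoid (Qp p)) T" using mem[of \<tau>] by (simp add: y_def u_def)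
    have nat: "u (of_nat n * (\<kappa> / of_nat R ^ \<tau>)) \<in> generate (add_monoid (Qp p)) T" for n
    proof (induction n)
      case 0
      have "u 0 = \<zero>\<^bsub>Qp p\<^esub>" using \<delta> by (simp add: u_def iota_0)
      then show ?case using subgroup.one_closed[OF gT] by simp
    next
      case (Suc n)
      have "u (of_nat (Suc n) * (\<kappa> / of_nat R ^ \<tau>)) = u (of_nat n * (\<kappa> / of_nat R ^ \<tau>)) \<oplus>\<^bsub>Qp p\<^esub> y"
        unfolding y_def uadd by (simp add: add_divide_distrib algebra_simps)
      then show ?case using subgroup.m_closed[OF gT Suc y] by simp
    qed
    show "x \<in> generate (add_monoid (Qp p)) T"
    proof (cases z rule: int_cases2)
      case (nonneg n)
      then show ?thesis using nat[of n] x by simp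
    next
      case (nonpos n)
      then have "x = \<ominus>\<^bsub>Qp p\<^esub> u (of_nat n * (\<kappa> / of_nat R ^ \<tau>))" using x by (simp add: uminus)
      then show ?thesis using subgroup.m_inv_closed[OF gT nat[of n]] by (simp add: a_inv_def)
    qed
  qed
  obtain T' where T': "finite T'" "T' \<subseteq> HU" "HU = generate (add_monoid (Qp p)) T'"
    using comm_group.subgroup_of_fg[OF Q.a_comm_group T(1) Tc subI inc] by blast
  have "\<exists>B. T' \<subseteq> H B" using T'(1,2)
  proof (induction T' rule: finite_induct)
    case (insert x T')
    then obtain B where B: "T' \<subseteq> H B" by blast
    obtain B' where B': "x \<in> H B'" using insert.prems by (auto simp: HU_def)
    have "insert x T' \<subseteq> H (max B B')" using B B' mono[of B "max B B'"] mono[of B' "max B B'"] by auto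
    then show ?case by blast
  qed auto
  then obtain B where B: "T' \<subseteq> H B" by blast
  have HB: "HU \<subseteq> H B" unfolding T'(3) by (rule group.generate_subgroup_incl[OF G B sub])
  have "u (of_int 1 * \<kappa> / of_nat R ^ Suc B) \<in> HU" unfolding HU_def H_def by blast
  then obtain z where "u (of_int 1 * \<kappa> / of_nat R ^ Suc B) = u (of_int z * \<kappa> / of_nat R ^ B)" using HB norm by blast
  then have "of_int 1 * \<kappa> / of_nat R ^ Suc B = (of_int z * \<kappa> / of_nat R ^ B :: rat)" by (rule uinj)
  then have "(1 :: rat) = of_int z * of_nat R" using R0 \<kappa> by (simp add: field_simps)
  then have "(of_int 1 :: rat) = of_int (z * int R)" by simp
  then have "z * int R = 1" by (simp only: of_int_eq_iff)
  then have "int R dvd 1" by (metis dvd_triv_right)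
  then show False using R by simp
qed

end

context near_root
begin

lemma e_pos_or_k1: "\<exists>i\<in>{1..s}. e i > 0"
proof (rule ccontr)
  assume "\<not> ?thesis"
  then have "(\<Prod>i=1..s. p i ^ e i) = 1" by (intro prod.neutral) simp
  then show False using k k_factorization by simp
qed

lemma k_power: "k ^ t = (\<Prod>i=1..s. p i ^ (e i * t))"
  using arg_cong[OF k_factorization, of "\<lambda>x. x ^ t"] by (simp only: prod_power_distrib power_mult)

lemma equal_multiplicities_dependent:
  assumes eq: "\<And>i. i \<in> {1..s} \<Longrightarrow> m i = m i0"
  shows "\<not> mult_independent b k"
proof -
  obtain \<eta> q t0 t1 j0 j1 where rel: "\<And>i. i \<in> {1..s} \<Longrightarrow> m i0 * e i0 * l i = m i * e i * l i0"
    using root_structure by blast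
  have rel': "e i * l i0 = l i * e i0" if "i \<in> {1..s}" for i
  proof -
    have "m i0 * (e i0 * l i) = m i0 * (e i * l i0)" using rel[OF that] eq[OF that] by (simp only: mult.assoc)
    then show ?thesis using m1[OF i0] by (simp add: mult.commute)
  qed
  have "k ^ l i0 = (\<Prod>i=1..s. p i ^ (e i * l i0))" by (rule k_power)
  also have "\<dots> = (\<Prod>i=1..s. p i ^ (l i * e i0))" by (intro prod.cong refl) (simp only: rel')
  also have "\<dots> = b ^ e i0" unfolding b_def by (simp only: prod_power_distrib power_mult)
  finally have kb: "k ^ l i0 = b ^ e i0" .
  have "e i0 \<ge> 1"
  proof -
    obtain i where i: "i \<in> {1..s}" "e i > 0" using e_pos_or_k1 by blast
    then have "l i * e i0 > 0" using rel'[OF i(1)] l1[OF i0] by (metis One_nat_def Suc_le_eq nat_0_less_mult_iff)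
    then show ?thesis by simp
  qed
  then show ?thesis using kb l1[OF i0] unfolding mult_independent_def by metis
qed

lemma multiplicities_equal:
  assumes min: "\<And>i. i \<in> {1..s} \<Longrightarrow> m i0 \<le> m i" and i: "i \<in> {1..s}"
  shows "m i = m i0"
proof (rule ccontr)
  assume ne: "m i \<noteq> m i0"
  obtain \<eta> q t0 t1 j0 j1 where t01: "t0 < t1" and j0: "j0 < k ^ t0" and j1: "j1 < k ^ t1"
    and q0: "q = of_nat (k ^ t0) * \<eta> + of_nat j0" and q1: "q = of_nat (k ^ t1) * \<eta> + of_nat j1"
    and \<eta>: "\<And>i. i \<in> {1..s} \<Longrightarrow> rge (p i) 0 \<eta>" and \<theta>q: "\<And>i. i \<in> {1..s} \<Longrightarrow> \<theta> i = io i q"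
    and rel: "\<And>i. i \<in> {1..s} \<Longrightarrow> m i0 * e i0 * l i = m i * e i * l i0"
    using root_structure by blast
  define \<Delta> where "\<Delta> = t1 - t0"
  have \<Delta>: "\<Delta> \<ge> 1" "t1 = t0 + \<Delta>" using t01 by (auto simp: \<Delta>_def)
  have k0: "(of_nat (k ^ t) :: rat) \<noteq> 0" for t using k by simp
  have jdiff: "(of_int (int j1 - int j0) :: rat) = of_nat (k ^ t0) * (of_int (1 - int (k ^ \<Delta>)) * \<eta>)"
    using q0 q1 by (simp add: \<Delta>(2) power_add algebra_simps)
  have "int (\<Prod>i=1..s. p i ^ (t0 * e i)) dvd int j1 - int j0"
  proof (rule prod_dvd_if_all_dvd)
    fix i assume i: "i \<in> {1..s}"
    have "rge (p i) (int t0 * int (e i)) (of_nat (k ^ t0))" using rat_val_k[OF i, of t0] by (simp add: rge_def)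
    then have "rge (p i) (int t0 * int (e i) + (0 + 0)) (of_int (int j1 - int j0))"
      unfolding jdiff by (intro rge_mult[OF primes[OF i]] rge_of_int[OF primes[OF i]] \<eta>[OF i])
    then have "rge (p i) (int (t0 * e i)) (of_int (int j1 - int j0))" by simp
    then show "int (p i) ^ (t0 * e i) dvd int j1 - int j0" unfolding rge_of_int_iff[OF primes[OF i]] .
  qed
  moreover have "(\<Prod>i=1..s. p i ^ (t0 * e i)) = k ^ t0" unfolding k_power by (simp only: mult.commute)
  ultimately have "int (k ^ t0) dvd int j1 - int j0" by (simp only:)
  then obtain J' where J': "int j1 - int j0 = int (k ^ t0) * J'" by (auto elim: dvdE)
  have kt0: "int (k ^ t0) > 0" using k by simp
  have "J' \<ge> 0"
  proof (rule ccontr)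
    assume "\<not> J' \<ge> 0"
    then have "int (k ^ t0) * J' \<le> int (k ^ t0) * (- 1)" using kt0 by (intro mult_left_mono) auto
    then show False using J' j0 by (simp del: of_nat_power)
  qed
  then obtain J where J: "J' = int J" using zero_le_imp_eq_int by blast
  have J1: "int j1 = int j0 + int (k ^ t0 * J)" using J' J by simp
  have Jlt: "J < k ^ \<Delta>"
  proof -
    have "k ^ t0 * J < k ^ t0 * k ^ \<Delta>" using J1 j1 unfolding \<Delta>(2) power_add by linarith
    then show ?thesis by simp
  qed
  have \<eta>J: "\<eta> = of_nat J + of_nat (k ^ \<Delta>) * \<eta>"
  proof -
    have "(of_int (int j1) :: rat) = of_int (int j0 + int (k ^ t0 * J))" by (simp only: J1)
    then have "(of_nat j1 :: rat) = of_nat j0 + of_nat (k ^ t0) * of_nat J" by simp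
    then have "of_nat (k ^ t0) * \<eta> = of_nat (k ^ t0) * (of_nat J + of_nat (k ^ \<Delta>) * \<eta>)"
      using q0 q1 by (simp add: \<Delta>(2) power_add algebra_simps)
    then show ?thesis using mult_left_cancel[OF k0[of t0]] by blast
  qed
  have jr: "\<exists>j<k ^ (t0 + r * \<Delta>). q = of_nat (k ^ (t0 + r * \<Delta>)) * \<eta> + of_nat j" for r
  proof (induction r)
    case 0
    then show ?case using j0 q0 by auto
  next
    case (Suc r)
    let ?t = "t0 + r * \<Delta>"
    obtain j where j: "j < k ^ ?t" "q = of_nat (k ^ ?t) * \<eta> + of_nat j" using Suc by blast
    have e: "k ^ (t0 + Suc r * \<Delta>) = k ^ ?t * k ^ \<Delta>" by (simp add: power_add algebra_simps)
    have "j + k ^ ?t * J < k ^ ?t * (J + 1)" using j(1) by simp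
    also have "\<dots> \<le> k ^ ?t * k ^ \<Delta>" using Jlt by (intro mult_left_mono) auto
    finally have lt: "j + k ^ ?t * J < k ^ (t0 + Suc r * \<Delta>)" unfolding e .
    have "q = of_nat (k ^ ?t) * (of_nat J + of_nat (k ^ \<Delta>) * \<eta>) + of_nat j" using j(2) by (simp only: \<eta>J[symmetric])
    also have "\<dots> = of_nat (k ^ (t0 + Suc r * \<Delta>)) * \<eta> + of_nat (j + k ^ ?t * J)" unfolding e by (simp add: algebra_simps)
    finally show ?case using lt by blast
  qed
  define l0 where "l0 = l i0"
  define t where "t \<tau> = t0 + (\<tau> * l0) * \<Delta>" for \<tau>
  have "\<forall>\<tau>. \<exists>j. j < k ^ t \<tau> \<and> q = of_nat (k ^ t \<tau>) * \<eta> + of_nat j" using jr unfolding t_def by blast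
  from choice[OF this] obtain j where "\<forall>\<tau>. j \<tau> < k ^ t \<tau> \<and> q = of_nat (k ^ t \<tau>) * \<eta> + of_nat (j \<tau>)" by blast
  then have j: "\<And>\<tau>. j \<tau> < k ^ t \<tau>" "\<And>\<tau>. q = of_nat (k ^ t \<tau>) * \<eta> + of_nat (j \<tau>)" by blast+
  define x where "x = (\<lambda>i\<in>{1..s}. io i \<eta>)"
  have x: "x \<in> carrier (Zb s p)" using \<eta> padic.iota_Ov[OF padic] by (simp add: x_def carrier_Zb PiE_iff)
  have sh: "shift k (t \<tau>) (j \<tau>) x = \<theta>" for \<tau>
  proof (rule Qb_eqI[OF Zb_Qb[OF shift_Zb[OF x]] Zb_Qb[OF theta_Zb]])
    fix i assume i: "i \<in> {1..s}"
    interpret padic "p i" using padic i .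
    have "shift k (t \<tau>) (j \<tau>) x i = io i (of_nat (k ^ t \<tau>) * \<eta> + of_nat (j \<tau>))"
      using i by (simp only: shift_def x_def restrict_apply if_True iota_add iota_mult)
    then show "shift k (t \<tau>) (j \<tau>) x i = \<theta> i" using \<theta>q[OF i] j(2)[of \<tau>] by (simp only:)
  qed
  obtain n where n: "\<And>i. i \<in> {1..s} \<Longrightarrow> io i (of_nat n) \<ominus>\<^bsub>Q i\<^esub> x i \<noteq> \<zero>\<^bsub>Q i\<^esub> \<and>
    padic.pv (p i) (io i (of_nat n) \<ominus>\<^bsub>Q i\<^esub> x i) = int (N i)"
    using exact_approximation[OF x, of N] by blast
  define y where "y \<tau> = k ^ t \<tau> * n + j \<tau>" for \<tau>
  define \<Lambda> where "\<Lambda> = m i0 * e i0 * \<Delta>"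
  have FV: "F (y \<tau>) i \<in> V i M \<longleftrightarrow> M \<le> W i (t \<tau>) (N i)" if i: "i \<in> {1..s}" for i M \<tau>
    unfolding y_def by (rule F_shift[OF x sh n order_refl i])
  have Fnz: "F (y \<tau>) \<noteq> \<zero>\<^bsub>Qb s p\<^esub>" for \<tau>
  proof
    assume "F (y \<tau>) = \<zero>\<^bsub>Qb s p\<^esub>"
    then have "F (y \<tau>) i0 \<in> V i0 (W i0 (t \<tau>) (N i0) + 1)" using Qb_zero(2)[OF i0] padic.Ov_zero[OF padic[OF i0]] by metis
    then show False using FV[OF i0] by simp
  qed
  have W\<tau>: "W i (t \<tau>) (N i) = W i (t 0) (N i) + int (l i) * (int \<tau> * int \<Lambda>)" if i: "i \<in> {1..s}" for i \<tau>
  proof -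
    have "m i * e i * l0 * \<Delta> = l i * \<Lambda>" using rel[OF i] by (simp add: \<Lambda>_def l0_def algebra_simps)
    then have "int (m i) * int (e i) * int l0 * int \<Delta> = int (l i) * int \<Lambda>" by (metis of_nat_mult)
    then have "int \<tau> * (int (m i) * int (e i) * int l0 * int \<Delta>) = int (l i) * (int \<tau> * int \<Lambda>)" by simp
    then show ?thesis unfolding W_affine t_def by (simp add: algebra_simps)
  qed
  have nuF: "nu (F (y \<tau>)) = nu (F (y 0)) + int \<tau> * int \<Lambda>" for \<tau>
  proof (rule nu_eqI[OF F_closed Fnz F_closed Fnz])
    fix i e assume i: "i \<in> {1..s}"
    show "F (y 0) i \<in> V i (int (l i) * e) \<longleftrightarrow> F (y \<tau>) i \<in> V i (int (l i) * (e + int \<tau> * int \<Lambda>))"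
      unfolding FV[OF i] W\<tau>[OF i, of \<tau>] by (simp add: algebra_simps)
  qed
  define R where "R = (\<Prod>i=1..s. p i ^ (e i * l0 * \<Delta> * (m i - m i0)))"
  define K where "K = k ^ (l0 * \<Delta>)"
  have bR: "b ^ \<Lambda> = R * K ^ m i0"
  proof -
    have "K ^ m i0 = k ^ (l0 * \<Delta> * m i0)" by (simp only: K_def power_mult)
    also have "\<dots> = (\<Prod>i=1..s. p i ^ (e i * l0 * \<Delta> * m i0))" unfolding k_power by (simp only: mult.assoc)
    finally have "K ^ m i0 = (\<Prod>i=1..s. p i ^ (e i * l0 * \<Delta> * m i0))" .
    then have "R * K ^ m i0 = (\<Prod>i=1..s. p i ^ (e i * l0 * \<Delta> * (m i - m i0)) * p i ^ (e i * l0 * \<Delta> * m i0))"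
      by (simp only: R_def prod.distrib)
    also have "\<dots> = (\<Prod>i=1..s. p i ^ (l i * \<Lambda>))"
    proof (rule prod.cong[OF refl])
      fix i assume i: "i \<in> {1..s}"
      have "e i * l0 * \<Delta> * (m i - m i0) + e i * l0 * \<Delta> * m i0 = e i * l0 * \<Delta> * m i"
        using min[OF i] by (simp flip: distrib_left)
      also have "\<dots> = l i * \<Lambda>" using rel[OF i] by (simp add: \<Lambda>_def l0_def algebra_simps)
      finally show "p i ^ (e i * l0 * \<Delta> * (m i - m i0)) * p i ^ (e i * l0 * \<Delta> * m i0) = p i ^ (l i * \<Lambda>)"
        by (simp only: power_add[symmetric])
    qed
    also have "\<dots> = b ^ \<Lambda>" unfolding b_def by (simp only: prod_power_distrib power_mult)
    finally show ?thesis by simp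
  qed
  have e1: "e i' \<ge> 1" if i': "i' \<in> {1..s}" for i'
  proof -
    obtain i2 where i2: "i2 \<in> {1..s}" "e i2 > 0" using e_pos_or_k1 by blast
    have "m i2 * e i2 * l i0 > 0" using i2 m1[OF i2(1)] l1[OF i0] by simp
    then have "e i0 > 0" using rel[OF i2(1)] by (metis mult_0 mult_0_right not_gr_zero)
    then have "m i0 * e i0 * l i' > 0" using m1[OF i0] l1[OF i'] by simp
    then have "e i' > 0" using rel[OF i'] by (metis mult_0 mult_0_right not_gr_zero)
    then show ?thesis by simp
  qed
  have l0: "l0 \<ge> 1" using l1[OF i0] by (simp add: l0_def)
  have R2: "R \<ge> 2"
  proof -
    have "e i * l0 * \<Delta> * (m i - m i0) \<noteq> 0" using e1[OF i] l0 \<Delta>(1) min[OF i] ne by simp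
    then have "p i dvd p i ^ (e i * l0 * \<Delta> * (m i - m i0))" by (rule dvd_power[OF disjI1, OF neq0_conv[THEN iffD1]])
    also have "\<dots> dvd R" unfolding R_def using i by (intro dvd_prodI) auto
    finally have "p i dvd R" .
    moreover have "R > 0" unfolding R_def using p_pos by (intro prod_pos) simp
    ultimately have "p i \<le> R" by (intro dvd_imp_le)
    then show ?thesis using prime_ge_2_nat[OF primes[OF i]] by simp
  qed
  have K2: "K \<ge> 2"
  proof -
    have "k ^ 1 \<le> K" unfolding K_def using k l0 \<Delta>(1) by (intro power_increasing) auto
    then show ?thesis using k by simp
  qed
  interpret padic "p i0" using padic i0 .
  define w :: rat where "w = of_nat (k ^ t0) * (of_nat n - \<eta>)"
  have w0: "w \<noteq> 0"
  proof -
    have "io i0 (of_nat n) \<ominus>\<^bsub>Q i0\<^esub> io i0 \<eta> \<noteq> \<zero>\<^bsub>Q i0\<^esub>" using n[OF i0] i0 by (simp only: x_def restrict_apply if_True) blast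
    then have "of_nat n - \<eta> \<noteq> 0" using iota_diff iota_0 by metis
    then show ?thesis using k0[of t0] unfolding w_def by (metis mult_eq_0_iff)
  qed
  have yq: "of_nat (y \<tau>) = w * of_nat K ^ \<tau> + q" for \<tau>
  proof -
    have "(of_nat (k ^ t \<tau>) :: rat) = of_nat (k ^ t0) * of_nat K ^ \<tau>"
      by (simp add: t_def K_def power_add power_mult[symmetric] algebra_simps)
    moreover have "of_nat (y \<tau>) = of_nat (k ^ t \<tau>) * (of_nat n - \<eta>) + q"
      using j(2)[of \<tau>] by (simp add: y_def algebra_simps)
    ultimately show ?thesis by (simp add: w_def)
  qed
  have thc: "\<theta> i0 \<in> carrier (Q i0)" using Qb_comp[OF Zb_Qb[OF theta_Zb] i0] .
  obtain g where g: "g \<in> carrier (poly_ring (Q i0))" "Q.eval g (\<theta> i0) \<noteq> \<zero>\<^bsub>Q i0\<^esub>"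
    and fg: "\<And>x. x \<in> carrier (Q i0) \<Longrightarrow> Q.eval (f i0) x = (x \<ominus>\<^bsub>Q i0\<^esub> \<theta> i0) [^]\<^bsub>Q i0\<^esub> (Q.alg_mult (f i0) (\<theta> i0)) \<otimes>\<^bsub>Q i0\<^esub> Q.eval g x"
    using eval_factor[OF f(1)[OF i0] f(2)[OF i0] thc] by blast
  obtain \<delta> d0 where \<delta>: "\<And>h. \<delta> h \<in> carrier (Q i0)" "\<delta> 0 = Q.eval g (io i0 q)"
    and ev: "\<And>d z. d \<ge> d0 \<Longrightarrow> Q.eval g (io i0 (w * z + q)) = esum \<delta> d z"
    using eval_esum[OF poly_set[OF g(1)], of q w] by blast
  define \<kappa> :: rat where "\<kappa> = of_nat b powi (- nu (F (y 0))) * w ^ m i0"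
  have b0: "(of_nat b :: rat) \<noteq> 0" using b_pos by simp
  have \<kappa>0: "\<kappa> \<noteq> 0" using b0 w0 by (simp add: \<kappa>_def)
  have val: "L_b s p l (F (y \<tau>)) i0 = io i0 (\<kappa> / of_nat R ^ \<tau>) \<otimes>\<^bsub>Q i0\<^esub> esum \<delta> d0 (of_nat K ^ \<tau>)" for \<tau>
  proof -
    let ?g = "Q.eval g (io i0 (of_nat (y \<tau>)))"
    have gc: "?g \<in> carrier (Q i0)" by (rule Q.eval_in_carrier[OF poly_set[OF g(1)] iota_closed])
    have "io i0 (of_nat (y \<tau>)) \<ominus>\<^bsub>Q i0\<^esub> \<theta> i0 = io i0 (w * of_nat K ^ \<tau>)"
      unfolding \<theta>q[OF i0] iota_diff[symmetric] yq by simp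
    then have "F (y \<tau>) i0 = io i0 ((w * of_nat K ^ \<tau>) ^ m i0) \<otimes>\<^bsub>Q i0\<^esub> ?g"
      using i0 fg[OF iota_closed, of "of_nat (y \<tau>)"] by (simp add: eval_tuple_def m_def iota_pow)
    then have "L_b s p l (F (y \<tau>)) i0 = (io i0 (of_nat b powi (- nu (F (y \<tau>)))) \<otimes>\<^bsub>Q i0\<^esub> io i0 ((w * of_nat K ^ \<tau>) ^ m i0)) \<otimes>\<^bsub>Q i0\<^esub> ?g"
      using L_b_comp[OF Fnz i0, of \<tau>] gc by (simp add: Q.m_assoc)
    also have "\<dots> = io i0 (of_nat b powi (- nu (F (y \<tau>))) * (w * of_nat K ^ \<tau>) ^ m i0) \<otimes>\<^bsub>Q i0\<^esub> ?g"
      by (simp only: iota_mult)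
    also have "of_nat b powi (- nu (F (y \<tau>))) * (w * of_nat K ^ \<tau>) ^ m i0 = \<kappa> / of_nat R ^ \<tau>"
    proof -
      have "- nu (F (y \<tau>)) = - nu (F (y 0)) - int (\<Lambda> * \<tau>)" using nuF[of \<tau>] by simp
      then have "(of_nat b :: rat) powi (- nu (F (y \<tau>))) = of_nat b powi (- nu (F (y 0))) / of_nat b powi (int (\<Lambda> * \<tau>))"
        using power_int_diff[of "of_nat b :: rat" "- nu (F (y 0))" "int (\<Lambda> * \<tau>)"] b0 by simp
      also have "(of_nat b :: rat) powi (int (\<Lambda> * \<tau>)) = (of_nat b ^ \<Lambda>) ^ \<tau>" by (simp only: power_int_of_nat power_mult)
      also have "(of_nat b :: rat) ^ \<Lambda> = of_nat R * of_nat K ^ m i0" using bR by (metis of_nat_mult of_nat_power)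
      finally have e: "of_nat b powi (- nu (F (y \<tau>))) = of_nat b powi (- nu (F (y 0))) / (of_nat R ^ \<tau> * (of_nat K ^ m i0) ^ \<tau> :: rat)"
        by (simp only: power_mult_distrib)
      have e2: "(w * of_nat K ^ \<tau>) ^ m i0 = w ^ m i0 * (of_nat K ^ m i0) ^ \<tau>"
        by (simp only: power_mult_distrib power_mult[symmetric] mult.commute)
      show ?thesis unfolding e e2 \<kappa>_def using K2 by simp
    qed
    also have "?g = esum \<delta> d0 (of_nat K ^ \<tau>)" unfolding yq by (rule ev) simp
    finally show ?thesis .
  qed
  obtain S where S: "finite S" "S \<subseteq> carrier (seq_group (Qb s p))"
    and Sk: "\<And>t j. j < k ^ t \<Longrightarrow> (\<lambda>n. L_b s p l (F (k ^ t * n + j))) \<in> generate (seq_group (Qb s p)) S"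
    using k_regularE[OF reg L_b_Zb[OF F_closed]] k by (metis One_nat_def Suc_1 Suc_leD)
  let ?h = "\<lambda>c :: nat \<Rightarrow> nat \<Rightarrow> padic. c n i0"
  have hom: "group_hom (seq_group (Qb s p)) (add_monoid (Q i0)) ?h"
  proof (intro group_hom.intro group_hom_axioms.intro homI)
    show "Group.group (seq_group (Qb s p))" by (rule SG.group_axioms)
    show "Group.group (add_monoid (Q i0))" by (rule Q.add.group_axioms)
    show "?h c \<in> carrier (add_monoid (Q i0))" if "c \<in> carrier (seq_group (Qb s p))" for c
      using that i0 unfolding mem_seq_Qb by simp
    show "?h (c \<otimes>\<^bsub>seq_group (Qb s p)\<^esub> d) = ?h c \<otimes>\<^bsub>add_monoid (Q i0)\<^esub> ?h d" for c d
      using i0 by (simp add: seq_mult)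
  qed
  have gen: "generate (add_monoid (Q i0)) (?h ` S) = ?h ` generate (seq_group (Qb s p)) S"
    using group_hom.generate_img[OF hom S(2)] by simp
  have hS: "?h ` S \<subseteq> carrier (Q i0)" using S(2) i0 unfolding subset_iff mem_seq_Qb by blast
  have sub: "subgroup (generate (add_monoid (Q i0)) (?h ` S)) (add_monoid (Q i0))"
    by (rule group.generate_is_subgroup[OF Q.add.group_axioms]) (use hS in simp)
  have mem: "io i0 (\<kappa> / of_nat R ^ \<tau>) \<otimes>\<^bsub>Q i0\<^esub> esum \<delta> d0 (of_nat K ^ \<tau>) \<in> generate (add_monoid (Q i0)) (?h ` S)" for \<tau>
    unfolding gen val[symmetric] y_def by (rule image_eqI[OF _ Sk[OF j(1)[of \<tau>]]]) simp
  obtain c where c: "c \<noteq> 0" "\<And>\<tau>::nat. io i0 (c * \<kappa> / of_nat R ^ \<tau>) \<otimes>\<^bsub>Q i0\<^esub> \<delta> 0 \<in> generate (add_monoid (Q i0)) (?h ` S)"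
    using exponential_elimination[OF sub K2 _ \<delta>(1) mem] R2 by auto
  have d00: "\<delta> 0 \<noteq> \<zero>\<^bsub>Q i0\<^esub>" using \<delta>(2) g(2) \<theta>q[OF i0] by simp
  have c\<kappa>: "c * \<kappa> \<noteq> 0" using c(1) \<kappa>0 by simp
  show False
    by (rule unbounded_denominators_not_fg[OF finite_imageI[OF S(1)] hS R2 c\<kappa> \<delta>(1) d00 c(2)])
qed

end

section \<open>The main theorem\<close>

context prime_powers
begin

lemma near_root_exists:
  assumes "s \<ge> 2" and f: "\<And>i. i \<in> {1..s} \<Longrightarrow> f i \<in> carrier (poly_ring (Q i))" "\<And>i. i \<in> {1..s} \<Longrightarrow> f i \<noteq> []"
    and \<theta>: "\<theta> \<in> Zb_roots s p f" and "k \<ge> 2" "k_regular (Zb s p) k (\<lambda>n. L_b s p l (eval_tuple s p f n))"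
    and "i0 \<in> {1..s}"
  shows "\<exists>N c. near_root s p l f \<theta> (\<lambda>i. ring.alg_mult (Q i) (f i) (\<theta> i)) N c k (\<lambda>i. multiplicity (p i) k) i0"
proof -
  have "\<forall>i\<in>{1..s}. \<exists>c N. \<forall>x\<in>V i 0. x \<ominus>\<^bsub>Q i\<^esub> \<theta> i \<in> V i (int N) \<longrightarrow> (\<forall>M. ring.eval (Q i) (f i) x \<in> V i M \<longleftrightarrow>
      x = \<theta> i \<or> M \<le> int (ring.alg_mult (Q i) (f i) (\<theta> i)) * padic.pv (p i) (x \<ominus>\<^bsub>Q i\<^esub> \<theta> i) + c)"
  proof
    fix i assume i: "i \<in> {1..s}"
    have "\<theta> i \<in> Zp_roots (p i) (f i)" using \<theta> i unfolding Zb_roots_def PiE_iff by blast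
    from padic.root_local(2)[OF padic[OF i] f(1)[OF i] this]
    show "\<exists>c N. \<forall>x\<in>V i 0. x \<ominus>\<^bsub>Q i\<^esub> \<theta> i \<in> V i (int N) \<longrightarrow> (\<forall>M. ring.eval (Q i) (f i) x \<in> V i M \<longleftrightarrow>
      x = \<theta> i \<or> M \<le> int (ring.alg_mult (Q i) (f i) (\<theta> i)) * padic.pv (p i) (x \<ominus>\<^bsub>Q i\<^esub> \<theta> i) + c)" .
  qed
  from bchoice[OF this] obtain c where c: "\<forall>i\<in>{1..s}. \<exists>N. \<forall>x\<in>V i 0. x \<ominus>\<^bsub>Q i\<^esub> \<theta> i \<in> V i (int N) \<longrightarrow> (\<forall>M. ring.eval (Q i) (f i) x \<in> V i M \<longleftrightarrow>
      x = \<theta> i \<or> M \<le> int (ring.alg_mult (Q i) (f i) (\<theta> i)) * padic.pv (p i) (x \<ominus>\<^bsub>Q i\<^esub> \<theta> i) + c i)" ..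
  from bchoice[OF this] obtain N where N: "\<forall>i\<in>{1..s}. \<forall>x\<in>V i 0. x \<ominus>\<^bsub>Q i\<^esub> \<theta> i \<in> V i (int (N i)) \<longrightarrow> (\<forall>M. ring.eval (Q i) (f i) x \<in> V i M \<longleftrightarrow>
      x = \<theta> i \<or> M \<le> int (ring.alg_mult (Q i) (f i) (\<theta> i)) * padic.pv (p i) (x \<ominus>\<^bsub>Q i\<^esub> \<theta> i) + c i)" ..
  have "near_root s p l f \<theta> (\<lambda>i. ring.alg_mult (Q i) (f i) (\<theta> i)) N c k (\<lambda>i. multiplicity (p i) k) i0"
  proof (intro near_root.intro near_root_axioms.intro)
    show "prime_powers s p l" by (rule prime_powers_axioms)
  qed (use assms N in blast)+
  then show ?thesis by blast
qed

lemma Zb_roots_update: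
  assumes "\<theta> \<in> Zb_roots s p f" "i \<in> {1..s}" "x \<in> Zp_roots (p i) (f i)"
  shows "\<theta>(i := x) \<in> Zb_roots s p f"
  using assms unfolding Zb_roots_def PiE_iff by (auto simp: extensional_def)

lemma Zb_roots_eq_diag:
  assumes \<theta>: "\<theta> \<in> Zb_roots s p f" and eq: "\<And>i. i \<in> {1..s} \<Longrightarrow> \<theta> i = io i q"
  shows "\<theta> = diag_rat s p q"
proof (rule extensionalityI[of _ "{1..s}"])
  show "\<theta> \<in> extensional {1..s}" using \<theta> unfolding Zb_roots_def PiE_iff by blast
  show "diag_rat s p q \<in> extensional {1..s}" by (simp add: diag_rat_def)
  show "\<theta> i = diag_rat s p q i" if "i \<in> {1..s}" for i using eq[OF that] that by (simp add: diag_rat_def)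
qed

lemma regular_imp_unique_rational_root:
  assumes s2: "s \<ge> 2" and f: "\<And>i. i \<in> {1..s} \<Longrightarrow> f i \<in> carrier (poly_ring (Q i))" "\<And>i. i \<in> {1..s} \<Longrightarrow> f i \<noteq> []"
    and ne: "Zb_roots s p f \<noteq> {}" and k: "k \<ge> 2" and reg: "k_regular (Zb s p) k (\<lambda>n. L_b s p l (eval_tuple s p f n))"
  shows "unique_rational_root s p f"
proof -
  have rational: "\<exists>q. \<forall>i\<in>{1..s}. \<theta> i = io i q" if \<theta>: "\<theta> \<in> Zb_roots s p f" for \<theta>
  proof -
    obtain i0 where i0: "i0 \<in> {1..s}" using s2 by force
    obtain N c where nr: "near_root s p l f \<theta> (\<lambda>i. ring.alg_mult (Q i) (f i) (\<theta> i)) N c k (\<lambda>i. multiplicity (p i) k) i0"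
      using near_root_exists[OF s2 f \<theta> k reg i0] by blast
    from near_root.root_structure[OF nr] show ?thesis by blast
  qed
  obtain \<theta> where \<theta>: "\<theta> \<in> Zb_roots s p f" using ne by blast
  obtain q where q: "\<And>i. i \<in> {1..s} \<Longrightarrow> \<theta> i = io i q" using rational[OF \<theta>] by blast
  have single: "\<theta>' = \<theta>" if \<theta>': "\<theta>' \<in> Zb_roots s p f" for \<theta>'
  proof (rule extensionalityI[of _ "{1..s}"])
    show "\<theta> \<in> extensional {1..s}" "\<theta>' \<in> extensional {1..s}" using \<theta> \<theta>' unfolding Zb_roots_def PiE_iff by blast+
    fix i assume i: "i \<in> {1..s}"
    define i' :: nat where "i' = (if i = 1 then 2 else 1)"
    have i': "i' \<in> {1..s}" "i' \<noteq> i" using s2 by (auto simp: i'_def)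
    have "\<theta>' i \<in> Zp_roots (p i) (f i)" using \<theta>' i unfolding Zb_roots_def PiE_iff by blast
    from rational[OF Zb_roots_update[OF \<theta> i this]] obtain q' where q': "\<forall>j\<in>{1..s}. (\<theta>(i := \<theta>' i)) j = io j q'" by blast
    have "io i' q = io i' q'" using bspec[OF q' i'(1)] i'(2) q[OF i'(1)] by simp
    then have "q = q'" using padic.iota_inj[OF padic[OF i'(1)]] by blast
    then show "\<theta>' i = \<theta> i" using bspec[OF q' i] q[OF i] by simp
  qed
  define i0 where "i0 = (ARG_MIN (\<lambda>i. ring.alg_mult (Q i) (f i) (\<theta> i)) i. i \<in> {1..s})"
  obtain i1 where i1: "i1 \<in> {1..s}" using s2 by force
  have i0: "i0 \<in> {1..s}" and min: "\<And>i. i \<in> {1..s} \<Longrightarrow> ring.alg_mult (Q i0) (f i0) (\<theta> i0) \<le> ring.alg_mult (Q i) (f i) (\<theta> i)"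
    unfolding i0_def using arg_min_nat_lemma[of "\<lambda>i. i \<in> {1..s}" i1 "\<lambda>i. ring.alg_mult (Q i) (f i) (\<theta> i)", OF i1] by blast+
  obtain N c where nr: "near_root s p l f \<theta> (\<lambda>i. ring.alg_mult (Q i) (f i) (\<theta> i)) N c k (\<lambda>i. multiplicity (p i) k) i0"
    using near_root_exists[OF s2 f \<theta> k reg i0] by blast
  have mult: "ring.alg_mult (Q i) (f i) (\<theta> i) = ring.alg_mult (Q i0) (f i0) (\<theta> i0)" if "i \<in> {1..s}" for i
    by (rule near_root.multiplicities_equal[OF nr min that])
  have d: "\<theta> = diag_rat s p q" by (rule Zb_roots_eq_diag[OF \<theta> q])
  have "ring.alg_mult (Q i) (f i) (io i q) = ring.alg_mult (Q j) (f j) (io j q)" if "i \<in> {1..s}" "j \<in> {1..s}" for i j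
    using mult[OF that(1)] mult[OF that(2)] q[OF that(1)] q[OF that(2)] by simp
  moreover have "diag_rat s p q \<in> carrier (Zb s p)" using near_root.theta_Zb[OF nr] d by simp
  moreover have "Zb_roots s p f = {diag_rat s p q}" using single \<theta> d by blast
  ultimately show ?thesis unfolding unique_rational_root_def by blast
qed

lemma unique_rational_root_imp_strictly_regular:
  assumes s2: "s \<ge> 2" and f: "\<And>i. i \<in> {1..s} \<Longrightarrow> f i \<in> carrier (poly_ring (Q i))" "\<And>i. i \<in> {1..s} \<Longrightarrow> f i \<noteq> []"
    and un: "unique_rational_root s p f"
  shows "strictly_k_regular (Zb s p) b (\<lambda>n. L_b s p l (eval_tuple s p f n))"
proof -
  obtain q where qZ: "diag_rat s p q \<in> carrier (Zb s p)" and roots: "Zb_roots s p f = {diag_rat s p q}"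
    and mult: "\<forall>i\<in>{1..s}. \<forall>j\<in>{1..s}. ring.alg_mult (Q i) (f i) (io i q) = ring.alg_mult (Q j) (f j) (io j q)"
    using un unfolding unique_rational_root_def by blast
  define \<theta> where "\<theta> = diag_rat s p q"
  have \<theta>: "\<theta> \<in> Zb_roots s p f" using roots by (simp add: \<theta>_def)
  have \<theta>i: "\<theta> i = io i q" if "i \<in> {1..s}" for i using that by (simp add: \<theta>_def diag_rat_def)
  obtain i0 where i0: "i0 \<in> {1..s}" using s2 by force
  define m where "m = ring.alg_mult (Q i0) (f i0) (io i0 q)"
  have mi: "ring.alg_mult (Q i) (f i) (io i q) = m" if "i \<in> {1..s}" for i using mult that i0 unfolding m_def by blast
  have root: "io i q \<in> Zp_roots (p i) (f i)" if i: "i \<in> {1..s}" for i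
  proof -
    have "\<theta> i \<in> Zp_roots (p i) (f i)" using \<theta> i unfolding Zb_roots_def PiE_iff by blast
    then show ?thesis by (simp only: \<theta>i[OF i])
  qed
  have q0: "rge (p i) 0 q" if i: "i \<in> {1..s}" for i
    using Zb_comp[OF qZ i] \<theta>i[OF i] padic.iota_Ov[OF padic[OF i]] by (simp add: \<theta>_def)
  have m1: "m \<ge> 1" using padic.root_local(1)[OF padic[OF i0] f(1)[OF i0] root[OF i0]] by (simp add: m_def)
  have "\<exists>g C. g \<in> carrier (poly_ring (Q i)) \<and> ring.eval (Q i) g (io i q) \<noteq> \<zero>\<^bsub>Q i\<^esub> \<and>
      (\<forall>n::nat. ring.eval (Q i) g (io i (of_nat n)) \<notin> V i C \<and>
        ring.eval (Q i) (f i) (io i (of_nat n)) = io i ((of_nat n - q) ^ m) \<otimes>\<^bsub>Q i\<^esub> ring.eval (Q i) g (io i (of_nat n)))"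
    if i: "i \<in> {1..s}" for i
  proof -
    interpret padic "p i" using padic i .
    obtain g where g: "g \<in> carrier (poly_ring (Q i))" "Q.eval g (io i q) \<noteq> \<zero>\<^bsub>Q i\<^esub>"
      and fg: "\<And>x. x \<in> carrier (Q i) \<Longrightarrow> Q.eval (f i) x = (x \<ominus>\<^bsub>Q i\<^esub> io i q) [^]\<^bsub>Q i\<^esub> (Q.alg_mult (f i) (io i q)) \<otimes>\<^bsub>Q i\<^esub> Q.eval g x"
      using eval_factor[OF f(1)[OF i] f(2)[OF i] iota_closed[of q]] by blast
    have gn: "g \<noteq> []" using g(2) by auto
    have "Zp_roots (p i) g = {}"
    proof (rule ccontr)
      assume "Zp_roots (p i) g \<noteq> {}"
      then obtain x where x: "x \<in> carrier (Zp (p i))" "x \<in> carrier (Q i)" "Q.eval g x = \<zero>\<^bsub>Q i\<^esub>"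
        by (auto simp: Zp_roots_def Q.is_root_def)
      have "Q.eval (f i) x = \<zero>\<^bsub>Q i\<^esub>" using fg[OF x(2)] x by simp
      then have "x \<in> Zp_roots (p i) (f i)" using x f(2)[OF i] by (simp add: Zp_roots_def Q.is_root_def)
      then have "\<theta>(i := x) = \<theta>" using Zb_roots_update[OF \<theta> i] roots by (simp add: \<theta>_def)
      then have "x = io i q" using \<theta>i[OF i] by (metis fun_upd_same)
      then show False using x(3) g(2) by simp
    qed
    then obtain C where C: "\<And>n::nat. Q.eval g (io i (of_nat n)) \<notin> V i C"
      using val_bounded_if_no_root[OF g(1) gn] by metis
    have "Q.eval (f i) (io i (of_nat n)) = io i ((of_nat n - q) ^ m) \<otimes>\<^bsub>Q i\<^esub> Q.eval g (io i (of_nat n))" for n :: nat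
      using fg[OF iota_closed] mi[OF i] by (simp only: iota_pow iota_diff)
    then show ?thesis using g C by blast
  qed
  then have "\<forall>i\<in>{1..s}. \<exists>gC. fst gC \<in> carrier (poly_ring (Q i)) \<and> ring.eval (Q i) (fst gC) (io i q) \<noteq> \<zero>\<^bsub>Q i\<^esub> \<and>
      (\<forall>n::nat. ring.eval (Q i) (fst gC) (io i (of_nat n)) \<notin> V i (snd gC) \<and>
        ring.eval (Q i) (f i) (io i (of_nat n)) = io i ((of_nat n - q) ^ m) \<otimes>\<^bsub>Q i\<^esub> ring.eval (Q i) (fst gC) (io i (of_nat n)))"
    by simp
  from bchoice[OF this] obtain gC where gC: "\<forall>i\<in>{1..s}. fst (gC i) \<in> carrier (poly_ring (Q i)) \<and> ring.eval (Q i) (fst (gC i)) (io i q) \<noteq> \<zero>\<^bsub>Q i\<^esub> \<and>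
      (\<forall>n::nat. ring.eval (Q i) (fst (gC i)) (io i (of_nat n)) \<notin> V i (snd (gC i)) \<and>
        ring.eval (Q i) (f i) (io i (of_nat n)) = io i ((of_nat n - q) ^ m) \<otimes>\<^bsub>Q i\<^esub> ring.eval (Q i) (fst (gC i)) (io i (of_nat n)))" ..
  have reg: "k_regular (Zb s p) b (\<lambda>n. L_b s p l (eval_tuple s p f n))"
    by (rule unique_root_regular[where g = "\<lambda>i. fst (gC i)" and C = "\<lambda>i. snd (gC i)" and q = q and m = m, OF _ f(1) q0 m1])
      (use gC in blast)+
  have "\<not> k_regular (Zb s p) k (\<lambda>n. L_b s p l (eval_tuple s p f n))" if k: "k \<ge> 2" and ind: "mult_independent b k" for k
  proof
    assume "k_regular (Zb s p) k (\<lambda>n. L_b s p l (eval_tuple s p f n))"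
    then obtain N c where nr: "near_root s p l f \<theta> (\<lambda>i. ring.alg_mult (Q i) (f i) (\<theta> i)) N c k (\<lambda>i. multiplicity (p i) k) i0"
      using near_root_exists[OF s2 f \<theta> k _ i0] by blast
    have "ring.alg_mult (Q i) (f i) (\<theta> i) = ring.alg_mult (Q i0) (f i0) (\<theta> i0)" if "i \<in> {1..s}" for i
      using mi[OF that] mi[OF i0] \<theta>i[OF that] \<theta>i[OF i0] by simp
    from near_root.equal_multiplicities_dependent[OF nr this] ind show False by blast
  qed
  then show ?thesis using reg unfolding strictly_k_regular_def by blast
qed

end

theorem theorem2p6:
  fixes s b :: nat and p l :: "nat \<Rightarrow> nat" and f :: "nat \<Rightarrow> padic list"
  assumes "s \<ge> 2"
    and "\<And>i. i \<in> {1..s} \<Longrightarrow> Factorial_Ring.prime (p i)"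
    and "inj_on p {1..s}"
    and "\<And>i. i \<in> {1..s} \<Longrightarrow> l i \<ge> 1"
    and "b = (\<Prod>i=1..s. p i ^ l i)"
    and "\<And>i. i \<in> {1..s} \<Longrightarrow> f i \<in> carrier (poly_ring (Qp (p i)))"
    and "\<And>i. i \<in> {1..s} \<Longrightarrow> f i \<noteq> \<zero>\<^bsub>poly_ring (Qp (p i))\<^esub>"
  shows "(\<forall>n. L_b s p l (eval_tuple s p f n) \<in> carrier (Zb s p)) \<and>
    (Zb_roots s p f = {} \<longrightarrow>
       (\<forall>k\<ge>2. k_regular (Zb s p) k (\<lambda>n. L_b s p l (eval_tuple s p f n)))) \<and>
    (unique_rational_root s p f \<longrightarrow>
       strictly_k_regular (Zb s p) b (\<lambda>n. L_b s p l (eval_tuple s p f n))) \<and>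
    (Zb_roots s p f \<noteq> {} \<and> \<not> unique_rational_root s p f \<longrightarrow>
       \<not> regular (Zb s p) (\<lambda>n. L_b s p l (eval_tuple s p f n)))"
proof -
  interpret prime_powers s p l
    using assms(1-4) by unfold_locales auto
  have b: "b = prime_powers.b s p l" using assms(5) by (simp add: b_def)
  have f: "f i \<in> carrier (poly_ring (Qp (p i)))" "f i \<noteq> []" if "i \<in> {1..s}" for i
    using assms(6,7)[OF that] by (simp_all add: univ_poly_zero)
  have f_set: "set (f i) \<subseteq> carrier (Qp (p i))" if "i \<in> {1..s}" for i
    using padic.poly_set[OF padic[OF that] f(1)[OF that]] .
  show ?thesis
  proof (intro conjI allI impI)
    show "L_b s p l (eval_tuple s p f n) \<in> carrier (Zb s p)" for n
      by (rule L_b_Zb[OF eval_tuple_Qb[OF f_set]])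
    show "k_regular (Zb s p) k (\<lambda>n. L_b s p l (eval_tuple s p f n))" if "Zb_roots s p f = {}" "2 \<le> k" for k
      by (rule k_regular_if_no_root[OF f that(1)]) (use that(2) in simp_all)
    show "strictly_k_regular (Zb s p) b (\<lambda>n. L_b s p l (eval_tuple s p f n))" if "unique_rational_root s p f"
      unfolding b by (rule unique_rational_root_imp_strictly_regular[OF assms(1) f that])
    show "\<not> regular (Zb s p) (\<lambda>n. L_b s p l (eval_tuple s p f n))"
      if "Zb_roots s p f \<noteq> {} \<and> \<not> unique_rational_root s p f"
      unfolding regular_def using regular_imp_unique_rational_root[OF assms(1) f] that by blast
  qed
qed

end
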